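(* Let $X_\sigma$ be a normal affine toric surface. Then there exists a non-normal affine toric surface $X_S$ whose normalization is $X_\sigma$ and such that $\operatorname{Aut}(X_\sigma)=\operatorname{Aut}(X_S)$ if and only if $X_\sigma$ is different from (i.e. not isomorphic to) $\mathbb{G}_m^2$, $\mathbb{G}_m\times\mathbb{A}^1$ and $\mathbb{A}^2$.
   Context: The base field $\mathbf{k}$ is algebraically closed of characteristic $0$; $\mathbb{G}_m$ is the multiplicative group and $\mathbb{A}^n$ the affine space over $\mathbf{k}$. An affine toric variety is an irreducible affine variety $X$ containing an algebraic torus $T\simeq\mathbb{G}_m^n$ as a Zariski open subset such that the action of $T$ on itself by translation extends to an algebraic action of $T$ on $X$ (normality is not assumed); it is a surface if $n=2$. An affine monoid is a finitely generated commutative monoid $S$ that embeds in $\mathbb{Z}^n$ for some $n\ge 0$; $M$ denotes the group generated by $S$. Every affine toric variety is of the form $X_S=\operatorname{Spec}\mathbf{k}[S]$ with $S$ an affine monoid and acting torus $\operatorname{Spec}\mathbf{k}[M]$. Put $N=\operatorname{Hom}(M,\mathbb{Z})$, $N_{\mathbb{Q}}=N\otimes\mathbb{Q}$, $M_{\mathbb{Q}}=M\otimes\mathbb{Q}$, $\sigma=\{u\in N_{\mathbb{Q}}\mid u(m)\ge 0\text{ for all }m\in S\}$ and $\sigma^\vee=\{m\in M_{\mathbb{Q}}\mid u(m)\ge 0\text{ for all }u\in\sigma\}$. The normalization of $X_S$ is $X_\sigma:=X_{\sigma^\vee\cap M}$, via the morphism induced by the inclusion $S\hookrightarrow\sigma^\vee\cap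 M$; normal affine toric varieties are exactly the $X_\sigma$ for $\sigma$ a strongly convex rational polyhedral cone. $\operatorname{Aut}(\cdot)$ is the group of automorphisms of the algebraic variety (not necessarily toric). By the universal property of normalization every automorphism of $X_S$ lifts to an automorphism of $X_\sigma$, so $\operatorname{Aut}(X_S)$ is regarded as a subgroup of $\operatorname{Aut}(X_\sigma)$ (both inside the group of birational self-maps); the equality $\operatorname{Aut}(X_\sigma)=\operatorname{Aut}(X_S)$ means that this inclusion is an equality. *)

theory Defs
  imports "HOL-Library.Poly_Mapping" "HOL-Library.Product_Plus" "HOL-Library.FuncSet"
    "HOL-Computational_Algebra.Polynomial"
begin

text \<open>
  Over an algebraically closed field an affine variety is determined by its set of (closed)
  points together with its algebra of regular functions, and a morphism is a map of points
  that pulls regular functions back to regular functions.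

  Only the values on \<open>points X\<close> matter: throughout, \<open>reg_fun X\<close> consists of all
  total functions whose restriction to \<open>points X\<close> is regular, and the
  coordinate ring is \<open>reg_fun X\<close> modulo agreement on \<open>points X\<close>.
\<close>

record ('p, 'k) variety =
  points :: "'p set"
  reg_fun :: "('p \<Rightarrow> 'k) set"

definition morphism ::
  "('p, 'k) variety \<Rightarrow> ('q, 'k) variety \<Rightarrow> ('p \<Rightarrow> 'q) \<Rightarrow> bool" where
  "morphism X Y \<phi> \<longleftrightarrow>
     \<phi> ` points X \<subseteq> points Y \<and> (\<forall>F\<in>reg_fun Y. F \<circ> \<phi> \<in> reg_fun X)"

definition inverse_morphisms ::
  "('p, 'k) variety \<Rightarrow> ('q, 'k) variety \<Rightarrow> ('p \<Rightarrow> 'q) \<Rightarrow> ('q \<Rightarrow> 'p) \<Rightarrow> bool" where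
  "inverse_morphisms X Y \<phi> \<psi> \<longleftrightarrow>
     morphism X Y \<phi> \<and> morphism Y X \<psi> \<and>
     (\<forall>x\<in>points X. \<psi> (\<phi> x) = x) \<and> (\<forall>y\<in>points Y. \<phi> (\<psi> y) = y)"

definition isomorphic :: "('p, 'k) variety \<Rightarrow> ('q, 'k) variety \<Rightarrow> bool" where
  "isomorphic X Y \<longleftrightarrow> (\<exists>\<phi> \<psi>. inverse_morphisms X Y \<phi> \<psi>)"

text \<open>Extensionality makes an element of \<open>Aut X\<close> determined by its values on the points of X.\<close>

definition Aut :: "('p, 'k) variety \<Rightarrow> ('p \<Rightarrow> 'p) set" where
  "Aut X = {\<phi> \<in> extensional (points X). \<exists>\<psi>. inverse_morphisms X X \<phi> \<psi>}"

text \<open>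
  Normality of an irreducible affine variety: its coordinate ring is integrally closed in
  its field of fractions.  The equation says that the fraction a/b is a root of the monic
  polynomial with coefficients \<open>c 0, \<dots>, c (n - 1)\<close>, multiplied by \<open>b ^ n\<close>.
\<close>

definition normal_variety :: "('p, 'k::field) variety \<Rightarrow> bool" where
  "normal_variety X \<longleftrightarrow>
     (\<forall>a\<in>reg_fun X. \<forall>b\<in>reg_fun X.
        (\<exists>x\<in>points X. b x \<noteq> 0) \<and>
        (\<exists>n c. (\<forall>i<n. c i \<in> reg_fun X) \<and>
           (\<forall>x\<in>points X. a x ^ n + (\<Sum>i<n. c i x * a x ^ i * b x ^ (n - i)) = 0))
        \<longrightarrow> (\<exists>q\<in>reg_fun X. \<forall>x\<in>points X. a x = q x * b x))"

text \<open>
  The morphism \<open>\<nu>\<close> is finite: the coordinate ring of X is a finitely generated module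
  over that of Y.
\<close>

definition finite_morphism ::
  "('p, 'k::field) variety \<Rightarrow> ('q, 'k) variety \<Rightarrow> ('p \<Rightarrow> 'q) \<Rightarrow> bool" where
  "finite_morphism X Y \<nu> \<longleftrightarrow> morphism X Y \<nu> \<and>
     (\<exists>G. finite G \<and> G \<subseteq> reg_fun X \<and>
        (\<forall>f\<in>reg_fun X. \<exists>c. (\<forall>g\<in>G. c g \<in> reg_fun Y) \<and>
           (\<forall>x\<in>points X. f x = (\<Sum>g\<in>G. c g (\<nu> x) * g x))))"

text \<open>
  For irreducible X and Y: the pull-back along \<open>\<nu>\<close> is injective on coordinate rings and induces
  an isomorphism of fields of fractions.
\<close>

definition birational_morphism ::
  "('p, 'k::field) variety \<Rightarrow> ('q, 'k) variety \<Rightarrow> ('p \<Rightarrow> 'q) \<Rightarrow> bool" where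
  "birational_morphism X Y \<nu> \<longleftrightarrow> morphism X Y \<nu> \<and>
     (\<forall>F\<in>reg_fun Y. (\<forall>x\<in>points X. F (\<nu> x) = 0) \<longrightarrow> (\<forall>y\<in>points Y. F y = 0)) \<and>
     (\<forall>f\<in>reg_fun X. \<exists>a\<in>reg_fun Y. \<exists>b\<in>reg_fun Y.
        (\<exists>y\<in>points Y. b y \<noteq> 0) \<and> (\<forall>x\<in>points X. f x * b (\<nu> x) = a (\<nu> x)))"

definition is_normalization ::
  "('p, 'k::field) variety \<Rightarrow> ('q, 'k) variety \<Rightarrow> ('p \<Rightarrow> 'q) \<Rightarrow> bool" where
  "is_normalization X Y \<nu> \<longleftrightarrow>
     normal_variety X \<and> finite_morphism X Y \<nu> \<and> birational_morphism X Y \<nu>"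

text \<open>
  For a normalization \<open>\<nu>\<close> from X to Y, every automorphism of Y has a unique lift
  to X; the following is the image of the resulting embedding of \<open>Aut Y\<close> into \<open>Aut X\<close>.
\<close>

definition lifted_Aut ::
  "('p, 'k) variety \<Rightarrow> ('q, 'k) variety \<Rightarrow> ('p \<Rightarrow> 'q) \<Rightarrow> ('p \<Rightarrow> 'p) set" where
  "lifted_Aut X Y \<nu> =
     {\<phi> \<in> Aut X. \<exists>\<psi>\<in>Aut Y. \<forall>x\<in>points X. \<nu> (\<phi> x) = \<psi> (\<nu> x)}"

definition affine_line :: "('k::field, 'k) variety" where
  "affine_line = \<lparr>points = UNIV, reg_fun = {F. \<exists>p. \<forall>t. F t = poly p t}\<rparr>"

definition mult_group :: "('k::field, 'k) variety" where
  "mult_group = \<lparr>points = UNIV - {0},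
     reg_fun = {F. \<exists>p n. \<forall>t. t \<noteq> 0 \<longrightarrow> F t = poly p t / t ^ n}\<rparr>"

text \<open>The coordinate ring of a product is the tensor product of the coordinate rings.\<close>

definition variety_product ::
  "('p, 'k::field) variety \<Rightarrow> ('q, 'k) variety \<Rightarrow> ('p \<times> 'q, 'k) variety" (infixr \<open>\<times>\<^sub>v\<close> 80) where
  "X \<times>\<^sub>v Y = \<lparr>points = points X \<times> points Y,
     reg_fun = {F. \<exists>(n::nat) f g. (\<forall>i<n. f i \<in> reg_fun X \<and> g i \<in> reg_fun Y) \<and>
       (\<forall>x\<in>points X. \<forall>y\<in>points Y. F (x, y) = (\<Sum>i<n. f i x * g i y))}\<rparr>"

text \<open>
  In dimension 2 the lattice M has rank 2; a basis is chosen, so that M is \<open>\<int> \<times> \<int>\<close>,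
  and the dual basis identifies the rational vector space of N with \<open>\<rat> \<times> \<rat>\<close>.  The algebra k[M]
  is the type \<open>lattice \<Rightarrow>\<^sub>0 'k\<close> with the convolution product.
\<close>

type_synonym lattice = "int \<times> int"

definition is_submonoid :: "'m::monoid_add set \<Rightarrow> bool" where
  "is_submonoid S \<longleftrightarrow> 0 \<in> S \<and> (\<forall>a\<in>S. \<forall>b\<in>S. a + b \<in> S)"

definition is_subgroup :: "'m::group_add set \<Rightarrow> bool" where
  "is_subgroup S \<longleftrightarrow> is_submonoid S \<and> (\<forall>a\<in>S. - a \<in> S)"

definition affine_monoid :: "lattice set \<Rightarrow> bool" where
  "affine_monoid S \<longleftrightarrow> (\<exists>G. finite G \<and> S = is_submonoid hull G)"

definition monoid_algebra :: "lattice set \<Rightarrow> (lattice \<Rightarrow>\<^sub>0 'k::field) set" where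
  "monoid_algebra S = {f. Poly_Mapping.keys f \<subseteq> S}"

text \<open>
  Closed points of Spec A for a finitely generated algebra A over an algebraically closed field k
  are the k-algebra homomorphisms from A to k.  Here A is a subalgebra of k[M], and its scalars
  are the elements \<open>Poly_Mapping.single 0 c\<close>.
\<close>

definition closed_points ::
  "(lattice \<Rightarrow>\<^sub>0 'k::field) set \<Rightarrow> ((lattice \<Rightarrow>\<^sub>0 'k) \<Rightarrow> 'k) set" where
  "closed_points A = {x \<in> extensional A.
     (\<forall>c. x (Poly_Mapping.single 0 c) = c) \<and>
     (\<forall>f\<in>A. \<forall>g\<in>A. x (f + g) = x f + x g \<and> x (f * g) = x f * x g)}"

definition Spec ::
  "(lattice \<Rightarrow>\<^sub>0 'k::field) set \<Rightarrow> ((lattice \<Rightarrow>\<^sub>0 'k) \<Rightarrow> 'k, 'k) variety" where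
  "Spec A = \<lparr>points = closed_points A,
     reg_fun = {F. \<exists>f\<in>A. \<forall>x\<in>closed_points A. F x = x f}\<rparr>"

definition toric_variety ::
  "lattice set \<Rightarrow> ((lattice \<Rightarrow>\<^sub>0 'k::field) \<Rightarrow> 'k, 'k) variety" where
  "toric_variety S = Spec (monoid_algebra S)"

text \<open>
  For \<open>S \<subseteq> T\<close>, the inclusion of S into T induces a morphism from \<open>toric_variety T\<close> to
  \<open>toric_variety S\<close>, which restricts homomorphisms to k[S].
\<close>

definition toric_inclusion ::
  "lattice set \<Rightarrow> ((lattice \<Rightarrow>\<^sub>0 'k::field) \<Rightarrow> 'k) \<Rightarrow> ((lattice \<Rightarrow>\<^sub>0 'k) \<Rightarrow> 'k)" where
  "toric_inclusion S x = restrict x (monoid_algebra S)"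

definition pairing :: "rat \<times> rat \<Rightarrow> lattice \<Rightarrow> rat" where
  "pairing u m = fst u * of_int (fst m) + snd u * of_int (snd m)"

definition rational_polyhedral_cone :: "(rat \<times> rat) set \<Rightarrow> bool" where
  "rational_polyhedral_cone \<sigma> \<longleftrightarrow> (\<exists>G::(rat \<times> rat) set. finite G \<and>
     \<sigma> = {(\<Sum>g\<in>G. r g * fst g, \<Sum>g\<in>G. r g * snd g) | r. \<forall>g\<in>G. 0 \<le> r g})"

definition strongly_convex :: "(rat \<times> rat) set \<Rightarrow> bool" where
  "strongly_convex \<sigma> \<longleftrightarrow> (\<forall>u\<in>\<sigma>. - u \<in> \<sigma> \<longrightarrow> u = 0)"

text \<open>The lattice points of the dual cone.\<close>

definition dual_monoid :: "(rat \<times> rat) set \<Rightarrow> lattice set" where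
  "dual_monoid \<sigma> = {m. \<forall>u\<in>\<sigma>. 0 \<le> pairing u m}"

end

theory Submission
  imports Defs "Berlekamp_Zassenhaus.Unique_Factorization_Poly"
begin

text \<open>
  Let P be the monoid of lattice points of the dual cone.  If P is the whole lattice, a half plane or a
  quadrant of a basis, then X is one of the three exceptional surfaces, and k[S] is stable under the
  inversion of the torus, respectively under the shears sending y to y + x^k for the coordinates x, y;
  this forces S = P, so that X_S is normal.  Otherwise X is
  singular exactly at the torus fixed point: at least three elements of P are indecomposable, so the
  tangent space there has dimension at least 3, while it has dimension at most 2 at every other point.
  Hence each automorphism fixes this point and preserves its maximal ideal m, and therefore also
  k + m^2, which is k[S] for S consisting of 0 and of all sums of two nonzero elements of P.  The
  same count of tangent dimensions shows that X is none of the three exceptional surfaces.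
\<close>

subsection \<open>Monoid algebras and their closed points\<close>

text \<open>Regular functions are given here only by their values on points, so every argument has
  to pass from values to elements of k[S]. This is possible because an element of k[S] is determined
  by its values; in characteristic 0 the powers of the one torus point (2, 3) already suffice for
  that. Smoothness is never defined. A bound by 2 on the space of point derivations is enough, and
  it is invariant under isomorphisms. Coefficient functionals at indecomposable exponents violate
  the bound at the fixed point, and the Leibniz rule on monomials proves it elsewhere. Being a
  normalization is part of the claim, so k[P] has to be shown integrally closed: in the Laurent ring
  by unique factorization in k[x][y], and then one half plane at a time by comparing terms of lowest
  weight. The choice of k + m^2 is economical: only the indecomposable monomials are lost, finite in
  number, which makes the inclusion finite and birational, while the loss of a ray generator already
  destroys normality.\<close>

abbreviation chi :: "lattice \<Rightarrow> (lattice \<Rightarrow>\<^sub>0 'k::field)" where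
  "chi m \<equiv> Poly_Mapping.single m 1"

text \<open>The linear extension of \<theta> to k[M]. Taking \<theta> total on the lattice lets one
  formula serve every submonoid.\<close>

definition eval_char :: "(lattice \<Rightarrow> 'k::field) \<Rightarrow> (lattice \<Rightarrow>\<^sub>0 'k) \<Rightarrow> 'k" where
  "eval_char \<theta> f = (\<Sum>m\<in>Poly_Mapping.keys f. Poly_Mapping.lookup f m * \<theta> m)"

lemma malg_iff: "f \<in> monoid_algebra S \<longleftrightarrow> Poly_Mapping.keys f \<subseteq> S"
  by (simp add: monoid_algebra_def)

lemma malg_lookup: "f \<in> monoid_algebra S \<Longrightarrow> Poly_Mapping.lookup f m \<noteq> 0 \<Longrightarrow> m \<in> S"
  by (auto simp: malg_iff in_keys_iff)

lemma malg_zero [simp]: "0 \<in> monoid_algebra S"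
  by (simp add: malg_iff)

lemma malg_single: "m \<in> S \<Longrightarrow> Poly_Mapping.single m c \<in> monoid_algebra S"
  by (auto simp: malg_iff)

lemma malg_add: "f \<in> monoid_algebra S \<Longrightarrow> g \<in> monoid_algebra S \<Longrightarrow> f + g \<in> monoid_algebra S"
  using keys_add[of f g] by (auto simp: malg_iff)

lemma malg_diff: "f \<in> monoid_algebra S \<Longrightarrow> g \<in> monoid_algebra S \<Longrightarrow> f - g \<in> monoid_algebra S"
proof -
  assume "f \<in> monoid_algebra S" "g \<in> monoid_algebra S"
  then have "m \<in> S" if "m \<in> Poly_Mapping.keys (f - g)" for m
    using that malg_lookup[of f S m] malg_lookup[of g S m]
    by (cases "Poly_Mapping.lookup f m = 0") (auto simp: in_keys_iff lookup_minus)
  then show ?thesis by (auto simp: malg_iff)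
qed

lemma malg_sum: "(\<And>i. i \<in> I \<Longrightarrow> f i \<in> monoid_algebra S) \<Longrightarrow> sum f I \<in> monoid_algebra S"
  by (induction I rule: infinite_finite_induct) (auto intro: malg_add)

lemma malg_mono: "S \<subseteq> T \<Longrightarrow> monoid_algebra S \<subseteq> monoid_algebra T"
  by (auto simp: monoid_algebra_def)

lemma is_submonoid_zero: "is_submonoid S \<Longrightarrow> 0 \<in> S"
  by (simp add: is_submonoid_def)

lemma is_submonoid_add: "is_submonoid S \<Longrightarrow> a \<in> S \<Longrightarrow> b \<in> S \<Longrightarrow> a + b \<in> S"
  by (simp add: is_submonoid_def)

lemma malg_const: "is_submonoid S \<Longrightarrow> Poly_Mapping.single 0 c \<in> monoid_algebra S"
  by (simp add: malg_single is_submonoid_zero)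

lemma malg_one: "is_submonoid S \<Longrightarrow> 1 \<in> monoid_algebra S"
  using malg_const[of S 1] by simp

lemma malg_mult:
  "is_submonoid S \<Longrightarrow> f \<in> monoid_algebra S \<Longrightarrow> g \<in> monoid_algebra S \<Longrightarrow> f * g \<in> monoid_algebra S"
  unfolding malg_iff by (rule order_trans[OF keys_mult]) (use is_submonoid_add in blast)

lemma malg_power: "is_submonoid S \<Longrightarrow> f \<in> monoid_algebra S \<Longrightarrow> f ^ n \<in> monoid_algebra S"
  by (induction n) (auto intro: malg_one malg_mult)

lemma poly_mapping_sum_single:
  "f = (\<Sum>m\<in>Poly_Mapping.keys f. Poly_Mapping.single m (Poly_Mapping.lookup f m))"
  by (rule poly_mapping_eqI)
    (auto simp: lookup_sum lookup_single when_def in_keys_iff sum.delta)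

text \<open>Points are additive only on their own k[S], so the addition case has to carry the
  membership of both summands.\<close>

lemma malg_induct [consumes 1, case_names zero single add]:
  assumes f: "f \<in> monoid_algebra S"
    and z: "P 0"
    and s: "\<And>m c. m \<in> S \<Longrightarrow> P (Poly_Mapping.single m c)"
    and a: "\<And>f g. f \<in> monoid_algebra S \<Longrightarrow> g \<in> monoid_algebra S \<Longrightarrow> P f \<Longrightarrow> P g \<Longrightarrow> P (f + g)"
  shows "P f"
proof -
  have "sum (\<lambda>m. Poly_Mapping.single m (Poly_Mapping.lookup f m)) K \<in> monoid_algebra S \<and>
        P (sum (\<lambda>m. Poly_Mapping.single m (Poly_Mapping.lookup f m)) K)"
    if "finite K" "K \<subseteq> S" for K
    using that by (induction K) (auto intro: z s a malg_add malg_single)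
  then show ?thesis
    using f poly_mapping_sum_single[of f] by (metis finite_keys malg_iff)
qed

lemma eval_char_superset:
  assumes "finite K" "Poly_Mapping.keys f \<subseteq> K"
  shows "eval_char \<theta> f = (\<Sum>m\<in>K. Poly_Mapping.lookup f m * \<theta> m)"
  unfolding eval_char_def
  using assms by (intro sum.mono_neutral_left) (auto simp: in_keys_iff)

lemma eval_char_zero [simp]: "eval_char \<theta> 0 = 0"
  by (simp add: eval_char_def)

lemma eval_char_single [simp]: "eval_char \<theta> (Poly_Mapping.single m c) = c * \<theta> m"
  by (cases "c = 0") (auto simp: eval_char_def)

lemma eval_char_add: "eval_char \<theta> (f + g) = eval_char \<theta> f + eval_char \<theta> g"
proof -
  define K where "K = Poly_Mapping.keys f \<union> Poly_Mapping.keys g"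
  have "finite K" by (simp add: K_def)
  moreover have "Poly_Mapping.keys (f + g) \<subseteq> K" using keys_add[of f g] by (simp add: K_def)
  ultimately show ?thesis
    by (simp add: eval_char_superset[of K] K_def lookup_add distrib_right sum.distrib)
qed

lemma eval_char_cong:
  "f \<in> monoid_algebra S \<Longrightarrow> (\<And>m. m \<in> S \<Longrightarrow> \<theta> m = \<eta> m) \<Longrightarrow> eval_char \<theta> f = eval_char \<eta> f"
  unfolding eval_char_def by (intro sum.cong) (auto simp: malg_iff)

text \<open>Homomorphisms from S to the multiplicative monoid of k, which are the same data as the
  closed points of X_S. Values off S are arbitrary.\<close>

definition character :: "lattice set \<Rightarrow> (lattice \<Rightarrow> 'k::field) \<Rightarrow> bool" where
  "character S \<theta> \<longleftrightarrow> \<theta> 0 = 1 \<and> (\<forall>m\<in>S. \<forall>n\<in>S. \<theta> (m + n) = \<theta> m * \<theta> n)"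

lemma eval_char_mult:
  assumes "character S \<theta>" "f \<in> monoid_algebra S" "g \<in> monoid_algebra S"
  shows "eval_char \<theta> (f * g) = eval_char \<theta> f * eval_char \<theta> g"
  using assms(2)
proof (induction f rule: malg_induct)
  case (single m c)
  from assms(3) show ?case
  proof (induction g rule: malg_induct)
    case (single n d)
    then show ?case using assms(1) \<open>m \<in> S\<close> by (simp add: mult_single character_def)
  qed (auto simp: eval_char_add algebra_simps)
qed (auto simp: eval_char_add algebra_simps)

definition char_point :: "lattice set \<Rightarrow> (lattice \<Rightarrow> 'k::field) \<Rightarrow> (lattice \<Rightarrow>\<^sub>0 'k) \<Rightarrow> 'k" where
  "char_point S \<theta> = restrict (eval_char \<theta>) (monoid_algebra S)"

lemma points_toric: "points (toric_variety S) = closed_points (monoid_algebra S)"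
  by (simp add: toric_variety_def Spec_def)

lemma reg_fun_toric: "reg_fun (toric_variety S) =
    {F. \<exists>f\<in>monoid_algebra S. \<forall>x\<in>points (toric_variety S). F x = x f}"
  by (simp add: toric_variety_def Spec_def)

lemma reg_funI: "f \<in> monoid_algebra S \<Longrightarrow> (\<And>x. x \<in> points (toric_variety S) \<Longrightarrow> F x = x f)
    \<Longrightarrow> F \<in> reg_fun (toric_variety S)"
  by (auto simp: reg_fun_toric)

lemma char_point_apply: "f \<in> monoid_algebra S \<Longrightarrow> char_point S \<theta> f = eval_char \<theta> f"
  by (simp add: char_point_def)

lemma char_point_chi: "m \<in> S \<Longrightarrow> char_point S \<theta> (chi m) = \<theta> m"
  by (simp add: char_point_apply malg_single)

lemma char_point_in:
  assumes "is_submonoid S" "character S \<theta>"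
  shows "char_point S \<theta> \<in> points (toric_variety S)"
  unfolding points_toric closed_points_def
  using assms
  by (auto simp: char_point_def malg_const malg_add malg_mult eval_char_mult eval_char_add)
    (auto simp: character_def)

lemma
  assumes "x \<in> points (toric_variety S)"
  shows point_const: "x (Poly_Mapping.single 0 c) = c"
    and point_add: "f \<in> monoid_algebra S \<Longrightarrow> g \<in> monoid_algebra S \<Longrightarrow> x (f + g) = x f + x g"
    and point_mult: "f \<in> monoid_algebra S \<Longrightarrow> g \<in> monoid_algebra S \<Longrightarrow> x (f * g) = x f * x g"
    and point_ext: "x \<in> extensional (monoid_algebra S)"
    and point_one: "x 1 = 1"
    and point_zero: "x 0 = 0"
proof -
  have c: "x (Poly_Mapping.single 0 c) = c" for c
    using assms by (auto simp: points_toric closed_points_def)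
  show "x (Poly_Mapping.single 0 c) = c" "x 1 = 1" "x 0 = 0"
    using c[of c] c[of 1] c[of 0] by simp_all
qed (use assms in \<open>auto simp: points_toric closed_points_def\<close>)

lemma point_single:
  assumes "is_submonoid S" "x \<in> points (toric_variety S)" "m \<in> S"
  shows "x (Poly_Mapping.single m c) = c * x (chi m)"
  using point_mult[OF assms(2), of "Poly_Mapping.single 0 c" "chi m"] assms
  by (simp add: point_const[OF assms(2)] mult_single malg_const malg_single)

text \<open>Converse to the construction of \<open>char_point\<close>: a point is the evaluation at
  its own character, so it is determined by its values on monomials.\<close>

lemma point_eval:
  assumes "is_submonoid S" "x \<in> points (toric_variety S)" "f \<in> monoid_algebra S"
  shows "x f = eval_char (\<lambda>m. x (chi m)) f"
  using assms(3)
proof (induction f rule: malg_induct)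
  case (single m c)
  then show ?case using point_single[OF assms(1,2), of m c] by simp
qed (simp_all add: point_zero[OF assms(2)] point_add[OF assms(2)] eval_char_add)

lemma point_diff:
  assumes "x \<in> points (toric_variety S)" "f \<in> monoid_algebra S" "g \<in> monoid_algebra S"
  shows "x (f - g) = x f - x g"
  using point_add[OF assms(1), of "f - g" g] assms by (simp add: malg_diff)

lemma point_power:
  assumes "is_submonoid S" "x \<in> points (toric_variety S)" "f \<in> monoid_algebra S"
  shows "x (f ^ n) = x f ^ n"
  by (induction n) (auto simp: assms point_one[OF assms(2)] point_mult[OF assms(2)] malg_power)

lemma point_sum:
  assumes "x \<in> points (toric_variety S)" "\<And>i. i \<in> I \<Longrightarrow> f i \<in> monoid_algebra S"
  shows "x (sum f I) = (\<Sum>i\<in>I. x (f i))"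
  using assms(2)
  by (induction I rule: infinite_finite_induct)
    (auto simp: point_zero[OF assms(1)] point_add[OF assms(1)] malg_sum)

lemma character_point:
  assumes "is_submonoid S" "x \<in> points (toric_variety S)"
  shows "character S (\<lambda>m. x (chi m))"
  using point_mult[OF assms(2), OF malg_single malg_single, of _ _ 1 1] point_one[OF assms(2)]
  by (auto simp: character_def mult_single)

lemma point_chi_add:
  assumes "is_submonoid S" "x \<in> points (toric_variety S)" "m \<in> S" "n \<in> S"
  shows "x (chi (m + n)) = x (chi m) * x (chi n)"
  using character_point[OF assms(1,2)] assms(3,4) by (simp add: character_def)

lemma point_eqI:
  fixes x y :: "(lattice \<Rightarrow>\<^sub>0 'k::field) \<Rightarrow> 'k"
  assumes "is_submonoid S" "x \<in> points (toric_variety S)" "y \<in> points (toric_variety S)"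
    and "\<And>m. m \<in> S \<Longrightarrow> x (chi m) = y (chi m)"
  shows "x = y"
proof (rule extensionalityI[OF point_ext[OF assms(2)] point_ext[OF assms(3)]])
  fix f :: "lattice \<Rightarrow>\<^sub>0 'k" assume "f \<in> monoid_algebra S"
  then show "x f = y f"
    using assms(4) eval_char_cong[of f S "\<lambda>m. x (chi m)" "\<lambda>m. y (chi m)"]
      point_eval[OF assms(1,2)] point_eval[OF assms(1,3)] by metis
qed

subsection \<open>Reducedness\<close>

text \<open>A Vandermonde argument without determinants: the relations for all powers combine to a
  relation for every polynomial in w, in particular for one that vanishes at all nodes but
  one.\<close>

lemma power_sums_zero:
  fixes c w :: "'a \<Rightarrow> 'k::field"
  assumes "finite K" "inj_on w K" and z: "\<And>j::nat. (\<Sum>m\<in>K. c m * w m ^ j) = 0" and "m \<in> K"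
  shows "c m = 0"
proof -
  define p where "p = (\<Prod>n\<in>K - {m}. [:- w n, 1:])"
  have "(\<Sum>n\<in>K. c n * poly p (w n)) = (\<Sum>n\<in>K. \<Sum>j\<le>degree p. coeff p j * (c n * w n ^ j))"
    by (simp add: poly_altdef sum_distrib_left mult_ac)
  also have "\<dots> = (\<Sum>j\<le>degree p. coeff p j * (\<Sum>n\<in>K. c n * w n ^ j))"
    by (subst sum.swap) (simp add: sum_distrib_left)
  finally have "(\<Sum>n\<in>K. c n * poly p (w n)) = 0" by (simp add: z)
  moreover have "(\<Sum>n\<in>K. c n * poly p (w n)) = c m * poly p (w m)"
  proof (subst sum.remove[OF assms(1,4)], subst sum.neutral)
    show "\<forall>n\<in>K - {m}. c n * poly p (w n) = 0"
      using assms(1) by (auto simp: p_def poly_prod)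
  qed simp
  moreover have "poly p (w m) \<noteq> 0"
    using assms(1,2,4) by (auto simp: p_def poly_prod dest: inj_onD)
  ultimately show ?thesis by simp
qed

text \<open>Characteristic 0 reduces this to unique factorization of 2^i 3^j among the naturals. Its
  use is to provide one torus point at which distinct monomials take distinct values.\<close>

lemma two_three_power_inj:
  assumes "(2::'k::field_char_0) powi a * 3 powi b = 1"
  shows "a = 0 \<and> b = 0"
proof -
  \<comment> \<open>Once negative exponents are moved to the other side, each prime occurs on at
    most one side. Parity then settles the exponent of 2, and cancellation the exponent of
    3.\<close>
  have nat: "i = 0 \<and> j = 0 \<and> i' = 0 \<and> j' = 0"
    if "(2::nat) ^ i * 3 ^ j = 2 ^ i' * 3 ^ j'" "i = 0 \<or> i' = 0" "j = 0 \<or> j' = 0" for i j i' j'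
  proof -
    have 2: "i = i'" if "(2::nat) ^ i * 3 ^ j = 2 ^ i' * 3 ^ j'" "i = 0 \<or> i' = 0" for i i'
    proof -
      have "even ((2::nat) ^ i * 3 ^ j) \<longleftrightarrow> even (2 ^ i' * (3::nat) ^ j')" using that by simp
      then show ?thesis using that(2) by auto
    qed
    then have "i = i'" using that by blast
    then have "(3::nat) ^ j = 3 ^ j'" using that by simp
    with \<open>i = i'\<close> that(2,3) show ?thesis by auto
  qed
  define i j i' j' where "i = nat a" "j = nat b" "i' = nat (- a)" "j' = nat (- b)"
  have p: "x powi c = x ^ nat c / x ^ nat (- c)" if "x \<noteq> 0" for x :: 'k and c
    using that by (simp add: power_int_def divide_inverse power_inverse)
  have "(2::'k) ^ i * 3 ^ j = 2 ^ i' * 3 ^ j'"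
    using assms by (simp add: p i_j_i'_j'_def field_simps)
  then have "of_nat ((2::nat) ^ i * 3 ^ j) = (of_nat (2 ^ i' * 3 ^ j') :: 'k)" by simp
  then have "(2::nat) ^ i * 3 ^ j = 2 ^ i' * 3 ^ j'" by (simp only: of_nat_eq_iff)
  moreover have "i = 0 \<or> i' = 0" "j = 0 \<or> j' = 0" by (auto simp: i_j_i'_j'_def)
  ultimately have "i = 0 \<and> j = 0 \<and> i' = 0 \<and> j' = 0" by (rule nat)
  then show ?thesis by (simp add: i_j_i'_j'_def)
qed

definition torus_char :: "'k::field \<Rightarrow> 'k \<Rightarrow> lattice \<Rightarrow> 'k" where
  "torus_char s t m = s powi fst m * t powi snd m"

lemma character_torus: "s \<noteq> 0 \<Longrightarrow> t \<noteq> 0 \<Longrightarrow> character S (torus_char s t)"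
  by (simp add: character_def torus_char_def power_int_add)

text \<open>The points (2^j, 3^j) suffice. There the monomial m takes the value w(m)^j with w
  injective, so the vanishing of all these power sums kills every coefficient.\<close>

lemma torus_point_reduced:
  fixes f :: "lattice \<Rightarrow>\<^sub>0 'k::field_char_0"
  assumes "\<And>s t. s \<noteq> 0 \<Longrightarrow> t \<noteq> 0 \<Longrightarrow> eval_char (torus_char s t) f = 0"
  shows "f = 0"
proof -
  define w :: "lattice \<Rightarrow> 'k" where "w = torus_char 2 3"
  have "inj w"
  proof
    fix m n assume "w m = w n"
    then have "(2::'k) powi (fst m - fst n) * 3 powi (snd m - snd n) = 1"
      by (simp add: w_def torus_char_def power_int_diff field_simps)
    from two_three_power_inj[OF this] show "m = n" by (simp add: prod_eq_iff)
  qed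
  have "(\<Sum>m\<in>Poly_Mapping.keys f. Poly_Mapping.lookup f m * w m ^ j) = 0" for j
  proof -
    have pw: "(c ^ j) powi a = (c powi a) ^ j" for c :: 'k and a
      by (metis mult.commute power_int_mult power_int_of_nat)
    have "torus_char (2 ^ j) (3 ^ j) m = w m ^ j" for m
      by (simp add: torus_char_def w_def power_mult_distrib pw)
    then show ?thesis using assms[of "2 ^ j" "3 ^ j"] by (simp add: eval_char_def)
  qed
  from power_sums_zero[OF finite_keys inj_on_subset[OF \<open>inj w\<close> subset_UNIV] this]
  show ?thesis by (intro poly_mapping_eqI) (metis lookup_zero in_keys_iff)
qed

text \<open>This makes the element of k[S] behind a regular function unique, and it is the means by
  which pointwise identities become identities in the algebra.\<close>

lemma toric_reduced:
  fixes f g :: "lattice \<Rightarrow>\<^sub>0 'k::field_char_0"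
  assumes S: "is_submonoid S" and f: "f \<in> monoid_algebra S" "g \<in> monoid_algebra S"
    and eq: "\<And>x. x \<in> points (toric_variety S) \<Longrightarrow> x f = x g"
  shows "f = g"
proof -
  have "f - g = 0"
  proof (rule torus_point_reduced)
    fix s t :: 'k assume "s \<noteq> 0" "t \<noteq> 0"
    from char_point_in[OF S character_torus[OF this]]
    show "eval_char (torus_char s t) (f - g) = 0"
      using eq f by (metis char_point_apply malg_diff point_diff right_minus_eq)
  qed
  then show ?thesis by simp
qed

lemma toric_nonzero_point:
  fixes f :: "lattice \<Rightarrow>\<^sub>0 'k::field_char_0"
  assumes "is_submonoid S" "f \<in> monoid_algebra S" "f \<noteq> 0"
  shows "\<exists>x\<in>points (toric_variety S). x f \<noteq> 0"
  using toric_reduced[OF assms(1,2) malg_zero] assms(3) by (metis point_zero)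

subsection \<open>Normality\<close>

text \<open>M is a denominator cleared from the coefficients of a monic equation, so it survives as
  leading coefficient and in the conclusion. The prime factors p of the denominator of the fraction
  are removed one at a time: p divides M a^n, and either M absorbs p or p cancels from the
  fraction.\<close>

lemma ufd_integral_dvd_mset:
  fixes a M :: "'a::ufd"
  assumes "\<And>p. p \<in># F \<Longrightarrow> irreducible p"
    and "M * a ^ n + (\<Sum>i<n. c i * a ^ i * prod_mset F ^ (n - i)) = 0"
  shows "\<exists>K. prod_mset F dvd M ^ K * a"
  using assms
proof (induction F arbitrary: a c)
  case (add p F)
  define b where "b = prod_mset F"
  have eq: "M * a ^ n + (\<Sum>i<n. c i * a ^ i * (p * b) ^ (n - i)) = 0"
    using add.prems(2) by (simp add: b_def)
  have irr: "irreducible r" if "r \<in># F" for r using add.prems(1) that by simp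
  have "prime_elem p" using add.prems(1) by simp
  have "p dvd (\<Sum>i<n. c i * a ^ i * (p * b) ^ (n - i))"
    by (rule dvd_sum) (auto intro!: dvd_mult dvd_mult2 dvd_power simp: power_mult_distrib)
  then have "p dvd M * a ^ n" using eq unfolding add_eq_0_iff by (simp only: dvd_minus_iff)
  then consider "p dvd M" | "p dvd a"
    using \<open>prime_elem p\<close> prime_elem_dvd_mult_iff[of p M "a ^ n"] prime_elem_dvd_power[of p a n] by auto
  then show ?case
  proof cases
    case 1
    \<comment> \<open>If p divides M, its powers are moved into the coefficients. The p dropped from
      the denominator costs one more factor M at the end.\<close>
    have "M * a ^ n + (\<Sum>i<n. c i * p ^ (n - i) * a ^ i * prod_mset F ^ (n - i)) = 0"
      using eq by (simp add: power_mult_distrib b_def mult_ac)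
    from add.IH[OF irr this] obtain K where "b dvd M ^ K * a" unfolding b_def by blast
    then have "p * b dvd M * (M ^ K * a)" using 1 by (rule mult_dvd_mono[rotated])
    then show ?thesis by (intro exI[of _ "Suc K"]) (simp add: b_def mult_ac)
  next
    case 2
    then obtain d where d: "a = p * d" by (elim dvdE)
    \<comment> \<open>With a = p d every term contains p^n; dividing by it leaves an equation of the
      same shape for d over b.\<close>
    have "p ^ n * (M * d ^ n + (\<Sum>i<n. c i * d ^ i * b ^ (n - i))) =
        M * a ^ n + (\<Sum>i<n. c i * a ^ i * (p * b) ^ (n - i))"
    proof -
      have "p ^ n * (c i * d ^ i * b ^ (n - i)) = c i * a ^ i * (p * b) ^ (n - i)" if "i < n" for i
      proof -
        have "p ^ n = p ^ i * p ^ (n - i)" using that by (simp flip: power_add)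
        then show ?thesis by (simp add: d power_mult_distrib mult_ac)
      qed
      then have "(\<Sum>i<n. p ^ n * (c i * d ^ i * b ^ (n - i))) = (\<Sum>i<n. c i * a ^ i * (p * b) ^ (n - i))"
      by (intro sum.cong) simp_all
    moreover have "p ^ n * (M * d ^ n) = M * a ^ n" by (simp add: d power_mult_distrib mult_ac)
    ultimately show ?thesis unfolding distrib_left sum_distrib_left by (simp only:)
    qed
    then have "M * d ^ n + (\<Sum>i<n. c i * d ^ i * prod_mset F ^ (n - i)) = 0"
      using eq \<open>prime_elem p\<close> by (auto simp: b_def)
    from add.IH[OF irr this] obtain K where "b dvd M ^ K * d" unfolding b_def by blast
    then have "p * b dvd p * (M ^ K * d)" by (rule mult_dvd_mono[OF dvd_refl])
    then show ?thesis by (intro exI[of _ K]) (simp add: b_def d mult_ac)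
  qed
qed simp

lemma ufd_integral_dvd:
  fixes a b M :: "'a::ufd"
  assumes "b \<noteq> 0" "M * a ^ n + (\<Sum>i<n. c i * a ^ i * b ^ (n - i)) = 0"
  shows "\<exists>K. b dvd M ^ K * a"
proof (cases "b dvd 1")
  case True
  then show ?thesis using dvd_trans one_dvd by blast
next
  case False
  then obtain F where "mset_factors F b" using mset_factors_exist assms(1) by blast
  then show ?thesis using ufd_integral_dvd_mset[of F M a n c] assms(2) by (auto elim!: mset_factorsE)
qed

lemma malg_one_zero: "0 \<in> S \<Longrightarrow> 1 \<in> monoid_algebra S"
  using malg_single[of 0 S 1] by simp

lemma chi_mult_cancel:
  fixes f g :: "lattice \<Rightarrow>\<^sub>0 'k::field"
  assumes "chi m * f = chi m * g"
  shows "f = g"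
proof -
  have "chi (- m) * (chi m * f) = chi (- m) * (chi m * g)" using assms by simp
  then show ?thesis by (simp add: mult_single flip: mult.assoc)
qed

lemma malg_mult_subset:
  assumes "f \<in> monoid_algebra A" "g \<in> monoid_algebra B" "\<And>a b. a \<in> A \<Longrightarrow> b \<in> B \<Longrightarrow> a + b \<in> C"
  shows "f * g \<in> monoid_algebra C"
  using assms(1,2) unfolding malg_iff
  by (intro order_trans[OF keys_mult]) (use assms(3) in blast)

lemma malg_disjoint_add_zero:
  fixes f g :: "lattice \<Rightarrow>\<^sub>0 'k::field"
  assumes "f \<in> monoid_algebra A" "g \<in> monoid_algebra B" "A \<inter> B = {}" "f + g = 0"
  shows "f = 0" "g = 0"
proof -
  have "Poly_Mapping.lookup f m = 0 \<and> Poly_Mapping.lookup g m = 0" for m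
  proof -
    have "Poly_Mapping.lookup f m + Poly_Mapping.lookup g m = 0"
      using assms(4) by (metis lookup_add lookup_zero)
    moreover have "m \<in> A" if "Poly_Mapping.lookup f m \<noteq> 0" using malg_lookup[OF assms(1) that] .
    moreover have "m \<in> B" if "Poly_Mapping.lookup g m \<noteq> 0" using malg_lookup[OF assms(2) that] .
    ultimately show ?thesis using assms(3)
      by (cases "Poly_Mapping.lookup f m = 0"; cases "Poly_Mapping.lookup g m = 0") auto
  qed
  then show "f = 0" "g = 0" by (auto intro: poly_mapping_eqI)
qed

section \<open>Laurent polynomials as a localization of k[x][y]\<close>

definition laurent_x :: "'k::field poly \<Rightarrow> (lattice \<Rightarrow>\<^sub>0 'k)" where
  "laurent_x p = poly (map_poly (Poly_Mapping.single 0) p) (chi (1, 0))"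

text \<open>The embedding of k[x][y] into k[M], with y as the outer variable. The detour through
  iterated polynomials gives access to unique factorization.\<close>

definition laurent :: "'k::field poly poly \<Rightarrow> (lattice \<Rightarrow>\<^sub>0 'k)" where
  "laurent F = poly (map_poly laurent_x F) (chi (0, 1))"

interpretation single_hom: map_poly_comm_ring_hom "Poly_Mapping.single (0::lattice) :: 'k::field \<Rightarrow> _"
  by unfold_locales (simp_all add: single_add mult_single)

interpretation laurent_x_hom: map_poly_comm_ring_hom "laurent_x :: 'k::field poly \<Rightarrow> _"
  by unfold_locales (simp_all add: laurent_x_def hom_distribs)

interpretation laurent_hom: comm_ring_hom "laurent :: 'k::field poly poly \<Rightarrow> _"
  by unfold_locales (simp_all add: laurent_def hom_distribs)

lemma laurent_x_pCons: "laurent_x (pCons c p) = Poly_Mapping.single 0 c + chi (1, 0) * laurent_x p"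
  by (cases "c = 0 \<and> p = 0") (auto simp: laurent_x_def)

lemma laurent_pCons: "laurent (pCons p F) = laurent_x p + chi (0, 1) * laurent F"
  by (cases "p = 0 \<and> F = 0") (auto simp: laurent_def)

lemma laurent_x_malg: "laurent_x p \<in> monoid_algebra {m. 0 \<le> fst m \<and> snd m = 0}"
proof (induction p)
  case (pCons c p)
  have "chi (1, 0) * laurent_x p \<in> monoid_algebra {m. 0 \<le> fst m \<and> snd m = 0}"
    by (rule malg_mult_subset[OF malg_single[of "(1, 0)" "{(1, 0)}"] pCons.IH]) auto
  then show ?case unfolding laurent_x_pCons by (intro malg_add malg_single) simp_all
qed simp

lemma laurent_malg: "laurent F \<in> monoid_algebra {m. 0 \<le> snd m}"
proof (induction F)
  case (pCons p F)
  have "chi (0, 1) * laurent F \<in> monoid_algebra {m. 0 \<le> snd m}"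
    by (rule malg_mult_subset[OF malg_single[of "(0, 1)" "{(0, 1)}"] pCons.IH]) auto
  moreover have "laurent_x p \<in> monoid_algebra {m. 0 \<le> snd m}"
    by (rule subsetD[OF malg_mono laurent_x_malg]) auto
  ultimately show ?case unfolding laurent_pCons by (intro malg_add)
qed simp

text \<open>The constant term sits at exponent 0 and the rest at x-exponents at least 1, so the two
  parts cannot cancel.\<close>

lemma laurent_x_zero: "laurent_x p = 0 \<Longrightarrow> p = 0"
proof (induction p)
  case (pCons c p)
  have 1: "chi (1, 0) * laurent_x p \<in> monoid_algebra {m. 1 \<le> fst m}"
    by (rule malg_mult_subset[OF malg_single[of "(1, 0)" "{(1, 0)}"] laurent_x_malg]) auto
  have 2: "Poly_Mapping.single 0 c \<in> monoid_algebra {0}" by (simp add: malg_single)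
  have "Poly_Mapping.single (0::lattice) c = 0" "chi (1, 0) * laurent_x p = 0"
    using pCons.prems unfolding laurent_x_pCons
    by (auto intro: malg_disjoint_add_zero[OF 2 1])
  then have "c = 0" "laurent_x p = 0"
    using chi_mult_cancel[of "(1, 0)" "laurent_x p" 0] by (auto dest: arg_cong[of _ _ "\<lambda>f. Poly_Mapping.lookup f 0"])
  then show ?case using pCons.IH by simp
qed simp

lemma laurent_zero: "laurent F = 0 \<Longrightarrow> F = 0"
proof (induction F)
  case (pCons p F)
  have 1: "chi (0, 1) * laurent F \<in> monoid_algebra {m. 1 \<le> snd m}"
    by (rule malg_mult_subset[OF malg_single[of "(0, 1)" "{(0, 1)}"] laurent_malg]) auto
  have "laurent_x p = 0" "chi (0, 1) * laurent F = 0"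
    using pCons.prems unfolding laurent_pCons
    by (auto intro: malg_disjoint_add_zero[OF laurent_x_malg 1])
  then have "p = 0" "laurent F = 0"
    using chi_mult_cancel[of "(0, 1)" "laurent F" 0] laurent_x_zero by auto
  then show ?case using pCons.IH by simp
qed simp

lemma laurent_monom: "laurent (monom (monom c i) j) = Poly_Mapping.single (int i, int j) c"
proof -
  have "laurent_x (monom c i) = Poly_Mapping.single (int i, 0) c"
    by (induction i) (auto simp: monom_0 monom_Suc laurent_x_pCons mult_single zero_prod_def)
  then show ?thesis
    by (induction j) (auto simp: monom_0 monom_Suc laurent_pCons mult_single)
qed

text \<open>Powers of the single element xy serve as denominators, since inverting xy inverts both
  variables.\<close>

abbreviation diag :: "nat \<Rightarrow> (lattice \<Rightarrow>\<^sub>0 'k::field)" where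
  "diag N \<equiv> chi (int N, int N)"

lemma laurent_diag: "laurent (monom (monom 1 N) N) = diag N"
  by (rule laurent_monom)

lemma diag_add: "diag (M + N) = (diag M * diag N :: lattice \<Rightarrow>\<^sub>0 'k::field)"
  by (simp add: mult_single)

lemma laurent_surj_shift:
  assumes "diag N * f = laurent F"
  shows "\<exists>G. diag (M + N) * f = laurent G"
proof
  show "diag (M + N) * f = laurent (monom (monom 1 M) M * F)"
    using assms unfolding diag_add by (simp add: laurent_hom.hom_mult laurent_diag mult.assoc)
qed

lemma laurent_surj: "\<exists>N F. diag N * f = laurent F"
proof -
  have "f \<in> monoid_algebra UNIV" by (simp add: malg_iff)
  then show ?thesis
  proof (induction f rule: malg_induct)
    case zero
    show ?case by (intro exI[of _ 0]) simp
  next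
    case (single m c)
    \<comment> \<open>At least the absolute value of either coordinate, so that the shift by N makes
      both exponents nonnegative.\<close>
    define N where "N = nat (\<bar>fst m\<bar> + \<bar>snd m\<bar>)"
    have "diag N * Poly_Mapping.single m c =
        laurent (monom (monom c (nat (int N + fst m))) (nat (int N + snd m)))"
    proof -
      have "0 \<le> int N + fst m" "0 \<le> int N + snd m" by (auto simp: N_def)
      then show ?thesis by (cases m) (simp add: laurent_monom mult_single)
    qed
    then show ?case by blast
  next
    case (add f g)
    then obtain M F N G where "diag M * f = laurent F" "diag N * g = laurent G" by blast
    with laurent_surj_shift[of M f F N] laurent_surj_shift[of N g G M]
    obtain F G where "diag (M + N) * f = laurent F" "diag (M + N) * g = laurent G"
      by (auto simp: add.commute)
    then have "diag (M + N) * (f + g) = laurent (F + G)"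
      by (simp add: distrib_left laurent_hom.hom_add)
    then show ?case by blast
  qed
qed

lemma laurent_surj_family:
  fixes f :: "nat \<Rightarrow> lattice \<Rightarrow>\<^sub>0 'k::field"
  shows "\<exists>N F. \<forall>i<n. diag N * f i = laurent (F i)"
proof -
  have "\<forall>i. \<exists>N F. diag N * f i = laurent F" using laurent_surj by blast
  then obtain N F where N: "\<And>i. diag (N i) * f i = laurent (F i)" by metis
  \<comment> \<open>The sum of the individual exponents is a common denominator for the whole
    family.\<close>
  have "\<exists>G. diag (sum N {..<n}) * f i = laurent G" if "i < n" for i
    using laurent_surj_shift[OF N, of "sum N ({..<n} - {i})" i] that
    by (simp add: sum.remove[of "{..<n}" i] add.commute)
  then show ?thesis by metis
qed

lemma laurent_no_zero_divisors:
  fixes f g :: "lattice \<Rightarrow>\<^sub>0 'k::field"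
  assumes "f * g = 0"
  shows "f = 0 \<or> g = 0"
proof -
  obtain M F N G where FG: "diag M * f = laurent F" "diag N * g = laurent G"
    using laurent_surj by metis
  have "laurent (F * G) = diag M * diag N * (f * g)"
    by (simp add: laurent_hom.hom_mult mult_ac flip: FG)
  then have "F * G = 0" using assms laurent_zero[of "F * G"] by (simp only: mult_zero_right)
  then have "diag M * f = 0 \<or> diag N * g = 0" using FG by auto
  then show ?thesis using chi_mult_cancel[of _ f 0] chi_mult_cancel[of _ g 0] by (metis mult_zero_right)
qed

lemma laurent_power_zero:
  fixes f :: "lattice \<Rightarrow>\<^sub>0 'k::field"
  shows "f ^ n = 0 \<Longrightarrow> f = 0"
  by (induction n) (auto dest: laurent_no_zero_divisors)

text \<open>Denominators are cleared with (xy)^N for a and b and with (xy)^K for the coefficients.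
  In k[x][y] the leading coefficient has become (xy)^K, a unit of k[M], so divisibility up to its
  powers is divisibility in k[M].\<close>

lemma laurent_integrally_closed:
  fixes a b :: "lattice \<Rightarrow>\<^sub>0 'k::field"
  assumes "b \<noteq> 0" and eq: "a ^ n + (\<Sum>i<n. c i * a ^ i * b ^ (n - i)) = 0"
  shows "\<exists>q. a = q * b"
proof -
  \<comment> \<open>Treated as a family of length two, so that a and b receive the same denominator
    and their ratio is unchanged.\<close>
  obtain N F where F: "\<forall>i<2::nat. diag N * (if i = 0 then a else b) = laurent (F i)"
    using laurent_surj_family[of 2 "\<lambda>i. if i = 0 then a else b"] by blast
  define A B where "A = F 0" and "B = F 1"
  have A: "diag N * a = laurent A" and B: "diag N * b = laurent B"
    using F[rule_format, of 0] F[rule_format, of 1] by (simp_all add: A_def B_def)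
  obtain K C where C: "\<And>i. i < n \<Longrightarrow> diag K * c i = laurent (C i)"
    using laurent_surj_family by metis
  define M where "M = (monom (monom 1 K) K :: 'k poly poly)"
  have "laurent (M * A ^ n + (\<Sum>i<n. C i * A ^ i * B ^ (n - i))) =
      diag K * (diag N * a) ^ n + (\<Sum>i<n. diag K * c i * (diag N * a) ^ i * (diag N * b) ^ (n - i))"
    by (simp add: laurent_hom.hom_add laurent_hom.hom_mult laurent_hom.hom_sum laurent_hom.hom_power
        M_def laurent_diag A B C)
  also have "\<dots> = diag K * diag N ^ n * (a ^ n + (\<Sum>i<n. c i * a ^ i * b ^ (n - i)))"
  proof -
    have "diag K * c i * (diag N * a) ^ i * (diag N * b) ^ (n - i) =
        diag K * diag N ^ n * (c i * a ^ i * b ^ (n - i))" if "i < n" for i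
    proof -
      have "diag N ^ n = (diag N ^ i * diag N ^ (n - i) :: lattice \<Rightarrow>\<^sub>0 'k)"
        using that by (simp flip: power_add)
      then show ?thesis by (simp add: power_mult_distrib mult_ac)
    qed
    then have "(\<Sum>i<n. diag K * c i * (diag N * a) ^ i * (diag N * b) ^ (n - i)) =
        (\<Sum>i<n. diag K * diag N ^ n * (c i * a ^ i * b ^ (n - i)))"
      by (intro sum.cong) simp_all
    moreover have "diag K * (diag N * a) ^ n = diag K * diag N ^ n * a ^ n"
      by (simp add: power_mult_distrib mult_ac)
    ultimately show ?thesis unfolding distrib_left sum_distrib_left by (simp only:)
  qed
  finally have "M * A ^ n + (\<Sum>i<n. C i * A ^ i * B ^ (n - i)) = 0"
    using eq laurent_zero by simp
  moreover have "B \<noteq> 0" using B assms(1) chi_mult_cancel[of _ b 0] by auto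
  ultimately obtain L where "B dvd M ^ L * A" using ufd_integral_dvd by blast
  then obtain E where E: "M ^ L * A = B * E" by (elim dvdE)
  have "diag K ^ L * (diag N * a) = diag N * b * laurent E"
    using arg_cong[OF E, of laurent]
    by (simp add: laurent_hom.hom_mult laurent_hom.hom_power M_def laurent_diag A B)
  then have "diag N * (diag K ^ L * a) = diag N * (laurent E * b)" by (simp add: mult_ac)
  then have "diag K ^ L * a = laurent E * b" by (rule chi_mult_cancel)
  moreover have "chi (- int K, - int K) ^ L * diag K ^ L = (1 :: lattice \<Rightarrow>\<^sub>0 'k)"
  proof -
    have "chi (- int K, - int K) * diag K = (1 :: lattice \<Rightarrow>\<^sub>0 'k)"
      by (simp add: mult_single flip: zero_prod_def)
    then show ?thesis by (simp flip: power_mult_distrib)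
  qed
  ultimately have "a = chi (- int K, - int K) ^ L * (laurent E * b)"
    using mult.assoc[of "chi (- int K, - int K) ^ L" "diag K ^ L" a] by simp
  then have "a = chi (- int K, - int K) ^ L * laurent E * b" by (simp only: mult.assoc)
  then show ?thesis by blast
qed

text \<open>If the least weight w of q were negative, the part of q^n of weight n w could not be
  cancelled: the coefficients have weight at least 0, and a lower power q^i starts at i w > n w. The
  n-th power of the lowest part of q would then vanish, but k[M] has no nilpotents.\<close>

lemma integral_support_nonneg:
  fixes q :: "lattice \<Rightarrow>\<^sub>0 'k::field" and l :: "lattice \<Rightarrow> int"
  assumes l: "\<And>m n. l (m + n) = l m + l n"
    and eq: "q ^ n + (\<Sum>i<n. c i * q ^ i) = 0"
    and c: "\<And>i. i < n \<Longrightarrow> c i \<in> monoid_algebra {m. 0 \<le> l m}"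
  shows "q \<in> monoid_algebra {m. 0 \<le> l m}"
proof (rule ccontr)
  assume "q \<notin> monoid_algebra {m. 0 \<le> l m}"
  then obtain m0 where m0: "m0 \<in> Poly_Mapping.keys q" "l m0 < 0"
    by (force simp: malg_iff)
  define w where "w = Min (l ` Poly_Mapping.keys q)"
  have w: "w \<in> l ` Poly_Mapping.keys q" "\<And>m. m \<in> Poly_Mapping.keys q \<Longrightarrow> w \<le> l m"
    using m0 unfolding w_def by (auto intro!: Min_in)
  have "w < 0" using w(2)[OF m0(1)] m0(2) by simp
  define q1 where "q1 = (\<Sum>m\<in>{m \<in> Poly_Mapping.keys q. l m = w}.
      Poly_Mapping.single m (Poly_Mapping.lookup q m))"
  define q2 where "q2 = (\<Sum>m\<in>{m \<in> Poly_Mapping.keys q. l m \<noteq> w}.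
      Poly_Mapping.single m (Poly_Mapping.lookup q m))"
  have q: "q = q1 + q2"
    unfolding q1_def q2_def
    by (subst poly_mapping_sum_single, subst sum.union_disjoint[symmetric]) (auto intro: sum.cong)
  have q1: "q1 \<in> monoid_algebra {m. l m = w}"
    unfolding q1_def by (intro malg_sum malg_single) auto
  have q2: "q2 \<in> monoid_algebra {m. w < l m}"
    unfolding q2_def by (intro malg_sum malg_single) (use w(2) in force)
  have qw: "q \<in> monoid_algebra {m. w \<le> l m}" using w(2) by (auto simp: malg_iff)
  have "q1 \<noteq> 0"
  proof
    assume "q1 = 0"
    then have "q \<in> monoid_algebra {m. w < l m}" using q q2 by simp
    then show False using w(1) by (auto simp: malg_iff)
  qed
  have l0: "l 0 = 0" using l[of 0 0] by simp
  have pow1: "q1 ^ k \<in> monoid_algebra {m. l m = int k * w}" for k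
  proof (induction k)
    case (Suc k)
    show ?case unfolding power_Suc by (rule malg_mult_subset[OF q1 Suc]) (auto simp: l algebra_simps)
  qed (simp add: l0 malg_one_zero)
  have pow: "q ^ k \<in> monoid_algebra {m. int k * w \<le> l m}" for k
  proof (induction k)
    case (Suc k)
    show ?case unfolding power_Suc by (rule malg_mult_subset[OF qw Suc]) (auto simp: l algebra_simps)
  qed (simp add: l0 malg_one_zero)
  \<comment> \<open>Replacing q^k by the power of the lowest part q1 changes only terms of weight
    above k w.\<close>
  have diff: "q ^ k - q1 ^ k \<in> monoid_algebra {m. int k * w < l m}" for k
  proof (induction k)
    case (Suc k)
    have "q * (q ^ k - q1 ^ k) \<in> monoid_algebra {m. int (Suc k) * w < l m}"
      by (rule malg_mult_subset[OF qw Suc]) (auto simp: l algebra_simps)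
    moreover have "q2 * q1 ^ k \<in> monoid_algebra {m. int (Suc k) * w < l m}"
      by (rule malg_mult_subset[OF q2 pow1]) (auto simp: l algebra_simps)
    moreover have "q ^ Suc k - q1 ^ Suc k = q * (q ^ k - q1 ^ k) + q2 * q1 ^ k"
      by (simp add: q algebra_simps)
    ultimately show ?case by (simp only: malg_add)
  qed simp
  have "(\<Sum>i<n. c i * q ^ i) \<in> monoid_algebra {m. int n * w < l m}"
  proof (rule malg_sum)
    fix i assume "i \<in> {..<n}"
    then have "i < n" by simp
    then have "int n * w < int i * w" using \<open>w < 0\<close> by simp
    show "c i * q ^ i \<in> monoid_algebra {m. int n * w < l m}"
      by (rule malg_mult_subset[OF c[OF \<open>i < n\<close>] pow])
        (use \<open>int n * w < int i * w\<close> in \<open>auto simp: l\<close>)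
  qed
  then have "(q ^ n - q1 ^ n) + (\<Sum>i<n. c i * q ^ i) \<in> monoid_algebra {m. int n * w < l m}"
    using diff malg_add by blast
  moreover have "q1 ^ n + ((q ^ n - q1 ^ n) + (\<Sum>i<n. c i * q ^ i)) = 0" using eq by simp
  ultimately have "q1 ^ n = 0"
    by (intro malg_disjoint_add_zero(1)[OF pow1]) auto
  then show False using laurent_power_zero \<open>q1 \<noteq> 0\<close> by blast
qed

text \<open>The fraction lies in k[M] because k[M] is integrally closed; after that each functional
  in L separately confines its support to a half plane.\<close>

lemma toric_normal:
  fixes L :: "(lattice \<Rightarrow> int) set"
  assumes L: "\<And>l m n. l \<in> L \<Longrightarrow> l (m + n) = l m + l n" and P: "P = {m. \<forall>l\<in>L. 0 \<le> l m}"
  shows "normal_variety (toric_variety P :: (_, 'k::field_char_0) variety)"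
  unfolding normal_variety_def
proof (intro ballI impI, elim conjE bexE exE)
  let ?X = "toric_variety P :: (_, 'k) variety"
  have "l 0 = 0" if "l \<in> L" for l using L[OF that, of 0 0] by simp
  then have sub: "is_submonoid P" by (auto simp: P L is_submonoid_def intro: eq_refl[OF sym])
  fix a b x0 n c
  assume a: "a \<in> reg_fun ?X" and b: "b \<in> reg_fun ?X" and x0: "x0 \<in> points ?X" "b x0 \<noteq> 0"
    and c: "\<forall>i<n. c i \<in> reg_fun ?X"
    and eq: "\<forall>x\<in>points ?X. a x ^ n + (\<Sum>i<n. c i x * a x ^ i * b x ^ (n - i)) = 0"
  obtain f where f: "f \<in> monoid_algebra P" "\<And>x. x \<in> points ?X \<Longrightarrow> a x = x f"
    using a by (auto simp: reg_fun_toric)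
  obtain g where g: "g \<in> monoid_algebra P" "\<And>x. x \<in> points ?X \<Longrightarrow> b x = x g"
    using b by (auto simp: reg_fun_toric)
  have "\<forall>i<n. \<exists>h\<in>monoid_algebra P. \<forall>x\<in>points ?X. c i x = x h"
    using c by (auto simp: reg_fun_toric)
  then obtain h where h: "\<And>i. i < n \<Longrightarrow> h i \<in> monoid_algebra P"
      "\<And>i x. i < n \<Longrightarrow> x \<in> points ?X \<Longrightarrow> c i x = x (h i)"
    by metis
  note cl = malg_power[OF sub] malg_mult[OF sub]
  have "g \<noteq> 0" using x0 g point_zero[OF x0(1)] by auto
  have "f ^ n + (\<Sum>i<n. h i * f ^ i * g ^ (n - i)) = 0"
  proof (rule toric_reduced[OF sub])
    have S: "(\<Sum>i<n. h i * f ^ i * g ^ (n - i)) \<in> monoid_algebra P"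
      by (intro malg_sum cl f g h) simp_all
    then show "f ^ n + (\<Sum>i<n. h i * f ^ i * g ^ (n - i)) \<in> monoid_algebra P"
      by (intro malg_add cl f)
    fix x assume x: "x \<in> points ?X"
    have "x (f ^ n + (\<Sum>i<n. h i * f ^ i * g ^ (n - i))) =
        x (f ^ n) + (\<Sum>i<n. x (h i * f ^ i * g ^ (n - i)))"
      by (subst point_add[OF x cl(1)[OF f(1)] S], subst point_sum[OF x])
        (auto intro!: cl f g h)
    also have "\<dots> = a x ^ n + (\<Sum>i<n. c i x * a x ^ i * b x ^ (n - i))"
      by (intro arg_cong2[of _ _ _ _ "(+)"] sum.cong)
        (auto simp: f g h x cl point_mult[OF x] point_power[OF sub x])
    finally show "x (f ^ n + (\<Sum>i<n. h i * f ^ i * g ^ (n - i))) = x 0"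
      using eq x point_zero[OF x] by simp
  qed simp
  with laurent_integrally_closed[OF \<open>g \<noteq> 0\<close>] obtain q where q: "f = q * g" by blast
  \<comment> \<open>Division by g^n produces a monic equation for q itself, the form required by the
    support estimate.\<close>
  have "g ^ n * (q ^ n + (\<Sum>i<n. h i * q ^ i)) = f ^ n + (\<Sum>i<n. h i * f ^ i * g ^ (n - i))"
  proof -
    have "g ^ n * (h i * q ^ i) = h i * f ^ i * g ^ (n - i)" if "i < n" for i
    proof -
      have "g ^ n = g ^ i * g ^ (n - i)" using that by (simp flip: power_add)
      then show ?thesis by (simp add: q power_mult_distrib mult_ac)
    qed
    then have "(\<Sum>i<n. g ^ n * (h i * q ^ i)) = (\<Sum>i<n. h i * f ^ i * g ^ (n - i))"
      by (intro sum.cong) simp_all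
    moreover have "g ^ n * q ^ n = f ^ n" by (simp add: q power_mult_distrib mult_ac)
    ultimately show ?thesis unfolding distrib_left sum_distrib_left by (simp only:)
  qed
  then have "q ^ n + (\<Sum>i<n. h i * q ^ i) = 0"
    using \<open>f ^ n + _ = 0\<close> \<open>g \<noteq> 0\<close> laurent_power_zero laurent_no_zero_divisors by metis
  then have "q \<in> monoid_algebra {m. 0 \<le> l m}" if "l \<in> L" for l
  proof (rule integral_support_nonneg[OF L[OF that]])
    show "h i \<in> monoid_algebra {m. 0 \<le> l m}" if "i < n" for i
      using h(1)[OF that] \<open>l \<in> L\<close> by (auto simp: P malg_iff)
  qed
  then have qP: "q \<in> monoid_algebra P" by (auto simp: P malg_iff)
  show "\<exists>q\<in>reg_fun ?X. \<forall>x\<in>points ?X. a x = q x * b x"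
  proof
    show "(\<lambda>x. x q) \<in> reg_fun ?X" using qP by (auto intro: reg_funI)
    show "\<forall>x\<in>points ?X. a x = x q * b x"
      using f g qP by (simp add: q point_mult)
  qed
qed

subsection \<open>Morphisms\<close>

lemma inverse_morphisms_sym: "inverse_morphisms X Y \<phi> \<psi> \<Longrightarrow> inverse_morphisms Y X \<psi> \<phi>"
  by (auto simp: inverse_morphisms_def)

lemma isomorphic_sym: "isomorphic X Y \<Longrightarrow> isomorphic Y X"
  unfolding isomorphic_def using inverse_morphisms_sym by blast

lemma morphism_point: "morphism X Y \<phi> \<Longrightarrow> x \<in> points X \<Longrightarrow> \<phi> x \<in> points Y"
  by (auto simp: morphism_def)

lemma morphism_reg_fun: "morphism X Y \<phi> \<Longrightarrow> F \<in> reg_fun Y \<Longrightarrow> (\<lambda>x. F (\<phi> x)) \<in> reg_fun X"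
  by (auto simp: morphism_def comp_def)

lemma morphism_comp: "morphism X Y \<phi> \<Longrightarrow> morphism Y Z \<psi> \<Longrightarrow> morphism X Z (\<lambda>x. \<psi> (\<phi> x))"
  by (force simp: morphism_def comp_def)

lemma isomorphic_trans:
  assumes "isomorphic X Y" "isomorphic Y Z"
  shows "isomorphic X Z"
proof -
  obtain f g where fg: "inverse_morphisms X Y f g" using assms(1) by (auto simp: isomorphic_def)
  obtain h k where hk: "inverse_morphisms Y Z h k" using assms(2) by (auto simp: isomorphic_def)
  have "inverse_morphisms X Z (\<lambda>x. h (f x)) (\<lambda>z. g (k z))"
    using fg hk unfolding inverse_morphisms_def by (auto intro: morphism_comp simp: morphism_point)
  then show ?thesis by (auto simp: isomorphic_def)
qed

subsection \<open>Tangent spaces\<close>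

text \<open>Elements of \<open>reg_fun X\<close> are total functions, so the first clause makes d
  depend only on the values on points. Homogeneity is the Leibniz rule with a constant
  factor.\<close>

definition point_derivation :: "('p, 'k::field) variety \<Rightarrow> 'p \<Rightarrow> (('p \<Rightarrow> 'k) \<Rightarrow> 'k) \<Rightarrow> bool" where
  "point_derivation X x d \<longleftrightarrow>
     (\<forall>f\<in>reg_fun X. \<forall>g\<in>reg_fun X. (\<forall>y\<in>points X. f y = g y) \<longrightarrow> d f = d g) \<and>
     (\<forall>c. d (\<lambda>_. c) = 0) \<and>
     (\<forall>f\<in>reg_fun X. \<forall>g\<in>reg_fun X. d (\<lambda>y. f y + g y) = d f + d g \<and>
        d (\<lambda>y. f y * g y) = f x * d g + g x * d f)"

lemma
  assumes "point_derivation X x d"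
  shows point_derivation_cong:
      "f \<in> reg_fun X \<Longrightarrow> g \<in> reg_fun X \<Longrightarrow> (\<And>y. y \<in> points X \<Longrightarrow> f y = g y) \<Longrightarrow> d f = d g"
    and point_derivation_const: "d (\<lambda>_. c) = 0"
    and point_derivation_add:
      "f \<in> reg_fun X \<Longrightarrow> g \<in> reg_fun X \<Longrightarrow> d (\<lambda>y. f y + g y) = d f + d g"
    and point_derivation_mult:
      "f \<in> reg_fun X \<Longrightarrow> g \<in> reg_fun X \<Longrightarrow> d (\<lambda>y. f y * g y) = f x * d g + g x * d f"
  using assms unfolding point_derivation_def by blast+

text \<open>A dimension bound without bases: a tangent space has dimension at most 2 exactly when
  some two differentials on it have trivial common kernel.\<close>

definition tangent_dim_le_2 :: "('p, 'k::field) variety \<Rightarrow> 'p \<Rightarrow> bool" where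
  "tangent_dim_le_2 X x \<longleftrightarrow> (\<exists>u\<in>reg_fun X. \<exists>v\<in>reg_fun X. \<forall>d.
     point_derivation X x d \<and> d u = 0 \<and> d v = 0 \<longrightarrow> (\<forall>f\<in>reg_fun X. d f = 0))"

lemma tangent_dim_le_2_iso:
  assumes iso: "inverse_morphisms X Y \<phi> \<psi>" and x: "x \<in> points X"
    and le: "tangent_dim_le_2 Y (\<phi> x)"
  shows "tangent_dim_le_2 X x"
proof -
  have m: "morphism X Y \<phi>" "morphism Y X \<psi>" and inv: "\<And>x. x \<in> points X \<Longrightarrow> \<psi> (\<phi> x) = x"
    using iso by (auto simp: inverse_morphisms_def)
  obtain u v where uv: "u \<in> reg_fun Y" "v \<in> reg_fun Y"
    and d0: "\<And>d f. point_derivation Y (\<phi> x) d \<Longrightarrow> d u = 0 \<Longrightarrow> d v = 0 \<Longrightarrow> f \<in> reg_fun Y \<Longrightarrow> d f = 0"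
    using le unfolding tangent_dim_le_2_def by blast
  show ?thesis
    unfolding tangent_dim_le_2_def
  proof (intro bexI allI impI ballI, elim conjE)
    show "(\<lambda>x. u (\<phi> x)) \<in> reg_fun X" "(\<lambda>x. v (\<phi> x)) \<in> reg_fun X"
      using morphism_reg_fun[OF m(1)] uv by auto
    fix d f assume d: "point_derivation X x d" "d (\<lambda>x. u (\<phi> x)) = 0" "d (\<lambda>x. v (\<phi> x)) = 0"
      and f: "f \<in> reg_fun X"
    \<comment> \<open>The push-forward of d along \<phi>; since \<psi> is a left inverse, d is
      recovered from it.\<close>
    define e where "e g = d (\<lambda>x. g (\<phi> x))" for g
    have "point_derivation Y (\<phi> x) e"
      using d(1) morphism_reg_fun[OF m(1)] morphism_point[OF m(1)]
      unfolding point_derivation_def e_def by simp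
    then have "e (\<lambda>y. f (\<psi> y)) = 0"
      using d0[of e] d(2,3) morphism_reg_fun[OF m(2) f] by (simp add: e_def)
    moreover have "e (\<lambda>y. f (\<psi> y)) = d f"
    proof -
      have "(\<lambda>x. f (\<psi> (\<phi> x))) \<in> reg_fun X"
        using morphism_reg_fun[OF m(1)] morphism_reg_fun[OF m(2) f] by blast
      then show ?thesis unfolding e_def by (intro point_derivation_cong[OF d(1)] f) (simp_all add: inv)
    qed
    ultimately show "d f = 0" by simp
  qed
qed

section \<open>Regular functions on toric varieties and a criterion for the tangent bound\<close>

lemma reg_fun_const: "is_submonoid S \<Longrightarrow> (\<lambda>_. c) \<in> reg_fun (toric_variety S)"
  by (rule reg_funI[OF malg_const]) (simp_all add: point_const)

lemma reg_fun_eval: "f \<in> monoid_algebra S \<Longrightarrow> (\<lambda>x. x f) \<in> reg_fun (toric_variety S)"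
  by (rule reg_funI) simp_all

lemma reg_fun_obtain:
  assumes "F \<in> reg_fun (toric_variety S)"
  obtains f where "f \<in> monoid_algebra S" "\<And>x. x \<in> points (toric_variety S) \<Longrightarrow> F x = x f"
  using assms by (auto simp: reg_fun_toric)

lemma reg_fun_add:
  assumes "F \<in> reg_fun (toric_variety S)" "G \<in> reg_fun (toric_variety S)"
  shows "(\<lambda>x. F x + G x) \<in> reg_fun (toric_variety S)"
proof -
  obtain f where f: "f \<in> monoid_algebra S" "\<And>x. x \<in> points (toric_variety S) \<Longrightarrow> F x = x f"
    by (rule reg_fun_obtain[OF assms(1)]) blast
  obtain g where g: "g \<in> monoid_algebra S" "\<And>x. x \<in> points (toric_variety S) \<Longrightarrow> G x = x g"
    by (rule reg_fun_obtain[OF assms(2)]) blast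
  show ?thesis by (rule reg_funI[OF malg_add[OF f(1) g(1)]]) (simp add: f g point_add)
qed

lemma reg_fun_mult:
  assumes "is_submonoid S" "F \<in> reg_fun (toric_variety S)" "G \<in> reg_fun (toric_variety S)"
  shows "(\<lambda>x. F x * G x) \<in> reg_fun (toric_variety S)"
proof -
  obtain f where f: "f \<in> monoid_algebra S" "\<And>x. x \<in> points (toric_variety S) \<Longrightarrow> F x = x f"
    by (rule reg_fun_obtain[OF assms(2)]) blast
  obtain g where g: "g \<in> monoid_algebra S" "\<And>x. x \<in> points (toric_variety S) \<Longrightarrow> G x = x g"
    by (rule reg_fun_obtain[OF assms(3)]) blast
  show ?thesis by (rule reg_funI[OF malg_mult[OF assms(1) f(1) g(1)]]) (simp add: f g point_mult)
qed

lemma reg_fun_sum: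
  assumes "is_submonoid S" "\<And>i. i \<in> I \<Longrightarrow> F i \<in> reg_fun (toric_variety S)"
  shows "(\<lambda>x. \<Sum>i\<in>I. F i x) \<in> reg_fun (toric_variety S)"
  using assms(2)
  by (induction I rule: infinite_finite_induct) (auto intro: reg_fun_const[OF assms(1)] reg_fun_add)

lemma reg_fun_cong:
  assumes "F \<in> reg_fun (toric_variety S)" "\<And>x. x \<in> points (toric_variety S) \<Longrightarrow> F x = G x"
  shows "G \<in> reg_fun (toric_variety S)"
proof -
  obtain f where f: "f \<in> monoid_algebra S" "\<And>x. x \<in> points (toric_variety S) \<Longrightarrow> F x = x f"
    by (rule reg_fun_obtain[OF assms(1)]) blast
  show ?thesis by (rule reg_funI[OF f(1)]) (use f(2) assms(2) in metis)
qed

text \<open>C stands for the set of exponents whose monomials are killed by d. The Leibniz rule d(a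
  + b) = x(a) d(b) + x(b) d(a) makes it closed under sums in P and under removing a summand b that
  is nonzero at x. The tangent bound thus becomes the combinatorial condition that p and q generate
  P in this sense.\<close>

lemma tangent_dim_le_2_toric:
  fixes x :: "(lattice \<Rightarrow>\<^sub>0 'k::field) \<Rightarrow> 'k"
  assumes P: "is_submonoid P" and x: "x \<in> points (toric_variety P)"
    and pq: "p \<in> P" "q \<in> P"
    and gen: "\<And>C m. \<lbrakk>0 \<in> C; p \<in> C; q \<in> C; \<And>a b. \<lbrakk>a \<in> C; b \<in> C; a \<in> P; b \<in> P\<rbrakk> \<Longrightarrow> a + b \<in> C;
        \<And>a b. \<lbrakk>a \<in> P; b \<in> P; b \<in> C; a + b \<in> C; x (chi b) \<noteq> 0\<rbrakk> \<Longrightarrow> a \<in> C; m \<in> P\<rbrakk> \<Longrightarrow> m \<in> C"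
  shows "tangent_dim_le_2 (toric_variety P) x"
proof -
  let ?X = "toric_variety P :: (_, 'k) variety"
  let ?ev = "\<lambda>m (x :: (lattice \<Rightarrow>\<^sub>0 'k) \<Rightarrow> 'k). x (chi m)"
  have pq': "?ev p \<in> reg_fun ?X" "?ev q \<in> reg_fun ?X"
    using pq by (auto intro: reg_fun_eval malg_single)
  have "d F = 0" if d: "point_derivation ?X x d" "d (?ev p) = 0" "d (?ev q) = 0"
    and F: "F \<in> reg_fun ?X" for d F
  proof -
  have ev: "?ev m \<in> reg_fun ?X" if "m \<in> P" for m using that by (intro reg_fun_eval malg_single)
  have cong: "d F = d G" if "F \<in> reg_fun ?X" "\<And>y. y \<in> points ?X \<Longrightarrow> F y = G y" for F G
    using point_derivation_cong[OF d(1) that(1) reg_fun_cong[OF that]] that by blast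
  have sum: "d (?ev (m + n)) = x (chi m) * d (?ev n) + x (chi n) * d (?ev m)"
    if "m \<in> P" "n \<in> P" for m n
  proof -
    have "d (?ev (m + n)) = d (\<lambda>y. y (chi m) * y (chi n))"
      using that P by (intro cong ev) (auto simp: point_chi_add is_submonoid_add)
    then show ?thesis using point_derivation_mult[OF d(1) ev ev] that by simp
  qed
  have "d (\<lambda>y. 1) = 0" by (rule point_derivation_const[OF d(1)])
  then have "d (?ev 0) = 0"
    using cong[OF ev[of 0], of "\<lambda>_. 1"] P by (simp add: is_submonoid_zero point_one)
  then have chi0: "d (?ev m) = 0" if "m \<in> P" for m
    using gen[of "{m. d (?ev m) = 0}" m] that d(2,3) sum by auto
  obtain f where f: "f \<in> monoid_algebra P" "\<And>x. x \<in> points ?X \<Longrightarrow> F x = x f"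
    by (rule reg_fun_obtain[OF F]) blast
  have ev0: "d (\<lambda>y. y f) = 0"
    using f(1)
  proof (induction f rule: malg_induct)
    case zero
    have "d (\<lambda>y. y 0) = d (\<lambda>_. 0)"
      by (intro cong reg_fun_eval malg_zero) (simp add: point_zero)
    then show ?case using point_derivation_const[OF d(1)] by simp
  next
    case (single m c)
    have "d (\<lambda>y. y (Poly_Mapping.single m c)) = d (\<lambda>y. c * y (chi m))"
      using single by (intro cong reg_fun_eval malg_single) (auto intro: point_single[OF P])
    also have "\<dots> = c * d (?ev m) + x (chi m) * d (\<lambda>_. c)"
      by (rule point_derivation_mult[OF d(1) reg_fun_const[OF P] ev[OF single]])
    also have "\<dots> = 0" using point_derivation_const[OF d(1)] chi0[OF single] by simp
    finally show ?case .
  next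
    case (add f g)
    have "d (\<lambda>y. y (f + g)) = d (\<lambda>y. y f + y g)"
      using add by (intro cong reg_fun_eval malg_add) (auto simp: point_add)
    also have "\<dots> = d (\<lambda>y. y f) + d (\<lambda>y. y g)"
      using add by (intro point_derivation_add[OF d(1)] reg_fun_eval)
    finally show ?case using add by simp
  qed
  have "d F = d (\<lambda>y. y f)" using F f(2) by (rule point_derivation_cong[OF d(1) _ reg_fun_eval[OF f(1)]])
  from this ev0 show "d F = 0" by (rule trans)
  qed
  then show ?thesis unfolding tangent_dim_le_2_def using pq' by blast
qed

section \<open>The tangent space at the fixed point\<close>

definition indecomposable :: "lattice set \<Rightarrow> lattice \<Rightarrow> bool" where
  "indecomposable P h \<longleftrightarrow> h \<in> P \<and> h \<noteq> 0 \<and> (\<forall>m\<in>P. \<forall>n\<in>P. m + n = h \<longrightarrow> m = 0 \<or> n = 0)"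

text \<open>Within P only 0 + h and h + 0 contribute to the exponent h. This is the Leibniz rule for
  the coefficient at h, taken at the point that reads off constant terms.\<close>

lemma lookup_mult_indecomposable:
  fixes f g :: "lattice \<Rightarrow>\<^sub>0 'k::field"
  assumes h: "indecomposable P h" and "f \<in> monoid_algebra P" and g: "g \<in> monoid_algebra P"
  shows "Poly_Mapping.lookup (f * g) h =
    Poly_Mapping.lookup f 0 * Poly_Mapping.lookup g h + Poly_Mapping.lookup g 0 * Poly_Mapping.lookup f h"
  using assms(2)
proof (induction f rule: malg_induct)
  case (single m c)
  from g show ?case
  proof (induction g rule: malg_induct)
    case (single n e)
    have "m = 0 \<and> n = h \<or> n = 0 \<and> m = h" if "m + n = h"
      using h that single \<open>m \<in> P\<close> unfolding indecomposable_def by fastforce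
    moreover have "h \<noteq> 0" using h by (simp add: indecomposable_def)
    ultimately show ?case by (auto simp: mult_single lookup_single when_def)
  qed (simp_all add: lookup_add algebra_simps)
qed (simp_all add: lookup_add algebra_simps)

definition pointed :: "lattice set \<Rightarrow> bool" where
  "pointed P \<longleftrightarrow> is_submonoid P \<and> (\<forall>m\<in>P. \<forall>n\<in>P. m + n = 0 \<longrightarrow> m = 0 \<and> n = 0)"

text \<open>The torus-fixed point, at which all monomials except 1 vanish. Its multiplicativity
  rests on \<open>pointed\<close>.\<close>

definition vertex :: "lattice set \<Rightarrow> (lattice \<Rightarrow>\<^sub>0 'k::field) \<Rightarrow> 'k" where
  "vertex P = char_point P (\<lambda>m. if m = 0 then 1 else 0)"

lemma vertex_point: "pointed P \<Longrightarrow> (vertex P :: _ \<Rightarrow> 'k::field) \<in> points (toric_variety P)"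
  unfolding vertex_def
proof (rule char_point_in)
  assume P: "pointed P"
  then show "is_submonoid P" by (simp add: pointed_def)
  have "m + n = 0 \<longleftrightarrow> m = 0 \<and> n = 0" if "m \<in> P" "n \<in> P" for m n
    using P that unfolding pointed_def by (metis add_0)
  then show "character P (\<lambda>m. if m = 0 then 1 else 0 :: 'k)"
    unfolding character_def by (simp del: split_paired_All)
qed

lemma vertex_apply:
  assumes "f \<in> monoid_algebra P"
  shows "vertex P f = Poly_Mapping.lookup f 0"
proof -
  have "eval_char (\<lambda>m. if m = 0 then 1 else 0) f = (\<Sum>m\<in>Poly_Mapping.keys f. if m = 0 then Poly_Mapping.lookup f m else 0)"
    unfolding eval_char_def by (intro sum.cong) auto
  also have "\<dots> = Poly_Mapping.lookup f 0" by (simp add: in_keys_iff)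
  finally show ?thesis using assms by (simp add: vertex_def char_point_apply)
qed

lemma two_linear_equations:
  fixes a1 :: "'k::field"
  shows "\<exists>c1 c2 c3. (c1 \<noteq> 0 \<or> c2 \<noteq> 0 \<or> c3 \<noteq> 0) \<and>
    c1 * a1 + c2 * a2 + c3 * a3 = 0 \<and> c1 * b1 + c2 * b2 + c3 * b3 = 0"
proof -
  \<comment> \<open>The cross product of the two rows solves the system. If it vanishes, the rows
    are proportional, and a vector orthogonal to a nonzero row is orthogonal to both.\<close>
  define d1 d2 d3 where d: "d1 = a2 * b3 - a3 * b2" "d2 = a3 * b1 - a1 * b3" "d3 = a1 * b2 - a2 * b1"
  consider "d1 \<noteq> 0 \<or> d2 \<noteq> 0 \<or> d3 \<noteq> 0" | "a1 = 0" "a2 = 0" "a3 = 0" "b1 = 0" "b2 = 0" "b3 = 0"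
    | "d1 = 0" "d2 = 0" "d3 = 0" "a1 \<noteq> 0 \<or> a2 \<noteq> 0 \<or> a3 \<noteq> 0"
    | "d1 = 0" "d2 = 0" "d3 = 0" "b1 \<noteq> 0 \<or> b2 \<noteq> 0 \<or> b3 \<noteq> 0" by blast
  then show ?thesis
  proof cases
    case 1
    then show ?thesis
      by (intro exI[of _ d1] exI[of _ d2] exI[of _ d3]) (simp add: d algebra_simps)
  next
    case 2
    then show ?thesis by (intro exI[of _ 1]) simp
  next
    case 3
    show ?thesis
    proof (cases "a1 = 0 \<and> a2 = 0")
      case True
      with 3 show ?thesis
        by (intro exI[of _ 1] exI[of _ 0]) (use 3 d in \<open>auto\<close>)
    next
      case False
      moreover have "a2 * b1 = a1 * b2" using 3 d by simp
      ultimately have "(a2 \<noteq> 0 \<or> - a1 \<noteq> 0 \<or> (0::'k) \<noteq> 0) \<and>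
          a2 * a1 + - a1 * a2 + 0 * a3 = 0 \<and> a2 * b1 + - a1 * b2 + 0 * b3 = 0"
        by (auto simp: mult.commute[of a2 a1])
      then show ?thesis by blast
    qed
  next
    case 4
    show ?thesis
    proof (cases "b1 = 0 \<and> b2 = 0")
      case True
      with 4 show ?thesis
        by (intro exI[of _ 1] exI[of _ 0]) (use 4 d in \<open>auto\<close>)
    next
      case False
      moreover have "b2 * a1 = b1 * a2" using 4 d by (simp add: mult.commute)
      ultimately have "(b2 \<noteq> 0 \<or> - b1 \<noteq> 0 \<or> (0::'k) \<noteq> 0) \<and>
          b2 * a1 + - b1 * a2 + 0 * a3 = 0 \<and> b2 * b1 + - b1 * b2 + 0 * b3 = 0"
        by (auto simp: mult.commute[of b2 b1])
      then show ?thesis by blast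
    qed
  qed
qed

text \<open>The coefficients at h1, h2, h3 are three independent point derivations, and some
  nontrivial combination of three derivations vanishes on any two given functions.\<close>

lemma vertex_tangent_dim:
  fixes P :: "lattice set"
  assumes P: "pointed P" and h: "indecomposable P h1" "indecomposable P h2" "indecomposable P h3"
    and ne: "h1 \<noteq> h2" "h1 \<noteq> h3" "h2 \<noteq> h3"
  shows "\<not> tangent_dim_le_2 (toric_variety P :: (_, 'k::field_char_0) variety) (vertex P)"
proof
  let ?X = "toric_variety P :: (_, 'k) variety"
  have sub: "is_submonoid P" using P by (simp add: pointed_def)
  assume "tangent_dim_le_2 ?X (vertex P)"
  then obtain u v where uv: "u \<in> reg_fun ?X" "v \<in> reg_fun ?X"
    and d0: "\<And>d f. point_derivation ?X (vertex P) d \<Longrightarrow> d u = 0 \<Longrightarrow> d v = 0 \<Longrightarrow> f \<in> reg_fun ?X \<Longrightarrow> d f = 0"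
    unfolding tangent_dim_le_2_def by blast
  \<comment> \<open>Reducedness makes the representing element of k[P] unique, so its coefficients
    depend only on the regular function.\<close>
  define rep where "rep F = (THE f. f \<in> monoid_algebra P \<and> (\<forall>x\<in>points ?X. F x = x f))" for F
  have rep: "rep F = f" if "f \<in> monoid_algebra P" "\<And>x. x \<in> points ?X \<Longrightarrow> F x = x f" for F f
    unfolding rep_def
    by (rule the_equality) (use that in \<open>auto intro!: toric_reduced[OF sub]\<close>)
  have repE: "rep F \<in> monoid_algebra P" "\<And>x. x \<in> points ?X \<Longrightarrow> F x = x (rep F)"
    if "F \<in> reg_fun ?X" for F
    using that rep by (auto simp: reg_fun_toric)
  obtain c1 c2 c3 where c: "c1 \<noteq> 0 \<or> c2 \<noteq> 0 \<or> c3 \<noteq> 0"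
    and cu: "c1 * Poly_Mapping.lookup (rep u) h1 + c2 * Poly_Mapping.lookup (rep u) h2
      + c3 * Poly_Mapping.lookup (rep u) h3 = 0"
    and cv: "c1 * Poly_Mapping.lookup (rep v) h1 + c2 * Poly_Mapping.lookup (rep v) h2
      + c3 * Poly_Mapping.lookup (rep v) h3 = 0"
    using two_linear_equations[of "Poly_Mapping.lookup (rep u) h1" "Poly_Mapping.lookup (rep u) h2"
        "Poly_Mapping.lookup (rep u) h3" "Poly_Mapping.lookup (rep v) h1"
        "Poly_Mapping.lookup (rep v) h2" "Poly_Mapping.lookup (rep v) h3"] by blast
  define d where "d F = c1 * Poly_Mapping.lookup (rep F) h1 + c2 * Poly_Mapping.lookup (rep F) h2
      + c3 * Poly_Mapping.lookup (rep F) h3" for F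
  have h0: "h1 \<noteq> 0" "h2 \<noteq> 0" "h3 \<noteq> 0" and hP: "h1 \<in> P" "h2 \<in> P" "h3 \<in> P"
    using h by (auto simp: indecomposable_def)
  have "point_derivation ?X (vertex P) d"
    unfolding point_derivation_def
  proof (intro conjI ballI allI impI)
    fix F G assume F: "F \<in> reg_fun ?X" and G: "G \<in> reg_fun ?X"
    show "d F = d G" if "\<forall>y\<in>points ?X. F y = G y"
    proof -
      have "rep F = rep G" using repE[OF G] that by (intro rep) auto
      then show ?thesis by (simp add: d_def)
    qed
    have "rep (\<lambda>y. F y + G y) = rep F + rep G"
      using repE[OF F] repE[OF G] by (intro rep) (auto simp: malg_add point_add)
    then show "d (\<lambda>y. F y + G y) = d F + d G" by (simp add: d_def lookup_add algebra_simps)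
    have m: "rep (\<lambda>y. F y * G y) = rep F * rep G"
      using repE[OF F] repE[OF G] by (intro rep) (auto simp: malg_mult[OF sub] point_mult)
    have "F (vertex P) = Poly_Mapping.lookup (rep F) 0" "G (vertex P) = Poly_Mapping.lookup (rep G) 0"
      using repE[OF F] repE[OF G] vertex_point[OF P] by (metis vertex_apply)+
    then show "d (\<lambda>y. F y * G y) = F (vertex P) * d G + G (vertex P) * d F"
      using repE(1)[OF F] repE(1)[OF G] h
      by (simp add: d_def m lookup_mult_indecomposable algebra_simps)
  next
    fix c
    have "rep (\<lambda>_. c) = Poly_Mapping.single 0 c"
      by (intro rep malg_const sub) (simp add: point_const)
    then show "d (\<lambda>_. c) = 0" using h0 by (simp add: d_def lookup_single when_def)
  qed
  moreover have "d u = 0" "d v = 0" using cu cv by (simp_all add: d_def)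
  ultimately have z: "d (\<lambda>x. x (chi m)) = 0" if "m \<in> P" for m
    using d0[of d] that reg_fun_eval malg_single by blast
  have rc: "rep (\<lambda>x. x (chi m)) = chi m" if "m \<in> P" for m
    using that by (intro rep malg_single) auto
  \<comment> \<open>On the monomials of h1, h2, h3 the derivation takes the values c1, c2, c3, which
    would all be zero.\<close>
  show False
    using z[OF hP(1)] z[OF hP(2)] z[OF hP(3)] ne c
    unfolding d_def rc[OF hP(1)] rc[OF hP(2)] rc[OF hP(3)] by (simp add: lookup_single when_def)
qed

subsection \<open>Automorphisms of a toric variety and of its normalization\<close>

lemma points_restrict:
  assumes "S \<subseteq> P" "is_submonoid S" "x \<in> points (toric_variety P)"
  shows "toric_inclusion S x \<in> points (toric_variety S)"
  using assms(3) malg_mono[OF assms(1)] malg_const[OF assms(2)]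
  unfolding points_toric closed_points_def toric_inclusion_def
  by (auto simp: malg_add malg_mult[OF assms(2)] subset_iff)

text \<open>Here g is the pull-back of f along \<phi>. An automorphism that descends to X_S has a
  pull-back preserving k[S]; applied to explicit automorphisms and monomials, this forces new
  exponents into S.\<close>

lemma lifted_Aut_pullback:
  fixes P :: "lattice set"
  defines "X \<equiv> toric_variety P :: (_, 'k::field_char_0) variety"
  assumes SP: "S \<subseteq> P" and sub: "is_submonoid S" "is_submonoid P"
    and Aut: "Aut X = lifted_Aut X (toric_variety S) (toric_inclusion S)"
    and inv: "inverse_morphisms X X \<phi> \<psi>"
    and f: "f \<in> monoid_algebra S" and g: "g \<in> monoid_algebra P"
    and fg: "\<And>x. x \<in> points X \<Longrightarrow> x g = \<phi> x f"
  shows "g \<in> monoid_algebra S"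
proof -
  define \<phi>' where "\<phi>' = restrict \<phi> (points X)"
  have m: "morphism X X \<phi>" "morphism X X \<psi>" using inv by (auto simp: inverse_morphisms_def)
  have "morphism X X \<phi>'"
    unfolding morphism_def
  proof safe
    fix x assume "x \<in> points X"
    then show "\<phi>' x \<in> points X" using morphism_point[OF m(1)] by (simp add: \<phi>'_def)
  next
    fix F assume "F \<in> reg_fun X"
    from morphism_reg_fun[OF m(1) this] show "F \<circ> \<phi>' \<in> reg_fun X"
      unfolding X_def by (rule reg_fun_cong) (simp add: \<phi>'_def X_def)
  qed
  then have "inverse_morphisms X X \<phi>' \<psi>"
    using inv morphism_point[OF m(2)] by (auto simp: inverse_morphisms_def \<phi>'_def)
  then have "\<phi>' \<in> Aut X" by (auto simp: Aut_def \<phi>'_def)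
  obtain \<chi> where \<chi>: "\<chi> \<in> Aut (toric_variety S)"
    "\<And>x. x \<in> points X \<Longrightarrow> toric_inclusion S (\<phi>' x) = \<chi> (toric_inclusion S x)"
    using \<open>\<phi>' \<in> Aut X\<close>[unfolded Aut] unfolding lifted_Aut_def by blast
  then have "morphism (toric_variety S) (toric_variety S) \<chi>"
    by (auto simp: Aut_def inverse_morphisms_def)
  from morphism_reg_fun[OF this reg_fun_eval[OF f]] obtain h where h: "h \<in> monoid_algebra S"
    "\<And>y. y \<in> points (toric_variety S) \<Longrightarrow> \<chi> y f = y h"
    by (auto simp: reg_fun_toric)
  have "g = h"
  proof (rule toric_reduced[OF sub(2) g])
    show "h \<in> monoid_algebra P" using h(1) malg_mono[OF SP] by blast
    fix x :: "(lattice \<Rightarrow>\<^sub>0 'k) \<Rightarrow> 'k" assume x: "x \<in> points (toric_variety P)"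
    then have "x g = toric_inclusion S (\<phi>' x) f"
      using fg f by (simp add: X_def \<phi>'_def toric_inclusion_def)
    also have "\<dots> = toric_inclusion S x h"
      using \<chi>(2) x h(2) points_restrict[OF SP sub(1) x] by (simp add: X_def)
    also have "\<dots> = x h" using h(1) by (simp add: toric_inclusion_def)
    finally show "x g = x h" .
  qed
  then show ?thesis using h(1) by simp
qed

text \<open>An automorphism descends once its pull-back restricts to k[S]. The hypothesis covers the
  inverse automorphism as well, so both restrictions exist, and they are inverse to each
  other.\<close>

lemma Aut_eq_lifted_Aut:
  fixes P :: "lattice set"
  defines "X \<equiv> toric_variety P :: (_, 'k::field_char_0) variety"
  assumes SP: "S \<subseteq> P" and sub: "is_submonoid S" "is_submonoid P"
    and pull: "\<And>\<phi> \<psi> f. inverse_morphisms X X \<phi> \<psi> \<Longrightarrow> f \<in> monoid_algebra S \<Longrightarrow>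
      \<exists>g\<in>monoid_algebra S. \<forall>x\<in>points X. x g = \<phi> x f"
  shows "Aut X = lifted_Aut X (toric_variety S) (toric_inclusion S)"
proof
  show "lifted_Aut X (toric_variety S) (toric_inclusion S) \<subseteq> Aut X" by (auto simp: lifted_Aut_def)
  let ?Y = "toric_variety S :: (_, 'k) variety"
  let ?A = "monoid_algebra S :: (lattice \<Rightarrow>\<^sub>0 'k) set"
  note sp = subsetD[OF malg_mono[OF SP]]
  show "Aut X \<subseteq> lifted_Aut X ?Y (toric_inclusion S)"
  proof
    fix \<phi> assume \<phi>: "\<phi> \<in> Aut X"
    then obtain \<psi> where inv: "inverse_morphisms X X \<phi> \<psi>" by (auto simp: Aut_def)
    \<comment> \<open>The map on points of X_S dual to \<alpha>, that is, composition with \<alpha>;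
      the two restrictions keep points and automorphisms extensional.\<close>
    define induced where "induced \<alpha> = restrict (\<lambda>y. restrict (\<lambda>f. y (\<alpha> f)) ?A) (points ?Y)"
      for \<alpha> :: "(lattice \<Rightarrow>\<^sub>0 'k) \<Rightarrow> lattice \<Rightarrow>\<^sub>0 'k"
    have induced: "morphism ?Y ?Y (induced \<alpha>)"
      if inv: "inverse_morphisms X X \<phi> \<psi>"
        and \<alpha>: "\<And>f. f \<in> ?A \<Longrightarrow> \<alpha> f \<in> ?A" "\<And>f x. f \<in> ?A \<Longrightarrow> x \<in> points X \<Longrightarrow> x (\<alpha> f) = \<phi> x f"
      for \<phi> \<psi> \<alpha>
    proof -
      have \<phi>x: "\<phi> x \<in> points X" if "x \<in> points X" for x
        using inv that by (auto simp: inverse_morphisms_def morphism_def)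
      \<comment> \<open>\<alpha> is known only through its values at points of X. That it is a
        homomorphism of algebras is recovered from reducedness, here for scalars and below for sums
        and products.\<close>
      have const: "\<alpha> (Poly_Mapping.single 0 c) = Poly_Mapping.single 0 c" for c
      proof (rule toric_reduced[OF sub(2)])
        have c: "Poly_Mapping.single 0 c \<in> ?A" by (rule malg_const[OF sub(1)])
        show "\<alpha> (Poly_Mapping.single 0 c) \<in> monoid_algebra P"
          "Poly_Mapping.single 0 c \<in> monoid_algebra P" using sp c \<alpha>(1) by blast+
        fix x :: "(lattice \<Rightarrow>\<^sub>0 'k) \<Rightarrow> 'k" assume x: "x \<in> points (toric_variety P)"
        then have \<phi>': "\<phi> x \<in> points (toric_variety P)" using \<phi>x by (simp add: X_def)
        show "x (\<alpha> (Poly_Mapping.single 0 c)) = x (Poly_Mapping.single 0 c)"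
          using \<alpha>(2)[OF c, of x] x by (simp add: X_def point_const[OF x] point_const[OF \<phi>'])
      qed
      have add: "\<alpha> (f + g) = \<alpha> f + \<alpha> g" if f: "f \<in> ?A" and g: "g \<in> ?A" for f g
      proof (rule toric_reduced[OF sub(2)])
        have fg: "f + g \<in> ?A" by (rule malg_add[OF f g])
        show "\<alpha> (f + g) \<in> monoid_algebra P" by (rule sp[OF \<alpha>(1)[OF fg]])
        show "\<alpha> f + \<alpha> g \<in> monoid_algebra P"
          by (rule sp) (rule malg_add[OF \<alpha>(1)[OF f] \<alpha>(1)[OF g]])
        fix x :: "(lattice \<Rightarrow>\<^sub>0 'k) \<Rightarrow> 'k" assume "x \<in> points (toric_variety P)"
        then have x: "x \<in> points X" by (simp add: X_def)
        show "x (\<alpha> (f + g)) = x (\<alpha> f + \<alpha> g)"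
          unfolding \<alpha>(2)[OF fg x] point_add[OF x[unfolded X_def] sp[OF \<alpha>(1)[OF f]] sp[OF \<alpha>(1)[OF g]]]
            \<alpha>(2)[OF f x] \<alpha>(2)[OF g x] by (rule point_add[OF \<phi>x[OF x, unfolded X_def] sp[OF f] sp[OF g]])
      qed
      have mult: "\<alpha> (f * g) = \<alpha> f * \<alpha> g" if f: "f \<in> ?A" and g: "g \<in> ?A" for f g
      proof (rule toric_reduced[OF sub(2)])
        have fg: "f * g \<in> ?A" by (rule malg_mult[OF sub(1),OF f g])
        show "\<alpha> (f * g) \<in> monoid_algebra P" by (rule sp[OF \<alpha>(1)[OF fg]])
        show "\<alpha> f * \<alpha> g \<in> monoid_algebra P"
          by (rule sp) (rule malg_mult[OF sub(1),OF \<alpha>(1)[OF f] \<alpha>(1)[OF g]])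
        fix x :: "(lattice \<Rightarrow>\<^sub>0 'k) \<Rightarrow> 'k" assume "x \<in> points (toric_variety P)"
        then have x: "x \<in> points X" by (simp add: X_def)
        show "x (\<alpha> (f * g)) = x (\<alpha> f * \<alpha> g)"
          unfolding \<alpha>(2)[OF fg x] point_mult[OF x[unfolded X_def] sp[OF \<alpha>(1)[OF f]] sp[OF \<alpha>(1)[OF g]]]
            \<alpha>(2)[OF f x] \<alpha>(2)[OF g x] by (rule point_mult[OF \<phi>x[OF x, unfolded X_def] sp[OF f] sp[OF g]])
      qed
      have pt: "induced \<alpha> y \<in> points ?Y" if y: "y \<in> points ?Y" for y
        unfolding points_toric closed_points_def
      proof (intro CollectI conjI allI ballI)
        show "induced \<alpha> y \<in> extensional ?A" using y by (simp add: induced_def)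
        show "induced \<alpha> y (Poly_Mapping.single 0 c) = c" for c
          using y by (simp add: induced_def malg_const[OF sub(1)] const point_const)
        fix f g assume "f \<in> ?A" "g \<in> ?A"
        then show "induced \<alpha> y (f + g) = induced \<alpha> y f + induced \<alpha> y g"
          "induced \<alpha> y (f * g) = induced \<alpha> y f * induced \<alpha> y g"
          using y by (simp_all add: induced_def malg_add malg_mult[OF sub(1)] add mult \<alpha> point_add point_mult)
      qed
      show ?thesis
        unfolding morphism_def
      proof safe
        fix y assume "y \<in> points ?Y" then show "induced \<alpha> y \<in> points ?Y" by (rule pt)
      next
        fix F assume "F \<in> reg_fun ?Y"
        then obtain f where f: "f \<in> ?A" "\<And>y. y \<in> points ?Y \<Longrightarrow> F y = y f"
          by (rule reg_fun_obtain) blast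
        then show "F \<circ> induced \<alpha> \<in> reg_fun ?Y"
          by (intro reg_funI[of "\<alpha> f"]) (auto simp: \<alpha> pt, simp add: induced_def)
      qed
    qed
    obtain \<alpha> where \<alpha>: "\<And>f. f \<in> ?A \<Longrightarrow> \<alpha> f \<in> ?A" "\<And>f x. f \<in> ?A \<Longrightarrow> x \<in> points X \<Longrightarrow> x (\<alpha> f) = \<phi> x f"
      using pull[OF inv] by metis
    note inv' = inverse_morphisms_sym[OF inv]
    obtain \<beta> where \<beta>: "\<And>f. f \<in> ?A \<Longrightarrow> \<beta> f \<in> ?A" "\<And>f x. f \<in> ?A \<Longrightarrow> x \<in> points X \<Longrightarrow> x (\<beta> f) = \<psi> x f"
      using pull[OF inv'] by metis
    have pts: "\<phi> x \<in> points X" "\<psi> x \<in> points X" "\<psi> (\<phi> x) = x" "\<phi> (\<psi> x) = x" if "x \<in> points X" for x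
      using inv that by (auto simp: inverse_morphisms_def morphism_def)
    have ab: "\<alpha> (\<beta> f) = f" if "f \<in> ?A" for f
      by (rule toric_reduced[OF sub(2)]) (use that pts in \<open>auto simp: X_def sp \<alpha> \<beta>\<close>)
    have ba: "\<beta> (\<alpha> f) = f" if "f \<in> ?A" for f
      by (rule toric_reduced[OF sub(2)]) (use that pts in \<open>auto simp: X_def sp \<alpha> \<beta>\<close>)
    have ma: "morphism ?Y ?Y (induced \<alpha>)" by (rule induced[OF inv \<alpha>])
    have mb: "morphism ?Y ?Y (induced \<beta>)" by (rule induced[OF inv' \<beta>])
    have invol: "induced \<gamma> (induced \<delta> y) = y"
      if "y \<in> points ?Y" "morphism ?Y ?Y (induced \<delta>)" "\<And>f. f \<in> ?A \<Longrightarrow> \<delta> (\<gamma> f) = f"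
        "\<And>f. f \<in> ?A \<Longrightarrow> \<gamma> f \<in> ?A" for \<gamma> \<delta> y
    proof (rule extensionalityI[of _ ?A])
      show "y \<in> extensional ?A" using that(1) by (rule point_ext)
      have y': "induced \<delta> y \<in> points ?Y" using that(1,2) by (rule morphism_point[rotated])
      then show "induced \<gamma> (induced \<delta> y) \<in> extensional ?A" by (simp add: induced_def)
      fix f assume "f \<in> ?A"
      then show "induced \<gamma> (induced \<delta> y) f = y f"
        using y' that by (simp add: induced_def[of \<gamma>]) (simp add: induced_def)
    qed
    have "inverse_morphisms ?Y ?Y (induced \<alpha>) (induced \<beta>)"
      unfolding inverse_morphisms_def
      using ma mb invol[OF _ ma ab \<beta>(1)] invol[OF _ mb ba \<alpha>(1)] by blast
    then have "induced \<alpha> \<in> Aut ?Y" by (auto simp: Aut_def induced_def)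
    moreover have "toric_inclusion S (\<phi> x) = induced \<alpha> (toric_inclusion S x)" if x: "x \<in> points X" for x
    proof (rule extensionalityI[of _ ?A])
      have "toric_inclusion S x \<in> points ?Y" using points_restrict[OF SP sub(1)] x by (simp add: X_def)
      then have e: "induced \<alpha> (toric_inclusion S x) = restrict (\<lambda>f. toric_inclusion S x (\<alpha> f)) ?A"
        by (simp add: induced_def)
      then show "induced \<alpha> (toric_inclusion S x) \<in> extensional ?A" by simp
      show "toric_inclusion S (\<phi> x) \<in> extensional ?A" by (simp add: toric_inclusion_def)
      fix f assume "f \<in> ?A"
      then show "toric_inclusion S (\<phi> x) f = induced \<alpha> (toric_inclusion S x) f"
        unfolding e using x by (simp add: toric_inclusion_def \<alpha>)
    qed
    ultimately show "\<phi> \<in> lifted_Aut X ?Y (toric_inclusion S)" using \<phi> by (auto simp: lifted_Aut_def)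
  qed
qed

subsection \<open>Coordinates on the lattice\<close>

text \<open>A basis of the lattice, given by its coordinate map and the dual basis. Allowing any
  basis avoids moving half planes and quadrants into standard position.\<close>

locale lattice_coordinates =
  fixes comb :: "int \<Rightarrow> int \<Rightarrow> lattice" and l1 l2 :: "lattice \<Rightarrow> int"
  assumes comb_add: "comb (a + c) (b + d) = comb a b + comb c d"
    and l_comb [simp]: "l1 (comb a b) = a" "l2 (comb a b) = b"
    and comb_l [simp]: "comb (l1 m) (l2 m) = m"
begin

lemma comb_zero [simp]: "comb 0 0 = 0"
  using comb_add[of 0 0 0 0] by simp

lemma l_add: "l1 (m + n) = l1 m + l1 n" "l2 (m + n) = l2 m + l2 n"
  using comb_add[of "l1 m" "l1 n" "l2 m" "l2 n"] l_comb by (metis comb_l)+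

lemma l_zero [simp]: "l1 0 = 0" "l2 0 = 0"
  using l_add[of 0 0] by auto

lemma l_minus: "l1 (- m) = - l1 m" "l2 (- m) = - l2 m"
  using l_add[of m "- m"] by auto

lemma swap: "lattice_coordinates (\<lambda>a b. comb b a) l2 l1"
  by unfold_locales (simp_all add: comb_add)

end

interpretation standard: lattice_coordinates Pair fst snd
  by unfold_locales simp_all

text \<open>A one-dimensional factor paired with the exponents of its monomials, so that one
  argument covers all three exceptional products.\<close>

definition line_exponents :: "('k::field, 'k) variety \<Rightarrow> int set \<Rightarrow> bool" where
  "line_exponents L E \<longleftrightarrow> L = mult_group \<and> E = UNIV \<or> L = affine_line \<and> E = {0..}"

lemma line_exponents_zero: "line_exponents L E \<Longrightarrow> 0 \<in> E"
  by (auto simp: line_exponents_def)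

lemma line_exponents_one: "line_exponents L E \<Longrightarrow> 1 \<in> E"
  by (auto simp: line_exponents_def)

lemma line_exponents_add: "line_exponents L E \<Longrightarrow> a \<in> E \<Longrightarrow> b \<in> E \<Longrightarrow> a + b \<in> E"
  by (auto simp: line_exponents_def)

text \<open>The exponent law for \<open>powi\<close> can fail at t = 0 for exponents of opposite
  sign. Here either t is nonzero or no exponent is negative.\<close>

lemma line_powi_add:
  assumes "line_exponents L E" "t \<in> points L" "a \<in> E" "b \<in> E"
  shows "t powi (a + b) = t powi a * t powi b"
  using assms(1) unfolding line_exponents_def
proof (elim disjE conjE)
  assume "L = mult_group"
  then show ?thesis using assms(2) by (simp add: mult_group_def power_int_add)
next
  assume "E = {0..}"
  then show ?thesis using assms(3,4) by (simp add: power_int_def nat_add_distrib power_add)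
qed

lemma line_monomial_regular:
  assumes "line_exponents L E" "e \<in> E"
  shows "(\<lambda>t. c * t powi e) \<in> reg_fun L"
  using assms(1) unfolding line_exponents_def
proof (elim disjE conjE)
  assume "L = mult_group"
  have "c * t powi e = poly (monom c (nat e)) t / t ^ nat (- e)" if "t \<noteq> 0" for t
    using that by (simp add: power_int_def poly_monom divide_inverse power_inverse)
  then show ?thesis unfolding \<open>L = mult_group\<close> mult_group_def by auto
next
  assume "L = affine_line" "E = {0..}"
  then have "c * t powi e = poly (monom c (nat e)) t" for t
    using assms(2) by (simp add: power_int_def poly_monom)
  then show ?thesis unfolding \<open>L = affine_line\<close> affine_line_def by auto
qed

lemma line_regular_monomials:
  assumes "line_exponents L E" "f \<in> reg_fun L"
  shows "\<exists>(n::nat) c e. (\<forall>i<n. e i \<in> E) \<and> (\<forall>t\<in>points L. f t = (\<Sum>i<n. c i * t powi e i))"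
  using assms(1) unfolding line_exponents_def
proof (elim disjE conjE)
  assume L: "L = mult_group" and E: "E = UNIV"
  obtain p N where "\<And>t. t \<noteq> 0 \<Longrightarrow> f t = poly p t / t ^ N"
    using assms(2) by (auto simp: L mult_group_def)
  then have "f t = (\<Sum>i<Suc (degree p). coeff p i * t powi (int i - int N))" if "t \<noteq> 0" for t
    using that by (simp add: poly_altdef sum_divide_distrib power_int_diff lessThan_Suc_atMost)
  then show ?thesis unfolding L E mult_group_def
    by (intro exI[of _ "Suc (degree p)"] exI[of _ "coeff p"] exI[of _ "\<lambda>i. int i - int N"]) auto
next
  assume L: "L = affine_line" and E: "E = {0..}"
  obtain p where "\<And>t. f t = poly p t" using assms(2) by (auto simp: L affine_line_def)
  then have "f t = (\<Sum>i<Suc (degree p). coeff p i * t powi int i)" for t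
    by (simp add: poly_altdef lessThan_Suc_atMost)
  then show ?thesis unfolding L E affine_line_def
    by (intro exI[of _ "Suc (degree p)"] exI[of _ "coeff p"] exI[of _ int]) auto
qed

text \<open>A homomorphism on the exponents is determined by its value at 1. If negative exponents
  occur, this value is a unit, so in both cases it is a point of the line.\<close>

lemma line_character:
  assumes L: "line_exponents L E" and g0: "g 0 = 1"
    and g: "\<And>a b. a \<in> E \<Longrightarrow> b \<in> E \<Longrightarrow> g (a + b) = g a * g b"
  shows "g 1 \<in> points L" and "e \<in> E \<Longrightarrow> g e = g 1 powi e"
proof -
  have nat: "g (int n) = g 1 ^ n" for n
  proof (induction n)
    case (Suc n)
    have "int n \<in> E" "1 \<in> E" using L by (auto simp: line_exponents_def)
    then show ?case using g[of 1 "int n"] Suc by (simp add: add.commute)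
  qed (simp add: g0)
  have inv: "g a * g (- a) = 1" if "E = UNIV" for a using g[of a "- a"] g0 that by simp
  show "g 1 \<in> points L"
    using L inv[of 1] unfolding line_exponents_def by (auto simp: mult_group_def affine_line_def)
  show "g e = g 1 powi e" if e: "e \<in> E"
  proof (cases "0 \<le> e")
    case True
    then show ?thesis using nat[of "nat e"] by (simp add: power_int_def)
  next
    case False
    then have "E = UNIV" using L e by (auto simp: line_exponents_def)
    then have "g (- e) * g e = 1" using inv[of "- e"] by simp
    moreover have "g (- e) = g 1 ^ nat (- e)" using nat[of "nat (- e)"] False by simp
    ultimately have "g e = inverse (g 1 ^ nat (- e))" using inverse_unique by metis
    then show ?thesis using False by (simp add: power_int_def power_inverse)
  qed
qed

context lattice_coordinates
begin

definition orthant :: "int set \<Rightarrow> int set \<Rightarrow> lattice set" where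
  "orthant E1 E2 = {m. l1 m \<in> E1 \<and> l2 m \<in> E2}"

lemma comb_orthant [simp]: "comb a b \<in> orthant E1 E2 \<longleftrightarrow> a \<in> E1 \<and> b \<in> E2"
  by (simp add: orthant_def)

lemma orthant_submonoid:
  "line_exponents L1 E1 \<Longrightarrow> line_exponents L2 E2 \<Longrightarrow> is_submonoid (orthant E1 E2)"
  by (auto simp: is_submonoid_def orthant_def l_add line_exponents_zero line_exponents_add)

text \<open>The coordinates of a point are its values on the two basis monomials; conversely, a pair
  of coordinates defines a character of the orthant.\<close>

lemma orthant_isomorphic:
  fixes L1 L2 :: "('k::field_char_0, 'k) variety"
  assumes L: "line_exponents L1 E1" "line_exponents L2 E2"
  shows "isomorphic (toric_variety (orthant E1 E2)) (L1 \<times>\<^sub>v L2)"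
proof -
  let ?P = "orthant E1 E2"
  let ?X = "toric_variety ?P :: (_, 'k) variety"
  have P: "is_submonoid ?P" using L by (rule orthant_submonoid)
  note zero = line_exponents_zero[OF L(1)] line_exponents_zero[OF L(2)]
  define \<phi> :: "((lattice \<Rightarrow>\<^sub>0 'k) \<Rightarrow> 'k) \<Rightarrow> 'k \<times> 'k" where
    "\<phi> x = (x (chi (comb 1 0)), x (chi (comb 0 1)))" for x
  define \<psi> :: "'k \<times> 'k \<Rightarrow> (lattice \<Rightarrow>\<^sub>0 'k) \<Rightarrow> 'k" where
    "\<psi> s = char_point ?P (\<lambda>m. fst s powi l1 m * snd s powi l2 m)" for s
  have g1: "x (chi (comb a 0)) = x (chi (comb 1 0)) powi a" "x (chi (comb 1 0)) \<in> points L1"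
    if x: "x \<in> points ?X" and a: "a \<in> E1" for x a
  proof -
    have mul: "x (chi (comb (c + d) 0)) = x (chi (comb c 0)) * x (chi (comb d 0))" if "c \<in> E1" "d \<in> E1" for c d
      using comb_add[of c d 0 0] point_chi_add[OF P x, of "comb c 0" "comb d 0"] that zero by simp
    have one: "x (chi (comb 0 0)) = 1" using point_one[OF x] by simp
    show "x (chi (comb a 0)) = x (chi (comb 1 0)) powi a" "x (chi (comb 1 0)) \<in> points L1"
      using line_character[OF L(1), of "\<lambda>a. x (chi (comb a 0))", OF one mul] a by blast+
  qed
  have g2: "x (chi (comb 0 b)) = x (chi (comb 0 1)) powi b" "x (chi (comb 0 1)) \<in> points L2"
    if x: "x \<in> points ?X" and b: "b \<in> E2" for x b
  proof -
    have mul: "x (chi (comb 0 (c + d))) = x (chi (comb 0 c)) * x (chi (comb 0 d))" if "c \<in> E2" "d \<in> E2" for c d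
      using comb_add[of 0 0 c d] point_chi_add[OF P x, of "comb 0 c" "comb 0 d"] that zero by simp
    have one: "x (chi (comb 0 0)) = 1" using point_one[OF x] by simp
    show "x (chi (comb 0 b)) = x (chi (comb 0 1)) powi b" "x (chi (comb 0 1)) \<in> points L2"
      using line_character[OF L(2), of "\<lambda>b. x (chi (comb 0 b))", OF one mul] b by blast+
  qed
  have \<phi>pt: "\<phi> x \<in> points L1 \<times> points L2" if "x \<in> points ?X" for x
    using g1(2)[OF that zero(1)] g2(2)[OF that zero(2)] by (simp add: \<phi>_def)
  have \<psi>pt: "\<psi> s \<in> points ?X" if "s \<in> points L1 \<times> points L2" for s
    unfolding \<psi>_def
  proof (rule char_point_in[OF P])
    show "character ?P (\<lambda>m. fst s powi l1 m * snd s powi l2 m)"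
      unfolding character_def
    proof (intro conjI ballI)
      fix m n assume "m \<in> ?P" "n \<in> ?P"
      then show "fst s powi l1 (m + n) * snd s powi l2 (m + n) =
          fst s powi l1 m * snd s powi l2 m * (fst s powi l1 n * snd s powi l2 n)"
        using that L by (auto simp: orthant_def l_add line_powi_add)
    qed simp
  qed
  have m\<phi>: "morphism ?X (L1 \<times>\<^sub>v L2) \<phi>"
    unfolding morphism_def
  proof (intro conjI ballI)
    show "\<phi> ` points ?X \<subseteq> points (L1 \<times>\<^sub>v L2)"
      using \<phi>pt by (simp add: variety_product_def image_subset_iff)
    fix F assume "F \<in> reg_fun (L1 \<times>\<^sub>v L2)"
    then obtain n :: nat and f g where fg: "\<And>i. i < n \<Longrightarrow> f i \<in> reg_fun L1" "\<And>i. i < n \<Longrightarrow> g i \<in> reg_fun L2"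
      and F: "\<And>x y. x \<in> points L1 \<Longrightarrow> y \<in> points L2 \<Longrightarrow> F (x, y) = (\<Sum>i<n. f i x * g i y)"
      unfolding variety_product_def by auto blast
    have r1: "(\<lambda>x. f i (x (chi (comb 1 0)))) \<in> reg_fun ?X" if i: "i < n" for i
    proof -
      obtain N :: nat and c e where e: "\<And>j. j < N \<Longrightarrow> e j \<in> E1"
        "\<And>t. t \<in> points L1 \<Longrightarrow> f i t = (\<Sum>j<N. c j * t powi e j)"
        using line_regular_monomials[OF L(1) fg(1)[OF i]] by blast
      have "(\<lambda>x. \<Sum>j<N. c j * x (chi (comb (e j) 0))) \<in> reg_fun ?X"
        using e(1) zero
        by (intro reg_fun_sum[OF P] reg_fun_mult[OF P] reg_fun_const[OF P] reg_fun_eval malg_single) auto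
      then show ?thesis
        by (rule reg_fun_cong) (use e g1 zero in \<open>auto intro!: sum.cong\<close>)
    qed
    have r2: "(\<lambda>x. g i (x (chi (comb 0 1)))) \<in> reg_fun ?X" if i: "i < n" for i
    proof -
      obtain N :: nat and c e where e: "\<And>j. j < N \<Longrightarrow> e j \<in> E2"
        "\<And>t. t \<in> points L2 \<Longrightarrow> g i t = (\<Sum>j<N. c j * t powi e j)"
        using line_regular_monomials[OF L(2) fg(2)[OF i]] by blast
      have "(\<lambda>x. \<Sum>j<N. c j * x (chi (comb 0 (e j)))) \<in> reg_fun ?X"
        using e(1) zero
        by (intro reg_fun_sum[OF P] reg_fun_mult[OF P] reg_fun_const[OF P] reg_fun_eval malg_single) auto
      then show ?thesis
        by (rule reg_fun_cong) (use e g2 zero in \<open>auto intro!: sum.cong\<close>)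
    qed
    have "(\<lambda>x. \<Sum>i<n. f i (x (chi (comb 1 0))) * g i (x (chi (comb 0 1)))) \<in> reg_fun ?X"
      by (intro reg_fun_sum[OF P] reg_fun_mult[OF P] r1 r2) auto
    then show "F \<circ> \<phi> \<in> reg_fun ?X"
      by (rule reg_fun_cong) (use \<phi>pt F in \<open>auto simp: \<phi>_def\<close>)
  qed
  have m\<psi>: "morphism (L1 \<times>\<^sub>v L2) ?X \<psi>"
    unfolding morphism_def
  proof (intro conjI ballI)
    show "\<psi> ` points (L1 \<times>\<^sub>v L2) \<subseteq> points ?X"
      using \<psi>pt by (simp add: variety_product_def image_subset_iff)
    fix F assume "F \<in> reg_fun ?X"
    then obtain f where f: "f \<in> monoid_algebra ?P" "\<And>x. x \<in> points ?X \<Longrightarrow> F x = x f"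
      by (rule reg_fun_obtain) blast
    define K where "K = Poly_Mapping.keys f"
    have K: "m \<in> ?P" if "m \<in> K" for m using f(1) that by (auto simp: K_def malg_iff)
    have "finite K" by (simp add: K_def)
    \<comment> \<open>Regular functions on a product are sums over an initial segment of the
      naturals, hence the numbering of the support of f.\<close>
    then obtain h where h: "bij_betw h {..<card K} K"
      by (metis ex_bij_betw_nat_finite lessThan_atLeast0)
    have hK: "h i \<in> K" if "i < card K" for i using h that by (auto dest: bij_betwE)
    show "F \<circ> \<psi> \<in> reg_fun (L1 \<times>\<^sub>v L2)"
      unfolding variety_product_def
    proof (simp, intro exI conjI allI impI ballI)
      fix i assume "i < card K"
      then have "l1 (h i) \<in> E1" "l2 (h i) \<in> E2" using hK K by (auto simp: orthant_def)
      then show "(\<lambda>s. Poly_Mapping.lookup f (h i) * s powi l1 (h i)) \<in> reg_fun L1"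
        "(\<lambda>t. 1 * t powi l2 (h i)) \<in> reg_fun L2"
        using line_monomial_regular[OF L(1)] line_monomial_regular[OF L(2)] by blast+
    next
      fix s t assume "s \<in> points L1" "t \<in> points L2"
      then have "F (\<psi> (s, t)) = (\<Sum>m\<in>K. Poly_Mapping.lookup f m * (s powi l1 m * t powi l2 m))"
        using f \<psi>pt[of "(s, t)"] by (simp add: \<psi>_def char_point_apply eval_char_def K_def)
      also have "\<dots> = (\<Sum>i<card K. Poly_Mapping.lookup f (h i) * s powi l1 (h i) * (1 * t powi l2 (h i)))"
        by (subst sum.reindex_bij_betw[OF h, symmetric]) (simp add: mult.assoc)
      finally show "F (\<psi> (s, t)) =
        (\<Sum>i<card K. Poly_Mapping.lookup f (h i) * s powi l1 (h i) * (1 * t powi l2 (h i)))" .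
    qed
  qed
  have "\<psi> (\<phi> x) = x" if x: "x \<in> points ?X" for x
  proof (rule point_eqI[OF P \<psi>pt[OF \<phi>pt[OF x]] x])
    fix m assume m: "m \<in> ?P"
    then have E: "l1 m \<in> E1" "l2 m \<in> E2" by (auto simp: orthant_def)
    have "\<psi> (\<phi> x) (chi m) = x (chi (comb (l1 m) 0)) * x (chi (comb 0 (l2 m)))"
      using m g1(1)[OF x E(1)] g2(1)[OF x E(2)] by (simp add: \<psi>_def char_point_chi \<phi>_def)
    also have "\<dots> = x (chi (comb (l1 m) 0 + comb 0 (l2 m)))"
      using E zero by (intro point_chi_add[OF P x, symmetric]) auto
    also have "\<dots> = x (chi m)" by (simp flip: comb_add)
    finally show "\<psi> (\<phi> x) (chi m) = x (chi m)" .
  qed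
  moreover have "\<phi> (\<psi> s) = s" for s
    using zero line_exponents_one[OF L(1)] line_exponents_one[OF L(2)]
    by (simp add: \<phi>_def \<psi>_def char_point_chi)
  ultimately have "inverse_morphisms ?X (L1 \<times>\<^sub>v L2) \<phi> \<psi>"
    using m\<phi> m\<psi> by (simp add: inverse_morphisms_def)
  then show ?thesis by (auto simp: isomorphic_def)
qed

end

text \<open>The basis monomials generate all others up to inverses, and a monomial with an inverse
  vanishes nowhere, so it may be cancelled.\<close>

lemma smooth_tangent_dim:
  fixes x :: "(lattice \<Rightarrow>\<^sub>0 'k::field) \<Rightarrow> 'k"
  assumes L: "line_exponents L1 E1" "line_exponents L2 E2"
    and x: "x \<in> points (toric_variety (standard.orthant E1 E2))"
  shows "tangent_dim_le_2 (toric_variety (standard.orthant E1 E2)) x"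
proof (rule tangent_dim_le_2_toric[OF standard.orthant_submonoid[OF L] x, of "(1, 0)" "(0, 1)"])
  let ?P = "standard.orthant E1 E2"
  have P: "is_submonoid ?P" using L by (rule standard.orthant_submonoid)
  note one = line_exponents_zero[OF L(1)] line_exponents_zero[OF L(2)]
    line_exponents_one[OF L(1)] line_exponents_one[OF L(2)]
  show "(1, 0) \<in> ?P" "(0, 1) \<in> ?P" using one by auto
  fix C m
  assume C0: "0 \<in> C" and C1: "(1, 0) \<in> C" "(0, 1) \<in> C"
    and add: "\<And>a b. \<lbrakk>a \<in> C; b \<in> C; a \<in> ?P; b \<in> ?P\<rbrakk> \<Longrightarrow> a + b \<in> C"
    and canc: "\<And>a b. \<lbrakk>a \<in> ?P; b \<in> ?P; b \<in> C; a + b \<in> C; x (chi b) \<noteq> 0\<rbrakk> \<Longrightarrow> a \<in> C"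
    and m: "m \<in> ?P"
  have unit: "- a \<in> C" if "a \<in> C" "a \<in> ?P" "- a \<in> ?P" for a
  proof (rule canc[OF that(3,2,1)])
    show "- a + a \<in> C" using C0 by simp
    have "x (chi (- a)) * x (chi a) = 1"
      using point_chi_add[OF P x that(3,2)] point_one[OF x] by simp
    then show "x (chi a) \<noteq> 0" by auto
  qed
  have n1: "(int n, 0) \<in> C" for n
  proof (induction n)
    case (Suc n)
    have "(int n, 0) \<in> ?P" using L(1) one by (auto simp: line_exponents_def)
    then show ?case using add[OF Suc C1(1)] one by (simp add: add.commute)
  qed (use C0 in \<open>simp flip: zero_prod_def\<close>)
  have n2: "(0, int n) \<in> C" for n
  proof (induction n)
    case (Suc n)
    have "(0, int n) \<in> ?P" using L(2) one by (auto simp: line_exponents_def)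
    then show ?case using add[OF Suc C1(2)] one by (simp add: add.commute)
  qed (use C0 in \<open>simp flip: zero_prod_def\<close>)
  obtain a b where ab: "m = (a, b)" "a \<in> E1" "b \<in> E2" using m by (cases m) auto
  have "(a, 0) \<in> C"
  proof (cases "0 \<le> a")
    case True then show ?thesis using n1[of "nat a"] by simp
  next
    case False
    then have "E1 = UNIV" using L(1) ab(2) by (auto simp: line_exponents_def)
    then show ?thesis using unit[of "(- a, 0)"] n1[of "nat (- a)"] False one by simp
  qed
  moreover have "(0, b) \<in> C"
  proof (cases "0 \<le> b")
    case True then show ?thesis using n2[of "nat b"] by simp
  next
    case False
    then have "E2 = UNIV" using L(2) ab(3) by (auto simp: line_exponents_def)
    then show ?thesis using unit[of "(0, - b)"] n2[of "nat (- b)"] False one by simp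
  qed
  ultimately show "m \<in> C" using add[of "(a, 0)" "(0, b)"] ab one by simp
qed

subsection \<open>Automorphisms that force \<open>S = P\<close>\<close>

text \<open>The self-map of X whose pull-back sends the monomial m to g(m); it is described on
  monomials only, as points are.\<close>

definition char_map :: "lattice set \<Rightarrow> (lattice \<Rightarrow> lattice \<Rightarrow>\<^sub>0 'k) \<Rightarrow> ((lattice \<Rightarrow>\<^sub>0 'k::field) \<Rightarrow> 'k) \<Rightarrow> (lattice \<Rightarrow>\<^sub>0 'k) \<Rightarrow> 'k"
  where "char_map P g x = char_point P (\<lambda>m. x (g m))"

lemma char_map_morphism:
  fixes g :: "lattice \<Rightarrow> lattice \<Rightarrow>\<^sub>0 'k::field"
  assumes P: "is_submonoid P" and gP: "\<And>m. m \<in> P \<Longrightarrow> g m \<in> monoid_algebra P"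
    and g: "g 0 = 1" "\<And>m n. m \<in> P \<Longrightarrow> n \<in> P \<Longrightarrow> g (m + n) = g m * g n"
  shows "morphism (toric_variety P) (toric_variety P) (char_map P g)"
proof -
  let ?X = "toric_variety P :: (_, 'k) variety"
  have pt: "char_map P g x \<in> points (toric_variety P)" if x: "x \<in> points (toric_variety P)" for x
    unfolding char_map_def
    by (rule char_point_in[OF P])
      (simp add: character_def g point_one[OF x] point_mult[OF x] gP del: split_paired_All)
  show ?thesis
    unfolding morphism_def
  proof (intro conjI ballI)
    show "char_map P g ` points (toric_variety P) \<subseteq> points (toric_variety P)" using pt by blast
    fix F assume "F \<in> reg_fun ?X"
    then obtain f where f: "f \<in> monoid_algebra P" "\<And>x. x \<in> points ?X \<Longrightarrow> F x = x f"
      by (rule reg_fun_obtain) blast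
    have "(\<lambda>x :: (lattice \<Rightarrow>\<^sub>0 'k) \<Rightarrow> 'k. \<Sum>m\<in>Poly_Mapping.keys f. Poly_Mapping.lookup f m * x (g m)) \<in> reg_fun ?X"
      using f(1) by (intro reg_fun_sum[OF P] reg_fun_mult[OF P] reg_fun_const[OF P] reg_fun_eval gP)
        (auto simp: malg_iff)
    then show "F \<circ> char_map P g \<in> reg_fun ?X"
      by (rule reg_fun_cong)
        (simp add: f pt, simp add: char_map_def char_point_apply f eval_char_def)
  qed
qed

lemma char_map_inverse:
  assumes P: "is_submonoid P"
    and m: "morphism (toric_variety P) (toric_variety P) (char_map P g)"
      "morphism (toric_variety P) (toric_variety P) (char_map P h)"
    and gh: "\<And>x m. x \<in> points (toric_variety P) \<Longrightarrow> m \<in> P \<Longrightarrow> char_map P g x (h m) = x (chi m)"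
    and hg: "\<And>x m. x \<in> points (toric_variety P) \<Longrightarrow> m \<in> P \<Longrightarrow> char_map P h x (g m) = x (chi m)"
  shows "inverse_morphisms (toric_variety P) (toric_variety P) (char_map P g) (char_map P h)"
proof -
  have *: "char_map P h (char_map P g x) = x"
    if x: "x \<in> points (toric_variety P)"
      and "morphism (toric_variety P) (toric_variety P) (char_map P g)"
      "morphism (toric_variety P) (toric_variety P) (char_map P h)"
      "\<And>m. m \<in> P \<Longrightarrow> char_map P g x (h m) = x (chi m)" for x g h
  proof (rule point_eqI[OF P _ x])
    show "char_map P h (char_map P g x) \<in> points (toric_variety P)"
      by (rule morphism_point[OF that(3) morphism_point[OF that(2) x]])
    fix m assume "m \<in> P"
    then show "char_map P h (char_map P g x) (chi m) = x (chi m)"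
      using that(4) by (simp add: char_map_def[of P h] char_point_chi)
  qed
  show ?thesis
    unfolding inverse_morphisms_def using m *[OF _ m] *[OF _ m(2,1)] gh hg by blast
qed

text \<open>Inversion of the torus sends each monomial to its inverse. Hence S is closed under
  negation and coincides with the group it generates.\<close>

lemma symmetric_lifted_imp_UNIV:
  fixes S :: "lattice set"
  defines "X \<equiv> toric_variety UNIV :: (_, 'k::field_char_0) variety"
  assumes S: "is_submonoid S" and gen: "is_subgroup hull S = UNIV"
    and Aut: "Aut X = lifted_Aut X (toric_variety S) (toric_inclusion S)"
  shows "S = UNIV"
proof -
  let ?g = "\<lambda>m. chi (- m) :: lattice \<Rightarrow>\<^sub>0 'k"
  have U: "is_submonoid (UNIV :: lattice set)" by (simp add: is_submonoid_def)
  have mor: "morphism X X (char_map UNIV ?g)"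
    unfolding X_def
    by (rule char_map_morphism[OF U]) (simp_all add: malg_single mult_single)
  have inv: "inverse_morphisms X X (char_map UNIV ?g) (char_map UNIV ?g)"
    unfolding X_def
    by (rule char_map_inverse[OF U mor[unfolded X_def] mor[unfolded X_def]])
      (simp_all add: char_map_def char_point_chi)
  have "?g m \<in> monoid_algebra S" if "m \<in> S" for m
    by (rule lifted_Aut_pullback[OF subset_UNIV S U Aut[unfolded X_def] inv[unfolded X_def]
          malg_single[OF that, of 1] malg_single[OF UNIV_I]])
      (simp add: char_map_def char_point_chi)
  then have "is_subgroup S"
    using S by (simp add: is_subgroup_def malg_iff del: split_paired_All)
  then show ?thesis using gen hull_same by metis
qed

context lattice_coordinates
begin

text \<open>The image of x^a y^b under y -> y + c x^k, with a = \<open>l1 m\<close> and b =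
  \<open>l2 m\<close>. A half plane admits every integer k, a quadrant only nonnegative k.\<close>

definition shear :: "int \<Rightarrow> 'k \<Rightarrow> lattice \<Rightarrow> (lattice \<Rightarrow>\<^sub>0 'k::field)" where
  "shear k c m = chi (comb (l1 m) 0) * (chi (comb 0 1) + Poly_Mapping.single (comb k 0) c) ^ nat (l2 m)"

lemma shear_automorphism:
  fixes c :: "'k::field"
  assumes L: "line_exponents L E" and k: "k \<in> E"
  defines "P \<equiv> orthant E {0..}"
  shows "inverse_morphisms (toric_variety P) (toric_variety P)
    (char_map P (shear k c)) (char_map P (shear k (- c)))"
proof -
  have L2: "line_exponents (affine_line :: ('k, 'k) variety) {0..}" by (simp add: line_exponents_def)
  have P: "is_submonoid P" unfolding P_def using L L2 by (rule orthant_submonoid)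
  note zero = line_exponents_zero[OF L]
  have sP: "shear k c m \<in> monoid_algebra P" if "m \<in> P" for c :: 'k and m
    unfolding shear_def using that k zero
    by (intro malg_mult[OF P] malg_power[OF P] malg_add malg_single) (auto simp: P_def orthant_def)
  have mor: "morphism (toric_variety P) (toric_variety P) (char_map P (shear k c))" for c :: 'k
  proof (rule char_map_morphism[OF P sP])
    show "shear k c 0 = 1" by (simp add: shear_def)
    fix m n assume mn: "m \<in> P" "n \<in> P"
    have "chi (comb (l1 m + l1 n) 0) = (chi (comb (l1 m) 0) * chi (comb (l1 n) 0) :: lattice \<Rightarrow>\<^sub>0 'k)"
      using comb_add[of "l1 m" "l1 n" 0 0] by (simp add: mult_single)
    moreover have "nat (l2 m + l2 n) = nat (l2 m) + nat (l2 n)"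
      using mn by (simp add: P_def orthant_def nat_add_distrib)
    ultimately show "shear k c (m + n) = shear k c m * shear k c n"
      by (simp add: shear_def l_add power_add mult_ac)
  qed
  \<comment> \<open>Proved for any c + d = 0, so that it gives both composites.\<close>
  have inv: "char_map P (shear k c) x (shear k d m) = x (chi m)"
    if x: "x \<in> points (toric_variety P)" and m: "m \<in> P" and cd: "c + d = 0" for c d :: 'k and x m
  proof -
    let ?y = "char_map P (shear k c) x"
    have y: "?y \<in> points (toric_variety P)" by (rule morphism_point[OF mor x])
    have mem: "comb (l1 m) 0 \<in> P" "comb 0 1 \<in> P" "comb k 0 \<in> P" "comb 0 (l2 m) \<in> P"
      using m k zero by (auto simp: P_def orthant_def)
    have y1: "?y (chi (comb a 0)) = x (chi (comb a 0))" if "comb a 0 \<in> P" for a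
      using that by (simp add: char_map_def char_point_chi shear_def)
    have y2: "?y (chi (comb 0 1)) = x (chi (comb 0 1)) + c * x (chi (comb k 0))"
      using mem point_single[OF P x mem(3), of c]
      by (simp add: char_map_def char_point_chi shear_def point_add[OF x] malg_single)
    have "?y (shear k d m) = ?y (chi (comb (l1 m) 0)) *
        (?y (chi (comb 0 1)) + ?y (Poly_Mapping.single (comb k 0) d)) ^ nat (l2 m)"
      using mem unfolding shear_def[of k d]
      by (simp add: point_mult[OF y] point_power[OF P y] point_add[OF y] malg_add malg_power[OF P] malg_single)
    also have "\<dots> = x (chi (comb (l1 m) 0)) * (x (chi (comb 0 1)) + c * x (chi (comb k 0)) + d * x (chi (comb k 0))) ^ nat (l2 m)"
      using point_single[OF P y mem(3), of d] by (simp only: y1[OF mem(1)] y1[OF mem(3)] y2)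
    also have "\<dots> = x (chi (comb (l1 m) 0)) * x (chi (comb 0 1)) ^ nat (l2 m)"
      using cd by (simp add: add.assoc flip: distrib_right)
    also have "x (chi (comb 0 1)) ^ nat (l2 m) = x (chi (comb 0 (l2 m)))"
    proof -
      have "x (chi (comb 0 (int n))) = x (chi (comb 0 1)) ^ n" for n
      proof (induction n)
        case (Suc n)
        have "comb 0 (int n) \<in> P" using zero by (simp add: P_def)
        then show ?case using comb_add[of 0 0 1 "int n"] point_chi_add[OF P x mem(2)] Suc by simp
      qed (simp add: point_one[OF x])
      from this[of "nat (l2 m)"] show ?thesis using m by (simp add: P_def orthant_def)
    qed
    also have "x (chi (comb (l1 m) 0)) * x (chi (comb 0 (l2 m))) = x (chi m)"
      using point_chi_add[OF P x mem(1,4)] comb_add[of "l1 m" 0 0 "l2 m"] by simp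
    finally show ?thesis .
  qed
  show ?thesis by (rule char_map_inverse[OF P mor mor]) (auto intro: inv)
qed

lemma shear_expand:
  "shear k 1 (comb a (int b)) =
    (\<Sum>j\<le>b. Poly_Mapping.single (comb (a + int (b - j) * k) (int j)) (of_nat (b choose j) :: 'k::field))"
proof -
  have pow: "chi (comb c d) ^ n = (chi (comb (int n * c) (int n * d)) :: lattice \<Rightarrow>\<^sub>0 'k)" for c d n
    by (induction n) (simp_all add: mult_single distrib_right flip: comb_add)
  have sn: "of_nat n * Poly_Mapping.single m (c::'k) = Poly_Mapping.single m (of_nat n * c)" for n m c
    using mult_single[of 0 "of_nat n" m c] by simp
  have "shear k 1 (comb a (int b)) =
      (\<Sum>j\<le>b. chi (comb a 0) * (of_nat (b choose j) * chi (comb 0 1) ^ j * (chi (comb k 0) :: lattice \<Rightarrow>\<^sub>0 'k) ^ (b - j)))"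
    by (simp add: shear_def binomial_ring sum_distrib_left)
  also have "\<dots> = (\<Sum>j\<le>b. Poly_Mapping.single (comb (a + int (b - j) * k) (int j)) (of_nat (b choose j)))"
    by (intro sum.cong refl) (simp add: pow sn mult_single flip: comb_add)
  finally show ?thesis .
qed

text \<open>The terms of the binomial expansion have distinct y-exponents, so none cancel, and their
  coefficients are nonzero in characteristic 0. If the sheared monomial lies in k[S], each of these
  terms puts its exponent into S.\<close>

lemma shear_lifted:
  fixes S :: "lattice set"
  assumes L: "line_exponents L E" and k: "k \<in> E"
  defines "P \<equiv> orthant E {0..}"
  defines "X \<equiv> toric_variety P :: (_, 'k::field_char_0) variety"
  assumes S: "is_submonoid S" "S \<subseteq> P"
    and Aut: "Aut X = lifted_Aut X (toric_variety S) (toric_inclusion S)"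
    and m: "comb a (int b) \<in> S" and j: "j \<le> b"
  shows "comb (a + int (b - j) * k) (int j) \<in> S"
proof -
  have L2: "line_exponents (affine_line :: ('k, 'k) variety) {0..}" by (simp add: line_exponents_def)
  have P: "is_submonoid P" unfolding P_def using L L2 by (rule orthant_submonoid)
  have mP: "comb a (int b) \<in> P" using m S(2) by blast
  let ?g = "shear k 1 (comb a (int b)) :: lattice \<Rightarrow>\<^sub>0 'k"
  have "?g \<in> monoid_algebra P"
    unfolding shear_def using mP k line_exponents_zero[OF L]
    by (intro malg_mult[OF P] malg_power[OF P] malg_add malg_single) (auto simp: P_def orthant_def)
  then have "?g \<in> monoid_algebra S"
    by (rule lifted_Aut_pullback[OF S(2,1) P Aut[unfolded X_def]
          shear_automorphism[OF L k, where c = 1, folded P_def] malg_single[OF m, of 1]])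
      (simp add: char_map_def char_point_chi mP)
  moreover have "Poly_Mapping.lookup ?g (comb (a + int (b - j) * k) (int j)) = of_nat (b choose j)"
  proof -
    have eq: "comb (a + int (b - i) * k) (int i) = comb (a + int (b - j) * k) (int j) \<longleftrightarrow> i = j" for i
      using l_comb(2) by (metis of_nat_eq_iff)
    show ?thesis
      unfolding shear_expand lookup_sum lookup_single when_def eq using j by simp
  qed
  ultimately show ?thesis using malg_lookup[of ?g S] j by (simp add: binomial_eq_0_iff)
qed

text \<open>Otherwise S would lie on the line \<open>l2\<close> = 0 and could not generate the
  lattice. The exponent is a successor so that a shear can lower it to 1.\<close>

lemma exists_positive:
  assumes "is_subgroup hull S = UNIV" "S \<subseteq> {m. 0 \<le> l2 m}"
  obtains a b where "comb a (int (Suc b)) \<in> S"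
proof -
  have "\<exists>m\<in>S. l2 m \<noteq> 0"
  proof (rule ccontr)
    assume "\<not> ?thesis"
    then have "S \<subseteq> {m. l2 m = 0}" by auto
    moreover have "is_subgroup {m. l2 m = 0}"
      by (simp add: is_subgroup_def is_submonoid_def l_add l_minus)
    ultimately have "is_subgroup hull S \<subseteq> {m. l2 m = 0}" by (rule hull_minimal)
    then have "comb 0 1 \<in> {m. l2 m = 0}" using assms(1) by blast
    then show False by simp
  qed
  then obtain m where m: "m \<in> S" "0 < l2 m" using assms(2) by force
  show thesis
  proof (rule that)
    show "comb (l1 m) (int (Suc (nat (l2 m - 1)))) \<in> S" using m by simp
  qed
qed

text \<open>The translation y -> y + 1 lowers the y-exponent to 1, and shears with arbitrary
  integers k then reach every power of x.\<close>

lemma halfplane_lifted_imp_eq: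
  fixes S :: "lattice set"
  defines "P \<equiv> orthant UNIV {0..}"
  defines "X \<equiv> toric_variety P :: (_, 'k::field_char_0) variety"
  assumes S: "is_submonoid S" "S \<subseteq> P" and gen: "is_subgroup hull S = UNIV"
    and Aut: "Aut X = lifted_Aut X (toric_variety S) (toric_inclusion S)"
  shows "S = P"
proof -
  have L: "line_exponents (mult_group :: ('k, 'k) variety) UNIV" by (simp add: line_exponents_def)
  note sh = shear_lifted[OF L UNIV_I S[unfolded P_def] Aut[unfolded X_def P_def]]
  obtain a b where "comb a (int (Suc b)) \<in> S"
    using exists_positive[OF gen] S(2) by (auto simp: P_def orthant_def)
  from sh[OF this, of 1 0] have a: "comb a (int 1) \<in> S" by simp
  \<comment> \<open>The shear y -> y + x^(k - a) turns x^a y into x^a y + x^k.\<close>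
  have h: "comb k 0 \<in> S" for k
    using sh[OF a, of 0 "k - a"] by simp
  have v: "comb k 1 \<in> S" for k
    using is_submonoid_add[OF S(1) a h[of "k - a"]] by (simp flip: comb_add)
  have "comb k (int n) \<in> S" for k n
  proof (induction n arbitrary: k)
    case (Suc n)
    then show ?case using is_submonoid_add[OF S(1) v[of 0] Suc[of k]] by (simp flip: comb_add)
  qed (simp add: h)
  then have "m \<in> S" if "m \<in> P" for m
    using that comb_l[of m] unfolding P_def orthant_def by (metis (mono_tags, lifting) atLeast_iff mem_Collect_eq nonneg_int_cases)
  then show ?thesis using S(2) by blast
qed

lemma quadrant_lifted_imp_axis:
  fixes S :: "lattice set"
  defines "P \<equiv> orthant {0..} {0..}"
  defines "X \<equiv> toric_variety P :: (_, 'k::field_char_0) variety"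
  assumes S: "is_submonoid S" "S \<subseteq> P" and gen: "is_subgroup hull S = UNIV"
    and Aut: "Aut X = lifted_Aut X (toric_variety S) (toric_inclusion S)"
  obtains a where "comb (int a) 1 \<in> S" "comb (int a) 0 \<in> S"
proof -
  have L: "line_exponents (affine_line :: ('k, 'k) variety) {0..}" by (simp add: line_exponents_def)
  note sh = shear_lifted[OF L _ S[unfolded P_def] Aut[unfolded X_def P_def], of 0, simplified]
  obtain a b where ab: "comb a (int (Suc b)) \<in> S"
    using exists_positive[OF gen] S(2) by (auto simp: P_def orthant_def)
  then have "0 \<le> a" using S(2) by (auto simp: P_def)
  then obtain n where n: "a = int n" by (rule nonneg_int_cases)
  show thesis using that[of n] sh[OF ab[unfolded n], of 1] sh[OF ab[unfolded n], of 0] by simp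
qed

text \<open>The translations in the two coordinates suffice: each lowers one exponent and leaves the
  other alone, so both basis vectors are reached.\<close>

lemma quadrant_lifted_imp_eq:
  fixes S :: "lattice set"
  defines "P \<equiv> orthant {0..} {0..}"
  defines "X \<equiv> toric_variety P :: (_, 'k::field_char_0) variety"
  assumes S: "is_submonoid S" "S \<subseteq> P" and gen: "is_subgroup hull S = UNIV"
    and Aut: "Aut X = lifted_Aut X (toric_variety S) (toric_inclusion S)"
  shows "S = P"
proof -
  \<comment> \<open>The swapped coordinates turn the translation in y into the translation in
    x.\<close>
  interpret sw: lattice_coordinates "\<lambda>a b. comb b a" l2 l1 by (rule swap)
  have P': "P = sw.orthant {0..} {0..}" by (auto simp: P_def orthant_def sw.orthant_def)
  have L: "line_exponents (affine_line :: ('k, 'k) variety) {0..}" by (simp add: line_exponents_def)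
  note sh = shear_lifted[OF L _ S[unfolded P_def] Aut[unfolded X_def P_def], of 0, simplified]
  note sh' = sw.shear_lifted[OF L _ S[unfolded P'] Aut[unfolded X_def P'], of 0, simplified]
  obtain a where a: "comb (int a) 1 \<in> S"
    using quadrant_lifted_imp_axis[OF S[unfolded P_def] gen Aut[unfolded X_def P_def]] by blast
  have v: "comb 0 1 \<in> S" using sh'[OF a, of 0] by simp
  obtain b where b: "comb 1 (int b) \<in> S"
    using sw.quadrant_lifted_imp_axis[OF S[unfolded P'] gen Aut[unfolded X_def P']] by blast
  have h: "comb 1 0 \<in> S" using sh[OF b, of 0] by simp
  have hn: "comb (int n) 0 \<in> S" for n
  proof (induction n)
    case (Suc n)
    then show ?case using is_submonoid_add[OF S(1) h Suc] by (simp flip: comb_add)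
  qed (simp add: is_submonoid_zero[OF S(1)])
  have vn: "comb 0 (int n) \<in> S" for n
  proof (induction n)
    case (Suc n)
    then show ?case using is_submonoid_add[OF S(1) v Suc] by (simp flip: comb_add)
  qed (simp add: is_submonoid_zero[OF S(1)])
  have "m \<in> S" if "m \<in> P" for m
  proof -
    have "comb (int (nat (l1 m))) 0 + comb 0 (int (nat (l2 m))) = m"
      using that by (simp add: P_def orthant_def flip: comb_add)
    then show ?thesis using is_submonoid_add[OF S(1) hn vn] by metis
  qed
  then show ?thesis using S(2) by blast
qed

end

subsection \<open>Strongly convex cones in the plane\<close>

definition dual_of :: "(rat \<times> rat) set \<Rightarrow> lattice set" where
  "dual_of V = {m. \<forall>v\<in>V. 0 \<le> pairing v m}"

definition cross :: "rat \<times> rat \<Rightarrow> rat \<times> rat \<Rightarrow> rat" where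
  "cross v w = fst v * snd w - snd v * fst w"

definition lin :: "rat \<Rightarrow> rat \<times> rat \<Rightarrow> rat \<Rightarrow> rat \<times> rat \<Rightarrow> rat \<times> rat" where
  "lin a v b w = (a * fst v + b * fst w, a * snd v + b * snd w)"

lemma pairing_lin: "pairing (lin a v b w) m = a * pairing v m + b * pairing w m"
  by (simp add: pairing_def lin_def algebra_simps)

lemma lin_decompose:
  assumes "cross v w \<noteq> 0"
  shows "g = lin (cross g w / cross v w) v (cross v g / cross v w) w"
proof -
  have "fst g * cross v w = cross g w * fst v + cross v g * fst w"
    "snd g * cross v w = cross g w * snd v + cross v g * snd w"
    by (simp_all add: cross_def algebra_simps)
  then show ?thesis using assms by (simp add: lin_def prod_eq_iff field_simps)
qed

lemma parallel_decompose:
  assumes "cross v g = 0" "v \<noteq> 0"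
  shows "\<exists>c. g = lin c v 0 v"
proof (cases "fst v = 0")
  case True
  then have "snd v \<noteq> 0" using assms(2) by (simp add: prod_eq_iff)
  then show ?thesis using True assms(1)
    by (intro exI[of _ "snd g / snd v"]) (simp add: lin_def prod_eq_iff cross_def)
next
  case False
  then show ?thesis using assms(1)
    by (intro exI[of _ "fst g / fst v"]) (simp add: lin_def prod_eq_iff cross_def field_simps)
qed

text \<open>The three shapes of a strongly convex planar cone: the origin, a ray, or two independent
  rays. Only the dual of V will be compared with that of the cone.\<close>

definition few_generators :: "(rat \<times> rat) set \<Rightarrow> (rat \<times> rat) set \<Rightarrow> bool" where
  "few_generators \<sigma> V \<longleftrightarrow> V = {} \<or> (\<exists>v\<in>\<sigma>. v \<noteq> 0 \<and> V = {v}) \<or>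
     (\<exists>v\<in>\<sigma>. \<exists>w\<in>\<sigma>. cross v w \<noteq> 0 \<and> V = {v, w})"

lemma few_generators_insert:
  assumes lin: "\<And>a b v w. \<lbrakk>0 \<le> a; 0 \<le> b; v \<in> \<sigma>; w \<in> \<sigma>\<rbrakk> \<Longrightarrow> lin a v b w \<in> \<sigma>"
    and sc: "strongly_convex \<sigma>" and V: "few_generators \<sigma> V" and g: "g \<in> \<sigma>"
  shows "\<exists>W. few_generators \<sigma> W \<and> dual_of W = dual_of (insert g V)"
proof (cases "g = 0")
  case True
  then have "dual_of V = dual_of (insert g V)" by (auto simp: dual_of_def pairing_def)
  then show ?thesis using V by blast
next
  case g0: False
  consider "V = {}" | v where "v \<in> \<sigma>" "v \<noteq> 0" "V = {v}"
    | v w where "v \<in> \<sigma>" "w \<in> \<sigma>" "cross v w \<noteq> 0" "V = {v, w}"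
    using V unfolding few_generators_def by blast
  then show ?thesis
  proof cases
    case 1
    then show ?thesis using g g0 by (auto simp: few_generators_def)
  next
    case (2 v)
    show ?thesis
    proof (cases "cross v g = 0")
      case True
      then obtain c where c: "g = lin c v 0 v" using parallel_decompose 2(2) by blast
      \<comment> \<open>A negative multiple of v would put -g into the cone, against strong
        convexity.\<close>
      have "0 \<le> c"
      proof (rule ccontr)
        assume "\<not> 0 \<le> c"
        then have "lin (- c) v 0 v \<in> \<sigma>" using lin 2(1) by simp
        moreover have "lin (- c) v 0 v = - g" by (simp add: c lin_def prod_eq_iff)
        ultimately show False using sc g g0 by (auto simp: strongly_convex_def)
      qed
      then have "dual_of V = dual_of (insert g V)"
        by (auto simp: 2 dual_of_def c pairing_lin)
      then show ?thesis using V by blast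
    next
      case False
      then have "few_generators \<sigma> (insert g V)"
        using 2 g unfolding few_generators_def by (metis insert_commute)
      then show ?thesis by blast
    qed
  next
    case (3 v w)
    define a b where "a = cross g w / cross v w" and "b = cross v g / cross v w"
    have gl: "g = lin a v b w" unfolding a_def b_def using 3(3) by (rule lin_decompose)
    have D: "dual_of (insert g V) = {m. 0 \<le> pairing v m \<and> 0 \<le> pairing w m \<and> 0 \<le> a * pairing v m + b * pairing w m}"
      by (auto simp: 3 dual_of_def gl pairing_lin)
    have cr: "cross v g = b * cross v w" "cross w g = - a * cross v w"
      using 3(3) by (simp_all add: a_def b_def) (simp add: cross_def)
    consider "0 \<le> a" "0 \<le> b" | "a < 0" "0 < b" | "0 < a" "b < 0" | "a \<le> 0" "b \<le> 0" by linarith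
    then show ?thesis
    proof cases
      case 1
      then have "dual_of (insert g V) = dual_of V" unfolding D by (auto simp: 3 dual_of_def)
      then show ?thesis using V by blast
    next
      case 2
      \<comment> \<open>Here w = (g - a v) / b is a nonnegative combination of v and g, so it
        imposes no further condition.\<close>
      have "0 \<le> pairing w m" if "0 \<le> pairing v m" "0 \<le> a * pairing v m + b * pairing w m" for m
      proof -
        have "a * pairing v m \<le> 0" using 2 that(1) by (simp add: mult_nonpos_nonneg)
        then have "0 \<le> b * pairing w m" using that(2) by linarith
        then show ?thesis using 2 by (simp add: zero_le_mult_iff)
      qed
      then have "dual_of {v, g} = dual_of (insert g V)"
        unfolding D by (auto simp: dual_of_def gl pairing_lin)
      moreover have "cross v g \<noteq> 0" using 3(3) 2 cr by simp
      then have "few_generators \<sigma> {v, g}" using 3(1) g unfolding few_generators_def by blast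
      ultimately show ?thesis by blast
    next
      case c3: 3
      have "0 \<le> pairing v m" if "0 \<le> pairing w m" "0 \<le> a * pairing v m + b * pairing w m" for m
      proof -
        have "b * pairing w m \<le> 0" using c3 that(1) by (simp add: mult_nonpos_nonneg)
        then have "0 \<le> a * pairing v m" using that(2) by linarith
        then show ?thesis using c3 by (simp add: zero_le_mult_iff)
      qed
      then have "dual_of {w, g} = dual_of (insert g V)"
        unfolding D by (auto simp: dual_of_def gl pairing_lin)
      moreover have "cross w g \<noteq> 0" using 3(3) c3 cr by simp
      then have "few_generators \<sigma> {w, g}" using 3(2) g unfolding few_generators_def by blast
      ultimately show ?thesis by blast
    next
      case 4
      then have "lin (- a) v (- b) w \<in> \<sigma>" using lin 3 by simp
      moreover have "lin (- a) v (- b) w = - g" by (simp add: gl lin_def prod_eq_iff)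
      ultimately show ?thesis using sc g g0 by (auto simp: strongly_convex_def)
    qed
  qed
qed

lemma dual_monoid_few_generators:
  assumes "rational_polyhedral_cone \<sigma>" and sc: "strongly_convex \<sigma>"
  shows "\<exists>V. few_generators \<sigma> V \<and> dual_of V = dual_monoid \<sigma>"
proof -
  obtain G :: "(rat \<times> rat) set" where G: "finite G"
    and \<sigma>: "\<sigma> = {(\<Sum>g\<in>G. r g * fst g, \<Sum>g\<in>G. r g * snd g) | r. \<forall>g\<in>G. 0 \<le> r g}"
    using assms(1) unfolding rational_polyhedral_cone_def by blast
  have lin: "lin a v b w \<in> \<sigma>" if ab: "0 \<le> a" "0 \<le> b" and vw: "v \<in> \<sigma>" "w \<in> \<sigma>" for a b v w
  proof -
    obtain r where r: "\<forall>g\<in>G. 0 \<le> r g" "v = (\<Sum>g\<in>G. r g * fst g, \<Sum>g\<in>G. r g * snd g)"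
      using vw(1) unfolding \<sigma> by blast
    obtain s where s: "\<forall>g\<in>G. 0 \<le> s g" "w = (\<Sum>g\<in>G. s g * fst g, \<Sum>g\<in>G. s g * snd g)"
      using vw(2) unfolding \<sigma> by blast
    have "lin a v b w = (\<Sum>g\<in>G. (a * r g + b * s g) * fst g, \<Sum>g\<in>G. (a * r g + b * s g) * snd g)"
      by (simp add: lin_def r s sum_distrib_left distrib_right sum.distrib mult.assoc)
    moreover have "\<forall>g\<in>G. 0 \<le> a * r g + b * s g" using ab r(1) s(1) by simp
    ultimately show ?thesis unfolding \<sigma> by (intro CollectI exI[of _ "\<lambda>g. a * r g + b * s g"]) simp
  qed
  have G\<sigma>: "g \<in> \<sigma>" if "g \<in> G" for g
  proof -
    have "(\<Sum>h\<in>G. (if h = g then 1 else 0) * fst h) = fst g" "(\<Sum>h\<in>G. (if h = g then 1 else 0) * snd h) = snd g"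
      using G that by (simp_all add: if_distrib[of "\<lambda>x. x * _"] cong: if_cong)
    then show ?thesis unfolding \<sigma>
      by (intro CollectI exI[of _ "\<lambda>h. if h = g then 1 else 0"]) simp
  qed
  have "\<exists>V. few_generators \<sigma> V \<and> dual_of V = dual_of F" if "finite F" "F \<subseteq> G" for F
    using that
  proof (induction F)
    case empty
    then show ?case by (auto simp: few_generators_def)
  next
    case (insert g F)
    then obtain V where V: "few_generators \<sigma> V" "dual_of V = dual_of F" by auto
    obtain W where W: "few_generators \<sigma> W" "dual_of W = dual_of (insert g V)"
      using few_generators_insert[OF lin sc V(1), of g] G\<sigma> insert.prems by auto
    moreover have "dual_of (insert g V) = dual_of (insert g F)" using V(2) by (auto simp: dual_of_def)
    ultimately show ?case by metis
  qed
  moreover have "dual_of G = dual_monoid \<sigma>"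
  proof
    show "dual_monoid \<sigma> \<subseteq> dual_of G" using G\<sigma> by (auto simp: dual_of_def dual_monoid_def)
    show "dual_of G \<subseteq> dual_monoid \<sigma>"
    proof
      fix m assume m: "m \<in> dual_of G"
      have "0 \<le> pairing u m" if u: "u \<in> \<sigma>" for u
      proof -
        obtain r where r: "\<forall>g\<in>G. 0 \<le> r g" "u = (\<Sum>g\<in>G. r g * fst g, \<Sum>g\<in>G. r g * snd g)"
          using u unfolding \<sigma> by blast
        have "pairing u m = (\<Sum>g\<in>G. r g * pairing g m)"
          by (simp add: r pairing_def sum_distrib_right sum_distrib_left distrib_left sum.distrib mult.assoc)
        then show ?thesis using r(1) m by (auto simp: dual_of_def intro!: sum_nonneg)
      qed
      then show "m \<in> dual_monoid \<sigma>" by (simp add: dual_monoid_def)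
    qed
  qed
  ultimately show ?thesis using G by (metis order_refl)
qed

section \<open>Primitive normals and the case distinction for cones\<close>

lemma primitive_multiple:
  fixes v :: "rat \<times> rat"
  assumes "v \<noteq> 0"
  shows "\<exists>a b (r::rat). coprime a b \<and> 0 < r \<and> fst v = r * of_int a \<and> snd v = r * of_int b"
proof -
  obtain x s where xs: "fst v = of_int x / of_int s" "0 < s" by (metis quotient_of_denom_pos quotient_of_div surj_pair)
  obtain y t where yt: "snd v = of_int y / of_int t" "0 < t" by (metis quotient_of_denom_pos quotient_of_div surj_pair)
  have "x * t \<noteq> 0 \<or> y * s \<noteq> 0" using assms xs yt by (auto simp: prod_eq_iff)
  then obtain a b where ab: "x * t = a * gcd (x * t) (y * s)" "y * s = b * gcd (x * t) (y * s)" "coprime a b"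
    using gcd_coprime_exists[of "x * t" "y * s"] by auto
  define g where "g = gcd (x * t) (y * s)"
  have "0 < g" unfolding g_def using \<open>x * t \<noteq> 0 \<or> y * s \<noteq> 0\<close> by (metis gcd_pos_int)
  have "fst v = of_int (x * t) / of_int (s * t)" "snd v = of_int (y * s) / of_int (s * t)"
    using xs yt by simp_all
  moreover have "of_int (x * t) = (of_int (a * g) :: rat)" "of_int (y * s) = (of_int (b * g) :: rat)"
    using ab(1,2) by (simp_all only: g_def)
  ultimately have "fst v = (of_int g / of_int (s * t)) * of_int a" "snd v = (of_int g / of_int (s * t)) * of_int b"
    by (simp_all only: of_int_mult) (simp_all add: mult.commute)
  moreover have "(0::rat) < of_int g / of_int (s * t)" using \<open>0 < g\<close> xs yt by simp
  ultimately show ?thesis using ab(3) by blast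
qed

lemma pairing_primitive:
  assumes "0 < r" "fst v = r * of_int a" "snd v = r * of_int b"
  shows "0 \<le> pairing v m \<longleftrightarrow> 0 \<le> a * fst m + b * snd m"
proof -
  have "pairing v m = r * of_int (a * fst m + b * snd m)"
    using assms by (simp add: pairing_def algebra_simps)
  then have "0 \<le> pairing v m \<longleftrightarrow> 0 \<le> (of_int (a * fst m + b * snd m) :: rat)"
    using assms(1) by (simp add: zero_le_mult_iff)
  then show ?thesis by (simp only: of_int_0_le_iff)
qed

lemma coprime_bezout:
  fixes a b :: int
  assumes "coprime a b"
  obtains c d where "a * c + b * d = 1"
proof -
  obtain u v where "u * a + v * b = gcd a b" using bezout_int by blast
  then show thesis using assms that[of u v] by (simp add: mult.commute)
qed

text \<open>
  \<open>l1\<close> and \<open>l2\<close> are the primitive inner normals of the two facets of the dual cone, \<open>p1\<close> and \<open>p2\<close> its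
  primitive ray generators, and \<open>D\<close> the index of the sublattice generated by \<open>p1\<close>, \<open>p2\<close>.  The divisibility
  conditions say that \<open>(p1, q1)\<close> and \<open>(p2, q2)\<close> are bases of the lattice.
\<close>

locale singular_cone =
  fixes l1 l2 :: "lattice \<Rightarrow> int" and p1 p2 q1 q2 :: lattice and D :: int
  assumes l_add: "l1 (m + n) = l1 m + l1 n" "l2 (m + n) = l2 m + l2 n"
    and l_inj: "l1 m = l1 n \<Longrightarrow> l2 m = l2 n \<Longrightarrow> m = n"
    and D: "2 \<le> D"
    and l_p: "l1 p1 = D" "l2 p1 = 0" "l1 p2 = 0" "l2 p2 = D"
    and l_q1: "l2 q1 = 1" "0 \<le> l1 q1" and l_q2: "l1 q2 = 1" "0 \<le> l2 q2"
    and dvd1: "D dvd l1 m - l2 m * l1 q1" and dvd2: "D dvd l2 m - l1 m * l2 q2"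

text \<open>The ray generators lie in the kernels of the two functionals. A Bezout solution has
  l2(q1) = 1, and adding a multiple of p1 makes l1(q1) nonnegative without changing l2(q1); likewise
  for q2. The divisibility is the determinant identity l1(m) l2(q) - l2(m) l1(q) = D det(m, q), read
  at a solution of l2(q) = 1.\<close>

lemma singular_cone_intro:
  fixes a1 b1 a2 b2 :: int
  assumes "coprime a1 b1" "coprime a2 b2" and D: "D = a1 * b2 - b1 * a2" "2 \<le> D"
  shows "\<exists>q1 q2. singular_cone (\<lambda>m. a1 * fst m + b1 * snd m) (\<lambda>m. a2 * fst m + b2 * snd m)
    (b2, - a2) (- b1, a1) q1 q2 D"
proof -
  obtain c2 d2 where e2: "a2 * c2 + b2 * d2 = 1" using coprime_bezout[OF assms(2)] .
  obtain c1 d1 where e1: "a1 * c1 + b1 * d1 = 1" using coprime_bezout[OF assms(1)] .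
  \<comment> \<open>As D is at least 1, the summand k1 D compensates a possibly negative value of
    the first functional at the Bezout solution.\<close>
  define k1 where "k1 = \<bar>a1 * c2 + b1 * d2\<bar>"
  define k2 where "k2 = \<bar>a2 * c1 + b2 * d1\<bar>"
  define q1 where "q1 = (c2 + k1 * b2, d2 - k1 * a2)"
  define q2 where "q2 = (c1 - k2 * b1, d1 + k2 * a1)"
  have q1: "a1 * fst q1 + b1 * snd q1 = (a1 * c2 + b1 * d2) + k1 * D"
    by (simp add: q1_def D algebra_simps)
  have q2: "a2 * fst q2 + b2 * snd q2 = (a2 * c1 + b2 * d1) + k2 * D"
    by (simp add: q2_def D algebra_simps)
  have "singular_cone (\<lambda>m. a1 * fst m + b1 * snd m) (\<lambda>m. a2 * fst m + b2 * snd m)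
    (b2, - a2) (- b1, a1) q1 q2 D"
  proof
    fix m n :: lattice
    show "m = n" if "a1 * fst m + b1 * snd m = a1 * fst n + b1 * snd n"
      "a2 * fst m + b2 * snd m = a2 * fst n + b2 * snd n"
    proof -
      have "D * fst m = b2 * (a1 * fst m + b1 * snd m) - b1 * (a2 * fst m + b2 * snd m)"
        "D * snd m = a1 * (a2 * fst m + b2 * snd m) - a2 * (a1 * fst m + b1 * snd m)"
        by (simp_all add: D algebra_simps)
      then have "D * fst m = D * fst n" "D * snd m = D * snd n"
        unfolding that by (simp_all add: D algebra_simps)
      then show ?thesis using D(2) by (simp add: prod_eq_iff)
    qed
    show "a2 * fst q1 + b2 * snd q1 = 1" using e2 by (simp add: q1_def algebra_simps)
    show "a1 * fst q2 + b1 * snd q2 = 1" using e1 by (simp add: q2_def algebra_simps)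
    have "k1 * 1 \<le> k1 * D" "k2 * 1 \<le> k2 * D"
      using D(2) by (intro mult_left_mono; simp add: k1_def k2_def)+
    then show "0 \<le> a1 * fst q1 + b1 * snd q1" "0 \<le> a2 * fst q2 + b2 * snd q2"
      unfolding q1 q2 by (auto simp: k1_def k2_def)
    have "(a1 * fst m + b1 * snd m) - (a2 * fst m + b2 * snd m) * (a1 * c2 + b1 * d2) =
        (a1 * fst m + b1 * snd m) * (a2 * c2 + b2 * d2) - (a2 * fst m + b2 * snd m) * (a1 * c2 + b1 * d2)"
      by (simp add: e2)
    also have "\<dots> = D * (fst m * d2 - snd m * c2)" by (simp add: D algebra_simps)
    finally have "(a1 * fst m + b1 * snd m) - (a2 * fst m + b2 * snd m) * (a1 * fst q1 + b1 * snd q1) =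
        D * (fst m * d2 - snd m * c2 - (a2 * fst m + b2 * snd m) * k1)"
      unfolding q1 by (simp add: algebra_simps)
    then show "D dvd (a1 * fst m + b1 * snd m) - (a2 * fst m + b2 * snd m) * (a1 * fst q1 + b1 * snd q1)"
      by simp
    have "(a2 * fst m + b2 * snd m) - (a1 * fst m + b1 * snd m) * (a2 * c1 + b2 * d1) =
        (a2 * fst m + b2 * snd m) * (a1 * c1 + b1 * d1) - (a1 * fst m + b1 * snd m) * (a2 * c1 + b2 * d1)"
      by (simp add: e1)
    also have "\<dots> = D * (snd m * c1 - fst m * d1)" by (simp add: D algebra_simps)
    finally have "(a2 * fst m + b2 * snd m) - (a1 * fst m + b1 * snd m) * (a2 * fst q2 + b2 * snd q2) =
        D * (snd m * c1 - fst m * d1 - (a1 * fst m + b1 * snd m) * k2)"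
      unfolding q2 by (simp add: algebra_simps)
    then show "D dvd (a2 * fst m + b2 * snd m) - (a1 * fst m + b1 * snd m) * (a2 * fst q2 + b2 * snd q2)"
      by simp
  qed (use D in \<open>simp_all add: algebra_simps\<close>)
  then show ?thesis by blast
qed

text \<open>The coordinate map is the explicit inverse of an integer matrix of determinant
  1.\<close>

lemma unimodular_coordinates:
  fixes a1 b1 a2 b2 :: int
  assumes "a1 * b2 - b1 * a2 = 1"
  shows "lattice_coordinates (\<lambda>s t. (s * b2 - t * b1, t * a1 - s * a2))
    (\<lambda>m. a1 * fst m + b1 * snd m) (\<lambda>m. a2 * fst m + b2 * snd m)"
proof
  fix a b :: int and m :: lattice
  have "a1 * fst (a * b2 - b * b1, b * a1 - a * a2) + b1 * snd (a * b2 - b * b1, b * a1 - a * a2) =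
      a * (a1 * b2 - b1 * a2)"
    "a2 * fst (a * b2 - b * b1, b * a1 - a * a2) + b2 * snd (a * b2 - b * b1, b * a1 - a * a2) =
      b * (a1 * b2 - b1 * a2)"
    "(a1 * fst m + b1 * snd m) * b2 - (a2 * fst m + b2 * snd m) * b1 = fst m * (a1 * b2 - b1 * a2)"
    "(a2 * fst m + b2 * snd m) * a1 - (a1 * fst m + b1 * snd m) * a2 = snd m * (a1 * b2 - b1 * a2)"
    by (simp_all add: algebra_simps)
  then show "a1 * fst (a * b2 - b * b1, b * a1 - a * a2) + b1 * snd (a * b2 - b * b1, b * a1 - a * a2) = a"
    "a2 * fst (a * b2 - b * b1, b * a1 - a * a2) + b2 * snd (a * b2 - b * b1, b * a1 - a * a2) = b"
    "((a1 * fst m + b1 * snd m) * b2 - (a2 * fst m + b2 * snd m) * b1,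
      (a2 * fst m + b2 * snd m) * a1 - (a1 * fst m + b1 * snd m) * a2) = m"
    unfolding assms by (simp_all add: prod_eq_iff)
qed (simp add: algebra_simps)

text \<open>The determinant D of the two primitive normals measures their failure to be a lattice
  basis: D = 1 gives a quadrant, D at least 2 the singular case.\<close>

lemma cone_cases [consumes 2, case_names full halfplane quadrant singular]:
  assumes "rational_polyhedral_cone \<sigma>" "strongly_convex \<sigma>"
  obtains "dual_monoid \<sigma> = UNIV"
  | comb l1 l2 where "lattice_coordinates comb l1 l2" "dual_monoid \<sigma> = {m. 0 \<le> l2 m}"
  | comb l1 l2 where "lattice_coordinates comb l1 l2" "dual_monoid \<sigma> = {m. 0 \<le> l1 m \<and> 0 \<le> l2 m}"
  | l1 l2 p1 p2 q1 q2 D where "singular_cone l1 l2 p1 p2 q1 q2 D" "dual_monoid \<sigma> = {m. 0 \<le> l1 m \<and> 0 \<le> l2 m}"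
proof -
  note cases = that
  obtain V where V: "few_generators \<sigma> V" and dual: "dual_monoid \<sigma> = dual_of V"
    using dual_monoid_few_generators[OF assms] by metis
  \<comment> \<open>Replacing v and w by primitive vectors rescales the determinant by a positive
    factor, so it becomes a positive integer.\<close>
  have two: thesis if cr: "cross v w > 0" and dual: "dual_monoid \<sigma> = dual_of {v, w}" for v w
  proof -
    have "v \<noteq> 0" "w \<noteq> 0" using cr by (auto simp: cross_def)
    then obtain a1 b1 r1 a2 b2 r2 where v: "coprime a1 b1" "0 < r1" "fst v = r1 * of_int a1" "snd v = r1 * of_int b1"
      and w: "coprime a2 b2" "0 < r2" "fst w = r2 * of_int a2" "snd w = r2 * of_int b2"
      using primitive_multiple by metis
    have P: "dual_monoid \<sigma> = {m. 0 \<le> a1 * fst m + b1 * snd m \<and> 0 \<le> a2 * fst m + b2 * snd m}"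
      unfolding dual dual_of_def using pairing_primitive[OF v(2-4)] pairing_primitive[OF w(2-4)] by simp
    have "cross v w = r1 * r2 * of_int (a1 * b2 - b1 * a2)"
      by (simp add: cross_def v w algebra_simps)
    moreover have "0 < r1 * r2" using v(2) w(2) by simp
    ultimately have "0 < (of_int (a1 * b2 - b1 * a2) :: rat)"
      using cr by (simp only: zero_less_mult_pos)
    then have "0 < a1 * b2 - b1 * a2" by (simp only: of_int_0_less_iff)
    then consider "a1 * b2 - b1 * a2 = 1" | "2 \<le> a1 * b2 - b1 * a2" by linarith
    then show thesis
    proof cases
      case 1
      show thesis using unimodular_coordinates[OF 1] P by (rule cases(3))
    next
      case 2
      obtain q1 q2 where "singular_cone (\<lambda>m. a1 * fst m + b1 * snd m) (\<lambda>m. a2 * fst m + b2 * snd m)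
          (b2, - a2) (- b1, a1) q1 q2 (a1 * b2 - b1 * a2)"
        using singular_cone_intro[OF v(1) w(1) refl 2] by blast
      then show thesis using P by (rule cases(4))
    qed
  qed
  consider "V = {}" | v where "v \<noteq> 0" "V = {v}" | v w where "cross v w \<noteq> 0" "V = {v, w}"
    using V unfolding few_generators_def by blast
  then show thesis
  proof cases
    case 1
    then show thesis using cases(1) dual by (simp add: dual_of_def)
  next
    case (2 v)
    obtain a b r where v: "coprime a b" "0 < r" "fst v = r * of_int a" "snd v = r * of_int b"
      using primitive_multiple[OF 2(1)] by blast
    obtain c d where cd: "a * c + b * d = 1" using coprime_bezout[OF v(1)] .
    \<comment> \<open>A Bezout pair completes the primitive normal (a, b) to a basis, with (a, b) in
      the second place.\<close>
    then have "d * b - (- c) * a = 1" by (simp add: algebra_simps)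
    from unimodular_coordinates[OF this] show thesis
    proof (rule cases(2))
      show "dual_monoid \<sigma> = {m. 0 \<le> a * fst m + b * snd m}"
        unfolding dual dual_of_def 2 using pairing_primitive[OF v(2-4)] by simp
    qed
  next
    case (3 v w)
    have "cross w v = - cross v w" by (simp add: cross_def)
    then have "0 < cross v w \<or> 0 < cross w v" using 3(1) by linarith
    then show thesis using two[of v w] two[of w v] dual 3(2) by (metis insert_commute)
  qed
qed

subsection \<open>The singular case\<close>

definition multiple :: "nat \<Rightarrow> lattice \<Rightarrow> lattice" where
  "multiple n m = (int n * fst m, int n * snd m)"

lemma multiple_zero [simp]: "multiple 0 m = 0"
  by (simp add: multiple_def flip: zero_prod_def)

lemma multiple_Suc: "multiple (Suc n) m = m + multiple n m"
  by (simp add: multiple_def prod_eq_iff distrib_right)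

definition decomposables :: "lattice set \<Rightarrow> lattice set" where
  "decomposables P = insert 0 {a + b | a b. a \<in> P \<and> b \<in> P \<and> a \<noteq> 0 \<and> b \<noteq> 0}"

context singular_cone
begin

definition P :: "lattice set" where
  "P = {m. 0 \<le> l1 m \<and> 0 \<le> l2 m}"

definition S :: "lattice set" where
  "S = decomposables P"

text \<open>The parallelogram spanned by p1 and p2, without the origin. From points of P outside of
  it, p1 or p2 can be subtracted within P.\<close>

definition K :: "lattice set" where
  "K = {m \<in> P. m \<noteq> 0 \<and> l1 m \<le> D \<and> l2 m \<le> D}"

lemma l_zero [simp]: "l1 0 = 0" "l2 0 = 0"
  using l_add[of 0 0] by auto

lemma l_eq_zero: "l1 m = 0 \<Longrightarrow> l2 m = 0 \<Longrightarrow> m = 0"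
  using l_inj[of m 0] by simp

lemma l_diff: "l1 (m - n) = l1 m - l1 n" "l2 (m - n) = l2 m - l2 n"
  using l_add[of "m - n" n] by auto

lemma l_multiple: "l1 (multiple n m) = int n * l1 m" "l2 (multiple n m) = int n * l2 m"
  by (induction n) (simp_all add: multiple_Suc l_add distrib_right)

lemma P_iff: "m \<in> P \<longleftrightarrow> 0 \<le> l1 m \<and> 0 \<le> l2 m"
  by (simp add: P_def)

lemma P_add: "m \<in> P \<Longrightarrow> n \<in> P \<Longrightarrow> m + n \<in> P"
  by (simp add: P_iff l_add)

lemma P_submonoid: "is_submonoid P"
  unfolding is_submonoid_def using P_add by (auto simp: P_iff)

lemma P_add_eq_zero: "m \<in> P \<Longrightarrow> n \<in> P \<Longrightarrow> m + n = 0 \<Longrightarrow> m = 0 \<and> n = 0"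
  using l_add[of m n] l_eq_zero[of m] l_eq_zero[of n] by (simp add: P_iff)

lemma P_pointed: "pointed P"
  unfolding pointed_def using P_submonoid P_add_eq_zero by blast

lemma P_pos: "m \<in> P \<Longrightarrow> m \<noteq> 0 \<Longrightarrow> 0 < l1 m + l2 m"
  using l_eq_zero[of m] by (fastforce simp: P_iff)

lemma pq_in_P: "p1 \<in> P" "p2 \<in> P" "q1 \<in> P" "q2 \<in> P"
  using D l_p l_q1 l_q2 by (auto simp: P_iff)

lemma multiple_P: "m \<in> P \<Longrightarrow> multiple n m \<in> P"
  by (simp add: P_iff l_multiple)

lemma p_nonzero: "p1 \<noteq> 0" "p2 \<noteq> 0" "p1 \<noteq> p2"
  using D l_p by auto

text \<open>On the ray \<open>l2\<close> = 0 the functional \<open>l1\<close> takes only multiples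
  of D, and p1 has the smallest positive value.\<close>

lemma indecomposable_p1: "indecomposable P p1"
  unfolding indecomposable_def
proof (intro conjI ballI impI)
  fix m n assume m: "m \<in> P" and n: "n \<in> P" and mn: "m + n = p1"
  have l2: "l2 m = 0" "l2 n = 0" and l1: "l1 m + l1 n = D"
    using m n l_p l_add[of m n] by (simp_all add: mn P_iff)
  have "D dvd l1 m" using dvd1[of m] l2 by simp
  then have "l1 m = 0 \<or> D \<le> l1 m" using m D by (auto simp: P_iff dest: zdvd_imp_le)
  then have "l1 m = 0 \<or> l1 n = 0" using l1 n by (auto simp: P_iff)
  then show "m = 0 \<or> n = 0" using l2 l_eq_zero by blast
qed (simp_all add: pq_in_P p_nonzero)

lemma indecomposable_p2: "indecomposable P p2"
  unfolding indecomposable_def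
proof (intro conjI ballI impI)
  fix m n assume m: "m \<in> P" and n: "n \<in> P" and mn: "m + n = p2"
  have l1: "l1 m = 0" "l1 n = 0" and l2: "l2 m + l2 n = D"
    using m n l_p l_add[of m n] by (simp_all add: mn P_iff)
  have "D dvd l2 m" using dvd2[of m] l1 by simp
  then have "l2 m = 0 \<or> D \<le> l2 m" using m D by (auto simp: P_iff dest: zdvd_imp_le)
  then have "l2 m = 0 \<or> l2 n = 0" using l2 n by (auto simp: P_iff)
  then show "m = 0 \<or> n = 0" using l1 l_eq_zero by blast
qed (simp_all add: pq_in_P p_nonzero)

text \<open>T consists of the points of P outside the sublattice spanned by p1 and p2. If a point of
  T with least \<open>l1\<close> + \<open>l2\<close> were a sum of two nonzero elements, both would
  lie in the sublattice, and so would the sum.\<close>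

lemma third_indecomposable:
  obtains h where "indecomposable P h" "h \<noteq> p1" "h \<noteq> p2"
proof -
  define T where "T = {m \<in> P. \<not> (D dvd l1 m \<and> D dvd l2 m)}"
  \<comment> \<open>T is nonempty since \<open>l2 q1\<close> = 1 is not divisible by D, which is at
    least 2.\<close>
  have "q1 \<in> T" using pq_in_P l_q1 D by (simp add: T_def)
  define w where "w m = nat (l1 m + l2 m)" for m
  obtain h where h: "h \<in> T" "\<And>m. m \<in> T \<Longrightarrow> w h \<le> w m"
    using arg_min_natI[of "\<lambda>m. m \<in> T" q1 w] arg_min_nat_le[of "\<lambda>m. m \<in> T" _ w] \<open>q1 \<in> T\<close> by blast
  have hP: "h \<in> P" and nd: "\<not> (D dvd l1 h \<and> D dvd l2 h)" using h(1) by (auto simp: T_def)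
  have "indecomposable P h"
    unfolding indecomposable_def
  proof (intro conjI ballI impI)
    show "h \<in> P" by fact
    show "h \<noteq> 0" using nd by auto
    fix m n assume m: "m \<in> P" and n: "n \<in> P" and mn: "m + n = h"
    show "m = 0 \<or> n = 0"
    proof (rule ccontr)
      assume "\<not> ?thesis"
      then have pos: "0 < l1 m + l2 m" "0 < l1 n + l2 n" using P_pos m n by auto
      moreover have "l1 h + l2 h = (l1 m + l2 m) + (l1 n + l2 n)"
        using l_add[of m n] by (simp add: mn)
      ultimately have "w m < w h" "w n < w h" by (auto simp: w_def)
      then have "m \<notin> T" "n \<notin> T" using h(2) by (meson not_le)+
      then show False using nd m n l_add[of m n] by (auto simp: T_def mn)
    qed
  qed
  moreover have "h \<noteq> p1" "h \<noteq> p2" using nd l_p by auto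
  ultimately show thesis using that by blast
qed

lemma vertex_singular:
  "\<not> tangent_dim_le_2 (toric_variety P :: (_, 'k::field_char_0) variety) (vertex P)"
proof -
  obtain h where "indecomposable P h" "h \<noteq> p1" "h \<noteq> p2" by (rule third_indecomposable)
  then show ?thesis
    using vertex_tangent_dim[OF P_pointed indecomposable_p1 indecomposable_p2] p_nonzero by metis
qed

lemma point_multiple:
  assumes x: "x \<in> points (toric_variety P)" and m: "m \<in> P"
  shows "x (chi (multiple n m)) = x (chi m) ^ n"
proof (induction n)
  case 0
  show ?case using point_one[OF x] by simp
next
  case (Suc n)
  then show ?case
    using point_chi_add[OF P_submonoid x m multiple_P[OF m, of n]] by (simp add: multiple_Suc)
qed

text \<open>By D m = l1(m) p1 + l2(m) p2, a point at which the monomials of p1 and p2 both vanish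
  kills all nontrivial monomials and is the vertex. If the monomial of p1 is nonzero, p1 may be
  cancelled, and every m in P is k p1 + l2(m) q1 for some integer k, so p1 and q1 bound the tangent
  space; symmetrically for p2.\<close>

lemma nonvertex_smooth:
  fixes x :: "(lattice \<Rightarrow>\<^sub>0 'k::field) \<Rightarrow> 'k"
  assumes x: "x \<in> points (toric_variety P)" and ne: "x \<noteq> vertex P"
  shows "tangent_dim_le_2 (toric_variety P) x"
proof -
  have multC: "multiple n a \<in> C"
    if "0 \<in> C" "a \<in> C" "a \<in> P" "\<And>a b. \<lbrakk>a \<in> C; b \<in> C; a \<in> P; b \<in> P\<rbrakk> \<Longrightarrow> a + b \<in> C" for C a n
    by (induction n) (use that multiple_P in \<open>simp_all add: multiple_Suc\<close>)
  \<comment> \<open>The coefficient of p may be negative, which is why a multiple of p is allowed on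
    either side; only p has to be nonzero at x.\<close>
  have smooth: "tangent_dim_le_2 (toric_variety P) x"
    if nz: "x (chi p) \<noteq> 0" and p: "p \<in> P" and q: "q \<in> P"
      and basis: "\<And>m. m \<in> P \<Longrightarrow> \<exists>k j. m = multiple k p + multiple j q \<or> m + multiple k p = multiple j q" for p q
  proof (rule tangent_dim_le_2_toric[OF P_submonoid x p q])
    fix C m
    assume C: "0 \<in> C" "p \<in> C" "q \<in> C"
      and add: "\<And>a b. \<lbrakk>a \<in> C; b \<in> C; a \<in> P; b \<in> P\<rbrakk> \<Longrightarrow> a + b \<in> C"
      and canc: "\<And>a b. \<lbrakk>a \<in> P; b \<in> P; b \<in> C; a + b \<in> C; x (chi b) \<noteq> 0\<rbrakk> \<Longrightarrow> a \<in> C" and m: "m \<in> P"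
    have pC: "multiple k p \<in> C" and qC: "multiple k q \<in> C" for k
      using multC[OF C(1) _ _ add] C p q by blast+
    obtain k j where "m = multiple k p + multiple j q \<or> m + multiple k p = multiple j q"
      using basis[OF m] by blast
    then show "m \<in> C"
    proof
      assume "m = multiple k p + multiple j q"
      then show ?thesis using add[OF pC qC] multiple_P p q by simp
    next
      assume "m + multiple k p = multiple j q"
      then show ?thesis
        using canc[OF m multiple_P[OF p] pC, of k] qC[of j] nz point_multiple[OF x p, of k] by simp
    qed
  qed
  have "x (chi p1) \<noteq> 0 \<or> x (chi p2) \<noteq> 0"
  proof (rule ccontr)
    assume z: "\<not> ?thesis"
    have "x = vertex P"
    proof (rule point_eqI[OF P_submonoid x vertex_point[OF P_pointed]])
      fix m assume m: "m \<in> P"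
      show "x (chi m) = vertex P (chi m)"
      proof (cases "m = 0")
        case True
        then show ?thesis using point_one[OF x] point_one[OF vertex_point[OF P_pointed]] by simp
      next
        case False
        define a b where "a = nat (l1 m)" and "b = nat (l2 m)"
        have ab: "int a = l1 m" "int b = l2 m" using m by (simp_all add: a_def b_def P_iff)
        have "multiple (nat D) m = multiple a p1 + multiple b p2"
          using D by (intro l_inj) (simp_all add: l_add l_multiple l_p ab)
        then have "x (chi m) ^ nat D = x (chi p1) ^ a * x (chi p2) ^ b"
          using point_chi_add[OF P_submonoid x multiple_P[OF pq_in_P(1), of a] multiple_P[OF pq_in_P(2), of b]]
            point_multiple[OF x] m pq_in_P by metis
        moreover have "0 < a \<or> 0 < b" using P_pos[OF m False] ab by linarith
        ultimately have "x (chi m) ^ nat D = 0" using z by auto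
        then have "x (chi m) = 0" by simp
        moreover have "vertex P (chi m) = (0::'k)"
          using m False by (simp add: vertex_apply malg_single lookup_single when_def)
        ultimately show ?thesis by simp
      qed
    qed
    then show False using ne by simp
  qed
  then show ?thesis
  proof
    assume "x (chi p1) \<noteq> 0"
    then show ?thesis
    proof (rule smooth[OF _ pq_in_P(1,3)])
      fix m assume m: "m \<in> P"
      obtain k where k: "l1 m - l2 m * l1 q1 = D * k" using dvd1[of m] by (elim dvdE)
      have j: "int (nat (l2 m)) = l2 m" using m by (simp add: P_iff)
      show "\<exists>k j. m = multiple k p1 + multiple j q1 \<or> m + multiple k p1 = multiple j q1"
      proof (cases "0 \<le> k")
        case True
        then have "m = multiple (nat k) p1 + multiple (nat (l2 m)) q1"
          using k j by (intro l_inj) (simp_all add: l_add l_multiple l_p l_q1 algebra_simps)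
        then show ?thesis by blast
      next
        case False
        then have "m + multiple (nat (- k)) p1 = multiple (nat (l2 m)) q1"
          using k j by (intro l_inj) (simp_all add: l_add l_multiple l_p l_q1 algebra_simps)
        then show ?thesis by blast
      qed
    qed
  next
    assume "x (chi p2) \<noteq> 0"
    then show ?thesis
    proof (rule smooth[OF _ pq_in_P(2,4)])
      fix m assume m: "m \<in> P"
      obtain k where k: "l2 m - l1 m * l2 q2 = D * k" using dvd2[of m] by (elim dvdE)
      have j: "int (nat (l1 m)) = l1 m" using m by (simp add: P_iff)
      show "\<exists>k j. m = multiple k p2 + multiple j q2 \<or> m + multiple k p2 = multiple j q2"
      proof (cases "0 \<le> k")
        case True
        then have "m = multiple (nat k) p2 + multiple (nat (l1 m)) q2"
          using k j by (intro l_inj) (simp_all add: l_add l_multiple l_p l_q2 algebra_simps)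
        then show ?thesis by blast
      next
        case False
        then have "m + multiple (nat (- k)) p2 = multiple (nat (l1 m)) q2"
          using k j by (intro l_inj) (simp_all add: l_add l_multiple l_p l_q2 algebra_simps)
        then show ?thesis by blast
      qed
    qed
  qed
qed

text \<open>The three products are toric surfaces satisfying the tangent bound everywhere, and an
  isomorphism would carry the bound back to the vertex.\<close>

lemma not_isomorphic_smooth:
  fixes L1 L2 :: "('k::field_char_0, 'k) variety"
  assumes L: "line_exponents L1 E1" "line_exponents L2 E2"
  shows "\<not> isomorphic (toric_variety P :: (_, 'k) variety) (L1 \<times>\<^sub>v L2)"
proof
  let ?X = "toric_variety P :: (_, 'k) variety"
  let ?Y = "toric_variety (standard.orthant E1 E2) :: (_, 'k) variety"
  assume "isomorphic ?X (L1 \<times>\<^sub>v L2)"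
  then have "isomorphic ?X ?Y"
    using isomorphic_trans isomorphic_sym[OF standard.orthant_isomorphic[OF L]] by blast
  then obtain \<phi> \<psi> where iso: "inverse_morphisms ?X ?Y \<phi> \<psi>" by (auto simp: isomorphic_def)
  note v = vertex_point[OF P_pointed]
  have "morphism ?X ?Y \<phi>" using iso by (simp add: inverse_morphisms_def)
  from morphism_point[OF this v] have "\<phi> (vertex P) \<in> points ?Y" .
  then have "tangent_dim_le_2 ?Y (\<phi> (vertex P))" by (rule smooth_tangent_dim[OF L])
  then have "tangent_dim_le_2 ?X (vertex P)" by (rule tangent_dim_le_2_iso[OF iso v])
  then show False using vertex_singular by blast
qed

lemma automorphism_fixes_vertex:
  fixes X :: "(_, 'k::field_char_0) variety"
  defines "X \<equiv> toric_variety P"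
  assumes iso: "inverse_morphisms X X \<phi> \<psi>"
  shows "\<phi> (vertex P) = vertex P"
proof (rule ccontr)
  assume ne: "\<phi> (vertex P) \<noteq> vertex P"
  note v = vertex_point[OF P_pointed, where 'k = 'k]
  have "morphism X X \<phi>" using iso by (simp add: inverse_morphisms_def)
  from morphism_point[OF this[unfolded X_def] v] have "\<phi> (vertex P) \<in> points (toric_variety P)" .
  then have "tangent_dim_le_2 X (\<phi> (vertex P))"
    unfolding X_def using ne by (rule nonvertex_smooth)
  then have "tangent_dim_le_2 X (vertex P)"
    by (rule tangent_dim_le_2_iso[OF iso v[folded X_def]])
  then show False using vertex_singular unfolding X_def by blast
qed

section \<open>The non-normal monoid: finiteness, generation and normalization\<close>

lemma S_subset: "S \<subseteq> P"
  unfolding S_def decomposables_def using P_add is_submonoid_zero[OF P_submonoid] by blast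

lemma S_addI: "a \<in> P \<Longrightarrow> b \<in> P \<Longrightarrow> a \<noteq> 0 \<Longrightarrow> b \<noteq> 0 \<Longrightarrow> a + b \<in> S"
  unfolding S_def decomposables_def by blast

lemma S_cases:
  assumes "m \<in> S"
  obtains "m = 0" | a b where "m = a + b" "a \<in> P" "b \<in> P" "a \<noteq> 0" "b \<noteq> 0"
  using assms unfolding S_def decomposables_def by blast

lemma S_submonoid: "is_submonoid S"
  unfolding is_submonoid_def
proof (intro conjI ballI)
  show "0 \<in> S" by (simp add: S_def decomposables_def)
  fix m n assume m: "m \<in> S" and n: "n \<in> S"
  show "m + n \<in> S"
  proof (cases "m = 0 \<or> n = 0")
    case True
    then show ?thesis using m n by auto
  next
    case False
    then show ?thesis using S_addI m n S_subset by blast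
  qed
qed

lemma finite_K: "finite K"
proof (rule inj_on_finite)
  show "inj_on (\<lambda>m. (l1 m, l2 m)) K" by (rule inj_onI) (simp add: l_inj)
  show "(\<lambda>m. (l1 m, l2 m)) ` K \<subseteq> {0..D} \<times> {0..D}" by (auto simp: K_def P_iff)
qed simp

text \<open>One step of a descent on \<open>l1\<close> + \<open>l2\<close>. The remainder stays
  nonzero, so the descent ends inside K.\<close>

lemma K_step:
  assumes m: "m \<in> P" "m \<noteq> 0" "m \<notin> K"
  obtains a b where "m = a + b" "a \<in> K" "b \<in> P" "b \<noteq> 0" "l1 b + l2 b < l1 m + l2 m"
proof -
  have K: "p1 \<in> K" "p2 \<in> K" using pq_in_P p_nonzero l_p D by (auto simp: K_def)
  have "D < l1 m \<or> D < l2 m" using m by (auto simp: K_def)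
  then show thesis
  proof
    assume "D < l1 m"
    moreover have "m - p1 \<noteq> 0" using calculation l_p by auto
    ultimately show thesis using that[of p1 "m - p1"] K(1) m(1) l_p D l_diff[of m p1] by (simp add: P_iff)
  next
    assume "D < l2 m"
    moreover have "m - p2 \<noteq> 0" using calculation l_p by auto
    ultimately show thesis using that[of p2 "m - p2"] K(2) m(1) l_p D l_diff[of m p2] by (simp add: P_iff)
  qed
qed

text \<open>A point beyond the parallelogram splits off p1 or p2 with a nonzero remainder. The
  resulting finiteness of P - S gives the finiteness of the normalization.\<close>

lemma P_minus_S: "P - S \<subseteq> K"
proof
  fix m assume m: "m \<in> P - S"
  show "m \<in> K"
  proof (rule ccontr)
    assume nK: "m \<notin> K"
    have "m \<noteq> 0" using m is_submonoid_zero[OF S_submonoid] by auto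
    then obtain a b where "m = a + b" "a \<in> K" "b \<in> P" "b \<noteq> 0" using K_step m nK by blast
    then have "m \<in> S" using S_addI[of a b] by (simp add: K_def)
    then show False using m by blast
  qed
qed

text \<open>Nonzero elements of S are sums of at least two elements of K. Such a sum can be cut into
  blocks of two, with a last block of three if the length is odd, so sums of two or three elements
  of K generate S.\<close>

lemma S_affine: "affine_monoid S"
proof -
  define G where "G = (\<lambda>(a, b). a + b) ` (K \<times> K) \<union> (\<lambda>(a, b, c). a + b + c) ` (K \<times> K \<times> K)"
  have "finite G" by (simp add: G_def finite_K)
  have G2: "a + b \<in> G" if "a \<in> K" "b \<in> K" for a b using that by (force simp: G_def)
  have G3: "a + b + c \<in> G" if "a \<in> K" "b \<in> K" "c \<in> K" for a b c using that by (force simp: G_def)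
  have hullm: "is_submonoid (is_submonoid hull G)"
    by (rule hull_in) (auto simp: is_submonoid_def)
  have sums: "\<exists>L. L \<noteq> [] \<and> set L \<subseteq> K \<and> sum_list L = m" if "m \<in> P" "m \<noteq> 0" for m
    using that
  proof (induction "nat (l1 m + l2 m)" arbitrary: m rule: less_induct)
    case less
    show ?case
    proof (cases "m \<in> K")
      case True
      then show ?thesis by (intro exI[of _ "[m]"]) simp
    next
      case False
      then obtain a b where ab: "m = a + b" "a \<in> K" "b \<in> P" "b \<noteq> 0" "l1 b + l2 b < l1 m + l2 m"
        using K_step less.prems by blast
      then have "nat (l1 b + l2 b) < nat (l1 m + l2 m)"
        using P_pos[of b] by simp
      from less.hyps[OF this ab(3,4)] obtain L where "L \<noteq> []" "set L \<subseteq> K" "sum_list L = b" by blast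
      then show ?thesis using ab by (intro exI[of _ "a # L"]) simp
    qed
  qed
  have long: "sum_list L \<in> is_submonoid hull G" if "2 \<le> length L" "set L \<subseteq> K" for L
    using that
  proof (induction "length L" arbitrary: L rule: less_induct)
    case less
    obtain a b L' where L: "L = a # b # L'" using less.prems(1) by (cases L; cases "tl L") auto
    have ab: "a \<in> K" "b \<in> K" using less.prems(2) L by auto
    consider "L' = []" | c where "L' = [c]" | "2 \<le> length L'" by (cases L'; cases "tl L'") auto
    then show ?case
    proof cases
      case 1
      then show ?thesis using G2[OF ab] hull_inc[of _ G] by (simp add: L)
    next
      case (2 c)
      then have "c \<in> K" using less.prems(2) L by auto
      then show ?thesis using G3[OF ab, of c] hull_inc[of _ G] 2 by (simp add: L add.assoc)
    next
      case 3
      have "sum_list L' \<in> is_submonoid hull G" using less.hyps[of L'] 3 less.prems(2) L by simp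
      moreover have "a + b \<in> is_submonoid hull G" using G2[OF ab] hull_inc[of _ G] by blast
      ultimately have "(a + b) + sum_list L' \<in> is_submonoid hull G" by (intro is_submonoid_add[OF hullm, of "a + b"])
      then show ?thesis by (simp add: L add.assoc)
    qed
  qed
  have "S \<subseteq> is_submonoid hull G"
  proof
    fix m assume "m \<in> S"
    then show "m \<in> is_submonoid hull G"
    proof (cases rule: S_cases)
      case 1
      then show ?thesis using is_submonoid_zero[OF hullm] by simp
    next
      case (2 a b)
      obtain L where L: "L \<noteq> []" "set L \<subseteq> K" "sum_list L = a" using sums 2 by blast
      obtain M where M: "M \<noteq> []" "set M \<subseteq> K" "sum_list M = b" using sums 2 by blast
      have "1 \<le> length L" "1 \<le> length M" using L(1) M(1) by (simp_all add: Suc_le_eq)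
      then have "2 \<le> length (L @ M)" by simp
      then show ?thesis using long[of "L @ M"] L M 2(1) by simp
    qed
  qed
  moreover have "is_submonoid hull G \<subseteq> S"
  proof (rule hull_minimal)
    have K: "a \<in> P \<and> a \<noteq> 0" if "a \<in> K" for a using that by (simp add: K_def)
    have "a + b \<in> S" if "a \<in> K" "b \<in> K" for a b using S_addI K that by blast
    moreover have "a + b + c \<in> S" if "a \<in> K" "b \<in> K" "c \<in> K" for a b c
      using S_addI[of "a + b" c] K that P_add P_add_eq_zero by metis
    ultimately show "G \<subseteq> S" by (auto simp: G_def)
  qed (rule S_submonoid)
  ultimately show ?thesis using \<open>finite G\<close> unfolding affine_monoid_def by blast
qed

text \<open>For nonzero m in P both 2m and 3m lie in S and differ by m, and every lattice vector is
  a difference of two elements of P.\<close>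

lemma S_generates: "is_subgroup hull S = UNIV"
proof -
  let ?T = "is_subgroup hull S"
  have T: "is_subgroup ?T" by (rule hull_in) (auto simp: is_subgroup_def is_submonoid_def)
  have diff: "a - b \<in> ?T" if "a \<in> ?T" "b \<in> ?T" for a b
  proof -
    have "- b \<in> ?T" using T that(2) unfolding is_subgroup_def by blast
    then have "a + - b \<in> ?T" using T that(1) by (intro is_submonoid_add) (simp_all only: is_subgroup_def)
    then show ?thesis by simp
  qed
  have ST: "a \<in> ?T" if "a \<in> S" for a using that by (rule hull_inc)
  have PT: "m \<in> ?T" if m: "m \<in> P" for m
  proof (cases "m = 0")
    case True
    then show ?thesis using ST is_submonoid_zero[OF S_submonoid] by blast
  next
    case False
    then have "m + m \<noteq> 0" using P_add_eq_zero m by blast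
    then have "(m + m) + m - (m + m) \<in> ?T"
      using False m by (intro diff ST S_addI P_add) auto
    then show ?thesis by simp
  qed
  have "m \<in> ?T" for m
  proof -
    \<comment> \<open>A multiple of p1 + p2 large enough to move m into P.\<close>
    define n where "n = multiple (nat (\<bar>l1 m\<bar> + \<bar>l2 m\<bar>)) (p1 + p2)"
    have n: "l1 n = (\<bar>l1 m\<bar> + \<bar>l2 m\<bar>) * D" "l2 n = (\<bar>l1 m\<bar> + \<bar>l2 m\<bar>) * D"
      by (simp_all add: n_def l_multiple l_add l_p)
    have "(\<bar>l1 m\<bar> + \<bar>l2 m\<bar>) * 1 \<le> (\<bar>l1 m\<bar> + \<bar>l2 m\<bar>) * D" using D by (intro mult_left_mono) auto
    then have "n \<in> P" "m + n \<in> P" by (auto simp: P_iff l_add n)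
    then show ?thesis using diff[OF PT PT, of "m + n" n] by simp
  qed
  then show ?thesis by blast
qed

lemma p1_not_in_S: "p1 \<notin> S"
proof
  assume "p1 \<in> S"
  then show False
    by (cases rule: S_cases) (use p_nonzero indecomposable_p1 in \<open>auto simp: indecomposable_def\<close>)
qed

text \<open>The fraction of the monomials of 3 p1 and 2 p1 is the monomial of p1. Its square lies in
  k[S], so it is integral, but p1 is not in S.\<close>

lemma S_not_normal: "\<not> normal_variety (toric_variety S :: (_, 'k::field_char_0) variety)"
proof
  let ?Y = "toric_variety S :: (_, 'k) variety"
  assume normal: "normal_variety ?Y"
  have pp: "p1 + p1 \<in> P" "p1 + p1 \<noteq> 0" using P_add P_add_eq_zero pq_in_P p_nonzero by blast+
  have mem: "p1 + p1 \<in> S" "p1 + p1 + p1 \<in> S"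
    using S_addI pp pq_in_P p_nonzero by blast+
  define a b where "a y = y (chi (p1 + p1 + p1))" and "b y = y (chi (p1 + p1))"
    for y :: "(lattice \<Rightarrow>\<^sub>0 'k) \<Rightarrow> 'k"
  have reg: "a \<in> reg_fun ?Y" "b \<in> reg_fun ?Y"
    unfolding a_def b_def using mem by (auto intro: reg_fun_eval malg_single)
  have "\<exists>y\<in>points ?Y. b y \<noteq> 0"
    unfolding b_def by (rule toric_nonzero_point[OF S_submonoid malg_single[OF mem(1)]])
      (metis lookup_single_eq lookup_zero one_neq_zero)
  moreover have "\<exists>n c. (\<forall>i<n. c i \<in> reg_fun ?Y) \<and>
      (\<forall>y\<in>points ?Y. a y ^ n + (\<Sum>i<n. c i y * a y ^ i * b y ^ (n - i)) = 0)"
  proof (intro exI conjI allI impI ballI)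
    \<comment> \<open>Degree 2 with c 0 = - b and c 1 = 0: after multiplication by b^2 the equation
      reads a^2 = b b^2.\<close>
    fix i :: nat assume "i < 2"
    show "(\<lambda>y. if i = 0 then - b y else 0) \<in> reg_fun ?Y"
    proof (cases "i = 0")
      case True
      have "(\<lambda>y. (-1) * b y) \<in> reg_fun ?Y"
        by (intro reg_fun_mult[OF S_submonoid] reg_fun_const[OF S_submonoid] reg)
      then show ?thesis using True by simp
    next
      case False
      then show ?thesis using reg_fun_const[OF S_submonoid, of 0] by simp
    qed
  next
    fix y assume y: "y \<in> points ?Y"
    have "a y * a y = y (chi ((p1 + p1 + p1) + (p1 + p1 + p1)))"
      unfolding a_def using mem by (intro point_chi_add[OF S_submonoid y, symmetric])
    also have "(p1 + p1 + p1) + (p1 + p1 + p1) = (p1 + p1) + ((p1 + p1) + (p1 + p1))"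
      by (simp add: add.assoc)
    also have "y (chi \<dots>) = b y * (b y * b y)"
      unfolding b_def using mem is_submonoid_add[OF S_submonoid mem(1,1)]
      by (simp add: point_chi_add[OF S_submonoid y])
    finally have "a y * a y = b y * (b y * b y)" .
    then show "a y ^ 2 + (\<Sum>i<2. (if i = 0 then - b y else 0) * a y ^ i * b y ^ (2 - i)) = 0"
      by (simp add: power2_eq_square lessThan_nat_numeral)
  qed
  ultimately obtain q where q: "q \<in> reg_fun ?Y" "\<forall>y\<in>points ?Y. a y = q y * b y"
    using normal reg unfolding normal_variety_def by blast
  obtain f where f: "f \<in> monoid_algebra S" "\<And>y. y \<in> points ?Y \<Longrightarrow> q y = y f"
    using q(1) by (rule reg_fun_obtain) blast
  have "chi (p1 + p1 + p1) = f * chi (p1 + p1)"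
  proof (rule toric_reduced[OF S_submonoid malg_single[OF mem(2)] malg_mult[OF S_submonoid f(1) malg_single[OF mem(1)]]])
    fix y :: "(lattice \<Rightarrow>\<^sub>0 'k) \<Rightarrow> 'k" assume y: "y \<in> points ?Y"
    then show "y (chi (p1 + p1 + p1)) = y (f * chi (p1 + p1))"
      using q(2) f(2) point_mult[OF y f(1) malg_single[OF mem(1)]] by (simp add: a_def b_def)
  qed
  then have "chi (p1 + p1) * chi p1 = chi (p1 + p1) * f"
    by (simp only: mult_single mult.commute[of _ f]) simp
  then have "chi p1 = f" by (rule chi_mult_cancel)
  then have "p1 \<in> S" using f(1) by (auto simp: malg_iff)
  then show False using p1_not_in_S by blast
qed

lemma inclusion_normalization:
  "is_normalization (toric_variety P :: (_, 'k::field_char_0) variety) (toric_variety S) (toric_inclusion S)"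
proof -
  let ?X = "toric_variety P :: (_, 'k) variety" and ?Y = "toric_variety S :: (_, 'k) variety"
  let ?\<nu> = "toric_inclusion S :: ((lattice \<Rightarrow>\<^sub>0 'k) \<Rightarrow> 'k) \<Rightarrow> _"
  note SP = subsetD[OF malg_mono[OF S_subset]]
  have \<nu>pt: "?\<nu> x \<in> points ?Y" if "x \<in> points ?X" for x
    using points_restrict[OF S_subset S_submonoid that] .
  have \<nu>: "?\<nu> x f = x f" if "f \<in> monoid_algebra S" for x f
    using that by (simp add: toric_inclusion_def)
  have mor: "morphism ?X ?Y ?\<nu>"
    unfolding morphism_def
  proof (intro conjI ballI)
    show "?\<nu> ` points ?X \<subseteq> points ?Y" using \<nu>pt by blast
    fix F assume "F \<in> reg_fun ?Y"
    then obtain f where f: "f \<in> monoid_algebra S" "\<And>y. y \<in> points ?Y \<Longrightarrow> F y = y f"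
      by (rule reg_fun_obtain) blast
    show "F \<circ> ?\<nu> \<in> reg_fun ?X"
      by (rule reg_funI[OF SP[OF f(1)]]) (simp add: f \<nu>pt \<nu>)
  qed
  have "normal_variety ?X"
  proof (rule toric_normal[of "{l1, l2}"])
    show "l (m + n) = l m + l n" if "l \<in> {l1, l2}" for l m n using that l_add by blast
  qed (simp add: P_def)
  moreover have "finite_morphism ?X ?Y ?\<nu>"
    unfolding finite_morphism_def
  proof (intro conjI mor)
    \<comment> \<open>Exponents of module generators: 0 and the finitely many elements of P missing
      from S.\<close>
    define H where "H = insert 0 (P - S)"
    define ev where "ev m = (\<lambda>x :: (lattice \<Rightarrow>\<^sub>0 'k) \<Rightarrow> 'k. x (chi m))" for m
    have HP: "H \<subseteq> P" using is_submonoid_zero[OF P_submonoid] by (auto simp: H_def)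
    have "finite H" using finite_subset[OF P_minus_S finite_K] by (simp add: H_def)
    \<comment> \<open>The generators are functions on X, and the coefficients are indexed by these
      functions, so the exponent has to be recovered from the function.\<close>
    have inj: "inj_on ev H"
    proof (rule inj_onI)
      fix m n assume mn: "m \<in> H" "n \<in> H" "ev m = ev n"
      have "(chi m :: lattice \<Rightarrow>\<^sub>0 'k) = chi n"
        by (rule toric_reduced[OF P_submonoid malg_single malg_single])
          (use mn HP in \<open>auto simp: ev_def dest: fun_cong\<close>)
      then show "m = n" by (metis keys_single singleton_inject one_neq_zero)
    qed
    show "\<exists>G. finite G \<and> G \<subseteq> reg_fun ?X \<and> (\<forall>F\<in>reg_fun ?X. \<exists>c. (\<forall>g\<in>G. c g \<in> reg_fun ?Y) \<and>
        (\<forall>x\<in>points ?X. F x = (\<Sum>g\<in>G. c g (?\<nu> x) * g x)))"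
    proof (intro exI[of _ "ev ` H"] conjI ballI)
      show "finite (ev ` H)" using \<open>finite H\<close> by simp
      show "ev ` H \<subseteq> reg_fun ?X" using HP by (auto simp: ev_def intro!: reg_fun_eval malg_single)
      fix F assume "F \<in> reg_fun ?X"
      then obtain f where f: "f \<in> monoid_algebra P" "\<And>x. x \<in> points ?X \<Longrightarrow> F x = x f"
        by (rule reg_fun_obtain) blast
      define s where "s = (\<Sum>m\<in>Poly_Mapping.keys f \<inter> S. Poly_Mapping.single m (Poly_Mapping.lookup f m))"
      have s: "s \<in> monoid_algebra S" unfolding s_def by (intro malg_sum malg_single) blast
      have split: "f = s + (\<Sum>m\<in>P - S. Poly_Mapping.single m (Poly_Mapping.lookup f m))"
      proof -
        have "(\<Sum>m\<in>P - S. Poly_Mapping.single m (Poly_Mapping.lookup f m)) =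
            (\<Sum>m\<in>Poly_Mapping.keys f - S. Poly_Mapping.single m (Poly_Mapping.lookup f m))"
          using f(1) finite_subset[OF P_minus_S finite_K]
          by (intro sum.mono_neutral_right) (auto simp: malg_iff in_keys_iff)
        then show ?thesis
          unfolding s_def by (subst poly_mapping_sum_single[of f], subst sum.Int_Diff[of _ _ S]) simp_all
      qed
      \<comment> \<open>The generator 1 takes the part of f supported in S as its coefficient; the
        other coefficients are constants.\<close>
      define c where "c g = (if g = ev 0 then (\<lambda>y. y s)
        else (\<lambda>y. Poly_Mapping.lookup f (the_inv_into H ev g)))" for g
      show "\<exists>c. (\<forall>g\<in>ev ` H. c g \<in> reg_fun ?Y) \<and> (\<forall>x\<in>points ?X. F x = (\<Sum>g\<in>ev ` H. c g (?\<nu> x) * g x))"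
      proof (intro exI[of _ c] conjI ballI)
        show "c g \<in> reg_fun ?Y" for g
          using s by (auto simp: c_def intro: reg_fun_eval reg_fun_const[OF S_submonoid])
        fix x assume x: "x \<in> points ?X"
        have "0 \<notin> P - S" using is_submonoid_zero[OF S_submonoid] by blast
        have "0 \<in> H" by (simp add: H_def)
        have "(\<Sum>g\<in>ev ` H. c g (?\<nu> x) * g x) = (\<Sum>m\<in>H. c (ev m) (?\<nu> x) * ev m x)"
          by (simp add: sum.reindex[OF inj])
        also have "\<dots> = c (ev 0) (?\<nu> x) * ev 0 x + (\<Sum>m\<in>P - S. c (ev m) (?\<nu> x) * ev m x)"
          unfolding H_def using \<open>finite H\<close> \<open>0 \<notin> P - S\<close> by (subst sum.insert) (simp_all add: H_def)
        also have "c (ev 0) (?\<nu> x) * ev 0 x = x s"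
          using point_one[OF x] \<nu>[OF s] by (simp add: c_def ev_def)
        also have "(\<Sum>m\<in>P - S. c (ev m) (?\<nu> x) * ev m x) =
            (\<Sum>m\<in>P - S. x (Poly_Mapping.single m (Poly_Mapping.lookup f m)))"
        proof (rule sum.cong)
          fix m assume m: "m \<in> P - S"
          then have "m \<in> H" "m \<noteq> 0" using \<open>0 \<notin> P - S\<close> by (auto simp: H_def)
          then have "ev m \<noteq> ev 0" using inj_onD[OF inj] \<open>0 \<in> H\<close> by blast
          then have "c (ev m) (?\<nu> x) = Poly_Mapping.lookup f m"
            using the_inv_into_f_f[OF inj \<open>m \<in> H\<close>] by (simp add: c_def)
          moreover have "x (Poly_Mapping.single m (Poly_Mapping.lookup f m)) = Poly_Mapping.lookup f m * x (chi m)"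
            using m by (intro point_single[OF P_submonoid x]) simp
          ultimately show "c (ev m) (?\<nu> x) * ev m x = x (Poly_Mapping.single m (Poly_Mapping.lookup f m))"
            by (simp only: ev_def)
        qed simp
        also have "\<dots> = x (\<Sum>m\<in>P - S. Poly_Mapping.single m (Poly_Mapping.lookup f m))"
          by (rule point_sum[OF x, symmetric]) (simp add: malg_single)
        also have "x s + \<dots> = x f"
          by (subst (2) split) (intro point_add[OF x, symmetric] SP s malg_sum malg_single; simp)
        also have "\<dots> = F x" using f(2)[OF x] by simp
        finally show "F x = (\<Sum>g\<in>ev ` H. c g (?\<nu> x) * g x)" ..
      qed
    qed
  qed
  moreover have "birational_morphism ?X ?Y ?\<nu>"
    unfolding birational_morphism_def
  proof (intro conjI mor ballI impI)
    fix F y assume F: "F \<in> reg_fun ?Y" and z: "\<forall>x\<in>points ?X. F (?\<nu> x) = 0" and y: "y \<in> points ?Y"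
    obtain f where f: "f \<in> monoid_algebra S" "\<And>y. y \<in> points ?Y \<Longrightarrow> F y = y f"
      using F by (rule reg_fun_obtain) blast
    have "f = 0"
    proof (rule toric_reduced[OF P_submonoid SP[OF f(1)] malg_zero])
      fix x :: "(lattice \<Rightarrow>\<^sub>0 'k) \<Rightarrow> 'k" assume x: "x \<in> points ?X"
      then show "x f = x 0" using z f(2)[OF \<nu>pt[OF x]] \<nu>[OF f(1)] point_zero[OF x] by simp
    qed
    then show "F y = 0" using f(2)[OF y] point_zero[OF y] by simp
  next
    fix F assume "F \<in> reg_fun ?X"
    then obtain f where f: "f \<in> monoid_algebra P" "\<And>x. x \<in> points ?X \<Longrightarrow> F x = x f"
      by (rule reg_fun_obtain) blast
    have pp: "p1 + p1 \<in> S" using S_addI pq_in_P p_nonzero by blast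
    \<comment> \<open>The monomial of 2 p1 is a common denominator: m + 2 p1 = (m + p1) + p1 is in S
      for every m in P.\<close>
    have fS: "f * chi (p1 + p1) \<in> monoid_algebra S"
    proof (rule malg_mult_subset[OF f(1) malg_single[of "p1 + p1" "{p1 + p1}"]])
      fix m n assume "m \<in> P" "n \<in> {p1 + p1}"
      then show "m + n \<in> S"
        using S_addI[of "m + p1" p1] P_add P_add_eq_zero pq_in_P p_nonzero
        by (metis add.assoc singletonD)
    qed simp
    show "\<exists>a\<in>reg_fun ?Y. \<exists>b\<in>reg_fun ?Y. (\<exists>y\<in>points ?Y. b y \<noteq> 0) \<and>
        (\<forall>x\<in>points ?X. F x * b (?\<nu> x) = a (?\<nu> x))"
    proof (rule bexI[of _ "\<lambda>y. y (f * chi (p1 + p1))"], rule bexI[of _ "\<lambda>y. y (chi (p1 + p1))"],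
        intro conjI ballI)
      show "(\<lambda>y. y (f * chi (p1 + p1))) \<in> reg_fun ?Y" using fS by (rule reg_fun_eval)
      show "(\<lambda>y. y (chi (p1 + p1))) \<in> reg_fun ?Y" using pp by (intro reg_fun_eval malg_single)
      show "\<exists>y\<in>points ?Y. y (chi (p1 + p1)) \<noteq> 0"
        by (rule toric_nonzero_point[OF S_submonoid malg_single[OF pp]])
          (metis lookup_single_eq lookup_zero one_neq_zero)
      fix x assume x: "x \<in> points ?X"
      show "F x * ?\<nu> x (chi (p1 + p1)) = ?\<nu> x (f * chi (p1 + p1))"
        using point_mult[OF x f(1) SP[OF malg_single[OF pp]]] f(2)[OF x] \<nu>[OF fS] \<nu>[OF malg_single[OF pp]]
        by simp
    qed
  qed
  ultimately show ?thesis by (simp add: is_normalization_def)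
qed

lemma Aut_lifts:
  fixes X :: "(_, 'k::field_char_0) variety"
  defines "X \<equiv> toric_variety P"
  shows "Aut X = lifted_Aut X (toric_variety S) (toric_inclusion S)"
  unfolding X_def
proof (rule Aut_eq_lifted_Aut[OF S_subset S_submonoid P_submonoid])
  fix \<phi> \<psi> :: "((lattice \<Rightarrow>\<^sub>0 'k) \<Rightarrow> 'k) \<Rightarrow> (lattice \<Rightarrow>\<^sub>0 'k) \<Rightarrow> 'k"
    and f :: "lattice \<Rightarrow>\<^sub>0 'k"
  assume inv': "inverse_morphisms (toric_variety P) (toric_variety P) \<phi> \<psi>" and f: "f \<in> monoid_algebra S"
  have inv: "inverse_morphisms X X \<phi> \<psi>" using inv' by (simp add: X_def)
  have \<phi>: "\<phi> x \<in> points (toric_variety P)" if "x \<in> points (toric_variety P)" for x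
    using inv that by (auto simp: X_def inverse_morphisms_def morphism_def)
  have pull: "\<exists>g\<in>monoid_algebra P. \<forall>x\<in>points (toric_variety P). x g = \<phi> x h"
    if h: "h \<in> monoid_algebra P" for h
  proof -
    have "morphism X X \<phi>" using inv by (simp add: inverse_morphisms_def)
    from morphism_reg_fun[OF this, unfolded X_def, OF reg_fun_eval[OF h]]
    show ?thesis by (auto simp: reg_fun_toric)
  qed
  \<comment> \<open>A nontrivial monomial vanishes at the vertex, which \<phi> fixes, so its
    pull-back has no constant term.\<close>
  have max: "\<exists>g\<in>monoid_algebra (P - {0}). \<forall>x\<in>points (toric_variety P). x g = \<phi> x (chi m)"
    if m: "m \<in> P" "m \<noteq> 0" for m
  proof -
    obtain g where g: "g \<in> monoid_algebra P" "\<And>x. x \<in> points (toric_variety P) \<Longrightarrow> x g = \<phi> x (chi m)"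
      using pull[OF malg_single[OF m(1)]] by blast
    have "Poly_Mapping.lookup g 0 = vertex P g" using vertex_apply[OF g(1)] by simp
    also have "\<dots> = vertex P (chi m)"
      using g(2)[OF vertex_point[OF P_pointed]] automorphism_fixes_vertex[OF inv[unfolded X_def]] by simp
    also have "\<dots> = 0" using m by (simp add: vertex_apply malg_single lookup_single when_def)
    finally have "g \<in> monoid_algebra (P - {0})" using g(1) by (auto simp: malg_iff in_keys_iff)
    then show ?thesis using g(2) by blast
  qed
  show "\<exists>g\<in>monoid_algebra S. \<forall>x\<in>points (toric_variety P). x g = \<phi> x f"
    using f
  proof (induction f rule: malg_induct)
    case zero
    show ?case
    proof (intro bexI[of _ 0] ballI malg_zero)
      fix x :: "(lattice \<Rightarrow>\<^sub>0 'k) \<Rightarrow> 'k" assume x: "x \<in> points (toric_variety P)"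
      show "x 0 = \<phi> x 0" using point_zero[OF x] point_zero[OF \<phi>[OF x]] by simp
    qed
  next
    case (single m c)
    have "\<exists>g\<in>monoid_algebra S. \<forall>x\<in>points (toric_variety P). x g = \<phi> x (chi m)"
      using single
    proof (cases rule: S_cases)
      case 1
      show ?thesis
      proof (intro bexI[of _ 1] ballI malg_one[OF S_submonoid])
        fix x :: "(lattice \<Rightarrow>\<^sub>0 'k) \<Rightarrow> 'k" assume x: "x \<in> points (toric_variety P)"
        show "x 1 = \<phi> x (chi m)" using point_one[OF x] point_one[OF \<phi>[OF x]] 1 by simp
      qed
    next
      case (2 a b)
      obtain g where g: "g \<in> monoid_algebra (P - {0})"
        "\<And>x. x \<in> points (toric_variety P) \<Longrightarrow> x g = \<phi> x (chi a)" using max[OF 2(2,4)] by blast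
      obtain h where h: "h \<in> monoid_algebra (P - {0})"
        "\<And>x. x \<in> points (toric_variety P) \<Longrightarrow> x h = \<phi> x (chi b)" using max[OF 2(3,5)] by blast
      \<comment> \<open>This is where the square of the maximal ideal enters: both factors have
        their support in P - {0}, so all exponents of the product are sums of two nonzero
        elements.\<close>
      have "g * h \<in> monoid_algebra S"
        by (rule malg_mult_subset[OF g(1) h(1)]) (use S_addI in blast)
      moreover have "x (g * h) = \<phi> x (chi m)" if x: "x \<in> points (toric_variety P)" for x
      proof -
        have "g \<in> monoid_algebra P" "h \<in> monoid_algebra P" using g(1) h(1) by (auto simp: malg_iff)
        then have "x (g * h) = x g * x h" by (rule point_mult[OF x])
        also have "\<dots> = \<phi> x (chi a) * \<phi> x (chi b)" using g(2)[OF x] h(2)[OF x] by simp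
        also have "\<dots> = \<phi> x (chi m)"
          unfolding 2(1) using 2 by (intro point_chi_add[OF P_submonoid \<phi>[OF x], symmetric])
        finally show ?thesis .
      qed
      ultimately show ?thesis by blast
    qed
    then obtain g where g: "g \<in> monoid_algebra S"
      "\<And>x. x \<in> points (toric_variety P) \<Longrightarrow> x g = \<phi> x (chi m)" by blast
    show ?case
    proof (intro bexI[of _ "Poly_Mapping.single 0 c * g"] ballI)
      show gS: "Poly_Mapping.single 0 c * g \<in> monoid_algebra S"
        using g(1) by (intro malg_mult[OF S_submonoid] malg_const[OF S_submonoid])
      fix x :: "(lattice \<Rightarrow>\<^sub>0 'k) \<Rightarrow> 'k" assume x: "x \<in> points (toric_variety P)"
      have "x (Poly_Mapping.single 0 c * g) = c * x g"
        using point_mult[OF x malg_const[OF P_submonoid]] g(1) malg_mono[OF S_subset] point_const[OF x]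
        by (metis subsetD)
      also have "\<dots> = \<phi> x (Poly_Mapping.single m c)"
        using g(2)[OF x] point_single[OF P_submonoid \<phi>[OF x]] single S_subset by (metis subsetD)
      finally show "x (Poly_Mapping.single 0 c * g) = \<phi> x (Poly_Mapping.single m c)" .
    qed
  next
    case (add f1 f2)
    obtain g1 where g1: "g1 \<in> monoid_algebra S"
      "\<And>x. x \<in> points (toric_variety P) \<Longrightarrow> x g1 = \<phi> x f1" using add by blast
    obtain g2 where g2: "g2 \<in> monoid_algebra S"
      "\<And>x. x \<in> points (toric_variety P) \<Longrightarrow> x g2 = \<phi> x f2" using add by blast
    note SP = subsetD[OF malg_mono[OF S_subset]]
    show ?case
    proof (intro bexI[of _ "g1 + g2"] ballI malg_add g1 g2)
      fix x :: "(lattice \<Rightarrow>\<^sub>0 'k) \<Rightarrow> 'k" assume x: "x \<in> points (toric_variety P)"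
      show "x (g1 + g2) = \<phi> x (f1 + f2)"
        unfolding point_add[OF x SP[OF g1(1)] SP[OF g2(1)]] point_add[OF \<phi>[OF x] SP[OF add(1)] SP[OF add(2)]]
        using g1(2)[OF x] g2(2)[OF x] by simp
    qed
  qed
qed

end

section \<open>The equivalence, by the four shapes of the dual cone\<close>

theorem theorem4p5:
  fixes \<sigma> :: "(rat \<times> rat) set"
    and X\<^sub>\<sigma> :: "((lattice \<Rightarrow>\<^sub>0 'k::{alg_closed_field, field_char_0}) \<Rightarrow> 'k, 'k) variety"
  assumes "rational_polyhedral_cone \<sigma>" and "strongly_convex \<sigma>"
    and "X\<^sub>\<sigma> = toric_variety (dual_monoid \<sigma>)"
  shows "(\<exists>S. affine_monoid S \<and> is_subgroup hull S = UNIV \<and> S \<subseteq> dual_monoid \<sigma> \<and>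
            \<not> normal_variety (toric_variety S :: (_, 'k) variety) \<and>
            is_normalization X\<^sub>\<sigma> (toric_variety S) (toric_inclusion S) \<and>
            Aut X\<^sub>\<sigma> = lifted_Aut X\<^sub>\<sigma> (toric_variety S) (toric_inclusion S))
     \<longleftrightarrow>
         (\<not> isomorphic X\<^sub>\<sigma> ((mult_group :: ('k, 'k) variety) \<times>\<^sub>v mult_group) \<and>
          \<not> isomorphic X\<^sub>\<sigma> ((mult_group :: ('k, 'k) variety) \<times>\<^sub>v affine_line) \<and>
          \<not> isomorphic X\<^sub>\<sigma> ((affine_line :: ('k, 'k) variety) \<times>\<^sub>v affine_line))"
    (is "?L \<longleftrightarrow> ?R")
proof -
  have Lm: "line_exponents (mult_group :: ('k, 'k) variety) UNIV"
    and La: "line_exponents (affine_line :: ('k, 'k) variety) {0..}"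
    by (simp_all add: line_exponents_def)
  have submonoid: "is_submonoid S" if S: "affine_monoid S" for S
  proof -
    obtain G where "S = is_submonoid hull G" using S unfolding affine_monoid_def by blast
    moreover have "is_submonoid (is_submonoid hull G)" by (rule hull_in) (auto simp: is_submonoid_def)
    ultimately show ?thesis by simp
  qed
  \<comment> \<open>Common to the exceptional cases: X is normal as the source of a normalization,
    so S equal to the full monoid contradicts the non-normality of X_S.\<close>
  have none: "\<not> ?L"
    if eq: "\<And>S. \<lbrakk>is_submonoid S; S \<subseteq> dual_monoid \<sigma>; is_subgroup hull S = UNIV;
      Aut X\<^sub>\<sigma> = lifted_Aut X\<^sub>\<sigma> (toric_variety S) (toric_inclusion S)\<rbrakk> \<Longrightarrow> S = dual_monoid \<sigma>"
  proof
    assume ?L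
    then obtain S where S: "affine_monoid S" "is_subgroup hull S = UNIV" "S \<subseteq> dual_monoid \<sigma>"
      and nn: "\<not> normal_variety (toric_variety S :: (_, 'k) variety)"
      and nz: "is_normalization X\<^sub>\<sigma> (toric_variety S) (toric_inclusion S)"
      and A: "Aut X\<^sub>\<sigma> = lifted_Aut X\<^sub>\<sigma> (toric_variety S) (toric_inclusion S)" by blast
    have "S = dual_monoid \<sigma>" using eq[OF submonoid[OF S(1)] S(3,2) A] .
    then show False using nn nz assms(3) by (simp add: is_normalization_def)
  qed
  from assms(1,2) show ?thesis
  proof (cases rule: cone_cases)
    case full
    have "\<not> ?L"
      by (rule none) (use symmetric_lifted_imp_UNIV[where 'k = 'k] in \<open>simp add: assms(3) full\<close>)
    moreover have "standard.orthant UNIV UNIV = UNIV" by (simp add: standard.orthant_def)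
    then have "\<not> ?R"
      using standard.orthant_isomorphic[OF Lm Lm] by (simp add: assms(3) full)
    ultimately show ?thesis by blast
  next
    case (halfplane comb l1 l2)
    interpret lattice_coordinates comb l1 l2 by fact
    have P: "dual_monoid \<sigma> = orthant UNIV {0..}" by (auto simp: halfplane orthant_def)
    have "\<not> ?L"
      by (rule none) (use halfplane_lifted_imp_eq[where 'k = 'k] in \<open>simp add: assms(3) P\<close>)
    moreover have "\<not> ?R" using orthant_isomorphic[OF Lm La] by (simp add: assms(3) P)
    ultimately show ?thesis by blast
  next
    case (quadrant comb l1 l2)
    interpret lattice_coordinates comb l1 l2 by fact
    have P: "dual_monoid \<sigma> = orthant {0..} {0..}" by (auto simp: quadrant orthant_def)
    have "\<not> ?L"
      by (rule none) (use quadrant_lifted_imp_eq[where 'k = 'k] in \<open>simp add: assms(3) P\<close>)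
    moreover have "\<not> ?R" using orthant_isomorphic[OF La La] by (simp add: assms(3) P)
    ultimately show ?thesis by blast
  next
    case (singular l1 l2 p1 p2 q1 q2 D)
    interpret singular_cone l1 l2 p1 p2 q1 q2 D by fact
    have P: "dual_monoid \<sigma> = P" by (simp add: singular P_def)
    have "?L" unfolding assms(3) P
      using S_affine S_generates S_subset S_not_normal inclusion_normalization Aut_lifts by blast
    moreover have "?R" unfolding assms(3) P
      using not_isomorphic_smooth[OF Lm Lm] not_isomorphic_smooth[OF Lm La] not_isomorphic_smooth[OF La La]
      by blast
    ultimately show ?thesis by blast
  qed
qed

end
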